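(* Let $f^s\in[L^2(\Omega^s)]^{\rm dim}$ and $f^d\in L^2(\Omega^d)$, and let $(\boldsymbol{u}_h,\boldsymbol{p}_h)\in\boldsymbol{X}_h$, with $\boldsymbol{u}_h=(u_h,\bar u_h)$, satisfy the discrete problem $$B_h((\boldsymbol{u}_h,\boldsymbol{p}_h),(\boldsymbol{v}_h,\boldsymbol{q}_h))=\int_{\Omega^s}f^s\cdot v_h\,dx+\int_{\Omega^d}f^dq_h\,dx\qquad\forall(\boldsymbol{v}_h,\boldsymbol{q}_h)\in\boldsymbol{X}_h .$$ Then mass is conserved pointwise, i.e., $$-\nabla\cdot u_h=\chi^d\,\Pi_Qf^d\qquad\forall x\in K,\ \forall K\in\mathcal{T},$$ and $u_h$ is $H({\rm div})$-conforming, i.e., $$[\![u_h\cdot n]\!]=0\quad\forall x\in F,\ \forall F\in\mathcal{F}\setminus\mathcal{F}^I,\qquad\text{and}\qquad u_h\cdot n=\bar u_h\cdot n\quad\forall x\in F,\ \forall F\in\mathcal{F}^I .$$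
   Context: Domain. $\Omega\subset\mathbb{R}^{\rm dim}$, ${\rm dim}=2,3$, is a bounded polygonal domain divided into two non-overlapping regions $\Omega^s$, $\Omega^d$ (unions of polygonal subdomains), $\Omega=\Omega^s\cup\Omega^d$, with polygonal interface $\Gamma^I$. $\Gamma^s:=\partial\Omega\cap\partial\Omega^s$, $\Gamma^d:=\partial\Omega\cap\partial\Omega^d$. $\mu,\kappa,\alpha>0$ are constants (viscosity, permeability, slip parameter), and $\chi^d$ is the characteristic function with value $1$ in $\Omega^d$ and $0$ in $\Omega^s$. $\varepsilon(u):=(\nabla u+(\nabla u)^T)/2$; the tangential component of a vector $w$ is $w^t:=w-(w\cdot n)n$. Mesh. For $j=s,d$, $\mathcal{T}^j$ is a triangulation of $\Omega^j$ into non-overlapping cells $K$; the meshes match on $\Gamma^I$, and $\mathcal{T}:=\mathcal{T}^s\cup\mathcal{T}^d$. $h_K$ is the diameter of $K$. $\mathcal{F}$ is the set of all facets, $\mathcal{F}^I$ the set of facets on $\Gamma^I$, $\mathcal{F}^j$ the set of facets in $\overline{\Omega}^j$, $\Gamma_0^j$ the union of the facets in $\mathcal{F}^j$. $n$ is the unit normal vector on a facet $F$; $n^j$ is the outward unit normal on $\partial K$ for $K\in\mathcal{T}^j$, which on $\Gamma^I$ is the unit normal pointing out of $\Omega^j$. $[\![\cdot]\!]$ is the usual jump operator. Spaces ($k$ is the polynomial degree of the method; $P_k(D)$ = polynomials of degree $k$ on $D$; $L^2_0(\Omega)$ = functions in $L^2(\Omega)$ with zero integral over $\Omega$). $V_h:=\{v_h\in[L^2(\Omega)]^{\rm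 dim}: v_h\in[P_k(K)]^{\rm dim}\ \forall K\in\mathcal{T}\}$; $Q_h:=\{q_h\in L^2(\Omega): q_h\in P_{k-1}(K)\ \forall K\in\mathcal{T}\}\cap L^2_0(\Omega)$; $\bar V_h:=\{\bar v_h\in[L^2(\Gamma_0^s)]^{\rm dim}:\bar v_h\in[P_k(F)]^{\rm dim}\ \forall F\in\mathcal{F}^s,\ \bar v_h=0\text{ on }\Gamma^s\}\cap[C^0(\Gamma_0^s)]^{\rm dim}$; $\bar Q_h^j:=\{\bar q_h^j\in L^2(\Gamma_0^j):\bar q_h^j\in P_k(F)\ \forall F\in\mathcal{F}^j\}$, $j=s,d$. $\boldsymbol{V}_h:=V_h\times\bar V_h\ni\boldsymbol{v}_h=(v_h,\bar v_h)$; $\boldsymbol{Q}_h:=Q_h\times\bar Q_h^s\times\bar Q_h^d\ni\boldsymbol{q}_h=(q_h,\bar q_h^s,\bar q_h^d)$; $\boldsymbol{q}_h^j:=(q_h,\bar q_h^j)$ with $q_h$ restricted to $\Omega^j$; $\boldsymbol{X}_h:=\boldsymbol{V}_h\times\boldsymbol{Q}_h$. $\Pi_Q$ is the standard $L^2$-projection operator onto $Q_h$. Forms ($\beta>0$ is a penalty parameter). $B_h((\boldsymbol{u},\boldsymbol{p}),(\boldsymbol{v},\boldsymbol{q})):=a_h(\boldsymbol{u},\boldsymbol{v})+\sum_{j=s,d}(b_h^j(\boldsymbol{p}^j,v)+b_h^{I,j}(\bar p^j,\bar v))+\sum_{j=s,d}(b_h^j(\boldsymbol{q}^j,u)+b_h^{I,j}(\bar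 q^j,\bar u))$; $a_h(\boldsymbol{u},\boldsymbol{v}):=a_h^s(\boldsymbol{u},\boldsymbol{v})+a_h^d(u,v)+a_h^I(\bar u,\bar v)$; $a_h^s(\boldsymbol{u},\boldsymbol{v}):=\sum_{K\in\mathcal{T}^s}\int_K2\mu\varepsilon(u):\varepsilon(v)\,dx+\sum_{K\in\mathcal{T}^s}\int_{\partial K}\frac{2\beta\mu}{h_K}(u-\bar u)\cdot(v-\bar v)\,ds-\sum_{K\in\mathcal{T}^s}\int_{\partial K}2\mu\varepsilon(u)n^s\cdot(v-\bar v)\,ds-\sum_{K\in\mathcal{T}^s}\int_{\partial K}2\mu\varepsilon(v)n^s\cdot(u-\bar u)\,ds$; $a_h^d(u,v):=\int_{\Omega^d}\kappa^{-1}u\cdot v\,dx$; $a_h^I(\bar u,\bar v):=\int_{\Gamma^I}\alpha\kappa^{-1/2}\bar u^t\cdot\bar v^t\,ds$; $b_h^j(\boldsymbol{p}^j,v):=-\sum_{K\in\mathcal{T}^j}\int_Kp\,\nabla\cdot v\,dx+\sum_{K\in\mathcal{T}^j}\int_{\partial K}\bar p^jv\cdot n^j\,ds$; $b_h^{I,j}(\bar p^j,\bar v):=-\int_{\Gamma^I}\bar p^j\bar v\cdot n^j\,ds$.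
   Formalization: The identity −∇·u_h = χ^d Π_Q f^d is proved assuming ∫_{Ω^d} f^d dx = 0, without which it fails on Ω^s because Q_h has zero mean; without that assumption −∇·u_h = Π_Q(χ^d f^d) is proved in every cell. *)

theory Defs
  imports "HOL-Analysis.Analysis"
begin

section \<open>Geometry: cells, facets, normals, surface integrals\<close>

text \<open>
  Cells are closed full-dimensional simplices, and a mesh is a triangulation in the sense of
  \<^const>\<open>triangulation\<close> (face-to-face). Facets are closed as well.
\<close>

definition facets :: "(real^'n) set \<Rightarrow> (real^'n) set set" where
  "facets K = {F. F facet_of K}"

definition outer_normal :: "(real^'n) set \<Rightarrow> (real^'n) set \<Rightarrow> real^'n" where
  "outer_normal K F = (THE \<nu>. norm \<nu> = 1 \<and> (\<forall>x\<in>F. \<forall>y\<in>K. \<nu> \<bullet> (y - x) \<le> 0))"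

text \<open>Unit normal of a facet on its own; its sign is irrelevant wherever it is used.\<close>

definition unit_normal :: "(real^'n) set \<Rightarrow> real^'n" where
  "unit_normal F = (SOME \<nu>. norm \<nu> = 1 \<and> (\<forall>x\<in>F. \<forall>y\<in>F. \<nu> \<bullet> (y - x) = 0))"

text \<open>
  Integration with respect to the surface measure of a flat facet. The right prism of height 1
  over \<open>F\<close> is isometric to \<open>F \<times> [0,1]\<close>, so the image of the Lebesgue measure on the prism
  under the orthogonal projection onto the hyperplane of \<open>F\<close> is exactly the
  \<open>(dim - 1)\<close>-dimensional Lebesgue (Hausdorff) measure on \<open>F\<close>.
\<close>

definition prism :: "(real^'n) set \<Rightarrow> (real^'n) set" where
  "prism F = {x + t *\<^sub>R unit_normal F | x t. x \<in> F \<and> 0 \<le> t \<and> t \<le> 1}"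

definition foot :: "(real^'n) set \<Rightarrow> real^'n \<Rightarrow> real^'n" where
  "foot F y = closest_point (affine hull F) y"

definition facet_int :: "(real^'n) set \<Rightarrow> (real^'n \<Rightarrow> real) \<Rightarrow> real" where
  "facet_int F g = integral\<^sup>L (lebesgue_on (prism F)) (\<lambda>y. g (foot F y))"

definition vol_int :: "(real^'n) set \<Rightarrow> (real^'n \<Rightarrow> real) \<Rightarrow> real" where
  "vol_int S g = integral\<^sup>L (lebesgue_on S) g"


section \<open>Function spaces and differential operators\<close>

definition L2 :: "(real^'n) set \<Rightarrow> (real^'n \<Rightarrow> 'b::euclidean_space) set" where
  "L2 S = {f. f \<in> borel_measurable (lebesgue_on S) \<and>
              integrable (lebesgue_on S) (\<lambda>x. (norm (f x))\<^sup>2)}"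

definition L2_facet :: "(real^'n) set \<Rightarrow> (real^'n \<Rightarrow> 'b::euclidean_space) set" where
  "L2_facet F = {g. (\<lambda>y. g (foot F y)) \<in> L2 (prism F)}"

text \<open>\<open>P k D\<close>: functions that coincide on \<open>D\<close> with a polynomial of total degree at most \<open>k\<close>.\<close>

definition P :: "nat \<Rightarrow> (real^'n) set \<Rightarrow> (real^'n \<Rightarrow> real) set" where
  "P k D = {f. \<exists>c :: ('n \<Rightarrow> nat) \<Rightarrow> real. \<forall>x\<in>D.
     f x = (\<Sum>a \<in> {a. (\<Sum>i\<in>UNIV. a i) \<le> k}. c a * (\<Prod>i\<in>UNIV. (x $ i) ^ a i))}"

definition Pvec :: "nat \<Rightarrow> (real^'n) set \<Rightarrow> (real^'n \<Rightarrow> real^'n) set" where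
  "Pvec k D = {f. \<forall>i. (\<lambda>x. f x $ i) \<in> P k D}"

definition grad :: "(real^'n \<Rightarrow> real^'n) \<Rightarrow> real^'n \<Rightarrow> real^'n^'n" where
  "grad u x = matrix (frechet_derivative u (at x))"

definition sym_grad :: "(real^'n \<Rightarrow> real^'n) \<Rightarrow> real^'n \<Rightarrow> real^'n^'n" where
  "sym_grad u x = (1/2) *\<^sub>R (grad u x + transpose (grad u x))"

definition divergence :: "(real^'n \<Rightarrow> real^'n) \<Rightarrow> real^'n \<Rightarrow> real" where
  "divergence u x = trace (grad u x)"

text \<open>
  Broken functions are functions on the whole space that are polynomial in the interior of
  each cell; their values on the skeleton (a null set) are arbitrary. The value on \<open>\<partial>K\<close> seen
  from \<open>K\<close> is the limit from the interior of \<open>K\<close>.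
\<close>

definition cell_trace :: "(real^'n) set \<Rightarrow> (real^'n \<Rightarrow> 'b::t2_space) \<Rightarrow> real^'n \<Rightarrow> 'b" where
  "cell_trace K u x = Lim (at x within interior K) u"

definition tangential :: "real^'n \<Rightarrow> real^'n \<Rightarrow> real^'n" where
  "tangential n w = w - (w \<bullet> n) *\<^sub>R n"


section \<open>The Stokes-Darcy setting\<close>

datatype side = Stokes | Darcy

record ('n::finite) setting =
  Omega :: "(real^'n) set"
  region :: "side \<Rightarrow> (real^'n) set"
  mesh :: "side \<Rightarrow> (real^'n) set set"
  viscosity :: real
  permeability :: real
  slip :: real
  penalty :: real
  order :: nat

abbreviation sides :: "side set" where "sides \<equiv> {Stokes, Darcy}"

definition cells :: "'n::finite setting \<Rightarrow> (real^'n) set set" where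
  "cells D = mesh D Stokes \<union> mesh D Darcy"

text \<open>
  The regions are open sets, so the decomposition of \<open>\<Omega>\<close> into \<open>\<Omega>\<^sup>s\<close> and \<open>\<Omega>\<^sup>d\<close> holds up to the
  interface. Requiring each of them to be the interior of the union of its cells (rather than
  only to have that union as its closure) excludes slit domains.
\<close>

definition stokes_darcy_setting :: "'n::finite setting \<Rightarrow> bool" where
  "stokes_darcy_setting D \<longleftrightarrow>
     (CARD('n) = 2 \<or> CARD('n) = 3) \<and>
     open (Omega D) \<and> connected (Omega D) \<and> bounded (Omega D) \<and> Omega D \<noteq> {} \<and>
     triangulation (cells D) \<and> (\<forall>K\<in>cells D. int CARD('n) simplex K) \<and>
     mesh D Stokes \<inter> mesh D Darcy = {} \<and>
     Omega D = interior (\<Union> (cells D)) \<and>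
     (\<forall>j. region D j = interior (\<Union> (mesh D j))) \<and>
     0 < viscosity D \<and> 0 < permeability D \<and> 0 < slip D \<and> 0 < penalty D \<and>
     1 \<le> order D"

definition interface :: "'n::finite setting \<Rightarrow> (real^'n) set" where
  "interface D = frontier (region D Stokes) \<inter> frontier (region D Darcy)"

definition ext_boundary :: "'n::finite setting \<Rightarrow> side \<Rightarrow> (real^'n) set" where
  "ext_boundary D j = frontier (Omega D) \<inter> frontier (region D j)"

definition all_facets :: "'n::finite setting \<Rightarrow> (real^'n) set set" where
  "all_facets D = (\<Union>K\<in>cells D. facets K)"

definition interface_facets :: "'n::finite setting \<Rightarrow> (real^'n) set set" where
  "interface_facets D = {F \<in> all_facets D. F \<subseteq> interface D}"

definition side_facets :: "'n::finite setting \<Rightarrow> side \<Rightarrow> (real^'n) set set" where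
  "side_facets D j = {F \<in> all_facets D. F \<subseteq> closure (region D j)}"

definition skeleton :: "'n::finite setting \<Rightarrow> side \<Rightarrow> (real^'n) set" where
  "skeleton D j = \<Union> (side_facets D j)"

text \<open>Normal to an interface facet pointing out of the given region: such a facet belongs to
  exactly one cell of each of the two meshes.\<close>

definition side_normal :: "'n::finite setting \<Rightarrow> side \<Rightarrow> (real^'n) set \<Rightarrow> real^'n" where
  "side_normal D j F = outer_normal (THE K. K \<in> mesh D j \<and> F facet_of K) F"


section \<open>Discrete spaces\<close>

definition V_h :: "'n::finite setting \<Rightarrow> (real^'n \<Rightarrow> real^'n) set" where
  "V_h D = {v \<in> L2 (Omega D). \<forall>K\<in>cells D. v \<in> Pvec (order D) (interior K)}"

definition Q_h :: "'n::finite setting \<Rightarrow> (real^'n \<Rightarrow> real) set" where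
  "Q_h D = {q \<in> L2 (Omega D).
     (\<forall>K\<in>cells D. q \<in> P (order D - 1) (interior K)) \<and> vol_int (Omega D) q = 0}"

definition Vbar_h :: "'n::finite setting \<Rightarrow> (real^'n \<Rightarrow> real^'n) set" where
  "Vbar_h D = {v. (\<forall>F\<in>side_facets D Stokes. v \<in> L2_facet F \<and> v \<in> Pvec (order D) F) \<and>
     (\<forall>x\<in>ext_boundary D Stokes. v x = 0) \<and> continuous_on (skeleton D Stokes) v}"

text \<open>Polynomials on the relative interiors only: the functions in this space are in general
  discontinuous where facets meet.\<close>

definition Qbar_h :: "'n::finite setting \<Rightarrow> side \<Rightarrow> (real^'n \<Rightarrow> real) set" where
  "Qbar_h D j = {q. \<forall>F\<in>side_facets D j. q \<in> L2_facet F \<and> q \<in> P (order D) (rel_interior F)}"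

type_synonym 'n velocity = "(real^'n \<Rightarrow> real^'n) \<times> (real^'n \<Rightarrow> real^'n)"
type_synonym 'n pressure = "(real^'n \<Rightarrow> real) \<times> (side \<Rightarrow> real^'n \<Rightarrow> real)"

definition VV_h :: "'n::finite setting \<Rightarrow> 'n velocity set" where
  "VV_h D = V_h D \<times> Vbar_h D"

definition QQ_h :: "'n::finite setting \<Rightarrow> 'n pressure set" where
  "QQ_h D = Q_h D \<times> {qb. \<forall>j. qb j \<in> Qbar_h D j}"

definition X_h :: "'n::finite setting \<Rightarrow> ('n velocity \<times> 'n pressure) set" where
  "X_h D = VV_h D \<times> QQ_h D"

definition Pi_Q :: "'n::finite setting \<Rightarrow> (real^'n \<Rightarrow> real) \<Rightarrow> real^'n \<Rightarrow> real" where
  "Pi_Q D f = (SOME g. g \<in> Q_h D \<and>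
     (\<forall>q\<in>Q_h D. vol_int (Omega D) (\<lambda>x. g x * q x) = vol_int (Omega D) (\<lambda>x. f x * q x)))"

definition chi_d :: "'n::finite setting \<Rightarrow> real^'n \<Rightarrow> real" where
  "chi_d D = indicator (region D Darcy)"


section \<open>Discrete forms\<close>

definition a_s :: "'n::finite setting \<Rightarrow> 'n velocity \<Rightarrow> 'n velocity \<Rightarrow> real" where
  "a_s D = (\<lambda>(u, ub) (v, vb).
     (\<Sum>K\<in>mesh D Stokes. vol_int K (\<lambda>x. 2 * viscosity D * (sym_grad u x \<bullet> sym_grad v x)))
   + (\<Sum>K\<in>mesh D Stokes. \<Sum>F\<in>facets K. facet_int F (\<lambda>x.
        2 * penalty D * viscosity D / diameter K *
        ((cell_trace K u x - ub x) \<bullet> (cell_trace K v x - vb x))))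
   - (\<Sum>K\<in>mesh D Stokes. \<Sum>F\<in>facets K. facet_int F (\<lambda>x.
        (2 * viscosity D) * ((cell_trace K (sym_grad u) x *v outer_normal K F)
          \<bullet> (cell_trace K v x - vb x))))
   - (\<Sum>K\<in>mesh D Stokes. \<Sum>F\<in>facets K. facet_int F (\<lambda>x.
        (2 * viscosity D) * ((cell_trace K (sym_grad v) x *v outer_normal K F)
          \<bullet> (cell_trace K u x - ub x)))))"

definition a_d ::
  "'n::finite setting \<Rightarrow> (real^'n \<Rightarrow> real^'n) \<Rightarrow> (real^'n \<Rightarrow> real^'n) \<Rightarrow> real" where
  "a_d D u v = vol_int (region D Darcy) (\<lambda>x. inverse (permeability D) * (u x \<bullet> v x))"

definition a_I ::
  "'n::finite setting \<Rightarrow> (real^'n \<Rightarrow> real^'n) \<Rightarrow> (real^'n \<Rightarrow> real^'n) \<Rightarrow> real" where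
  "a_I D ub vb = (\<Sum>F\<in>interface_facets D. facet_int F (\<lambda>x.
     slip D * permeability D powr (-1/2) *
     (tangential (unit_normal F) (ub x) \<bullet> tangential (unit_normal F) (vb x))))"

definition a_h :: "'n::finite setting \<Rightarrow> 'n velocity \<Rightarrow> 'n velocity \<Rightarrow> real" where
  "a_h D = (\<lambda>(u, ub) (v, vb). a_s D (u, ub) (v, vb) + a_d D u v + a_I D ub vb)"

definition b_h :: "'n::finite setting \<Rightarrow> side \<Rightarrow> (real^'n \<Rightarrow> real) \<times> (real^'n \<Rightarrow> real)
    \<Rightarrow> (real^'n \<Rightarrow> real^'n) \<Rightarrow> real" where
  "b_h D j = (\<lambda>(p, pb) v.
     - (\<Sum>K\<in>mesh D j. vol_int K (\<lambda>x. p x * divergence v x))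
     + (\<Sum>K\<in>mesh D j. \<Sum>F\<in>facets K. facet_int F (\<lambda>x.
          pb x * (cell_trace K v x \<bullet> outer_normal K F))))"

definition b_I :: "'n::finite setting \<Rightarrow> side \<Rightarrow> (real^'n \<Rightarrow> real)
    \<Rightarrow> (real^'n \<Rightarrow> real^'n) \<Rightarrow> real" where
  "b_I D j pb vb = - (\<Sum>F\<in>interface_facets D. facet_int F (\<lambda>x.
     pb x * (vb x \<bullet> side_normal D j F)))"

definition B_h :: "'n::finite setting \<Rightarrow> 'n velocity \<times> 'n pressure
    \<Rightarrow> 'n velocity \<times> 'n pressure \<Rightarrow> real" where
  "B_h D = (\<lambda>((u, ub), (p, pb)) ((v, vb), (q, qb)).
     a_h D (u, ub) (v, vb)
   + (\<Sum>j\<in>sides. b_h D j (p, pb j) v + b_I D j (pb j) vb)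
   + (\<Sum>j\<in>sides. b_h D j (q, qb j) u + b_I D j (qb j) ub))"


section \<open>Normal jump\<close>

text \<open>Sum over the adjacent cells of the outward normal traces; on a facet of
  \<open>\<partial>\<Omega>\<close>, which has a single adjacent cell, this is the normal trace itself.\<close>

definition normal_jump ::
  "'n::finite setting \<Rightarrow> (real^'n \<Rightarrow> real^'n) \<Rightarrow> (real^'n) set \<Rightarrow> real^'n \<Rightarrow> real" where
  "normal_jump D u F x =
     (\<Sum>K\<in>{K \<in> cells D. F facet_of K}. cell_trace K u x \<bullet> outer_normal K F)"

end

theory Submission
  imports Defs
begin

text \<open>
  Only test functions with vanishing velocity are used. Testing with a facet pressure that equals the
  normal jump (or \<open>(u - ub) \<bullet> n\<close> on the interface) on the relative interior of a single facet and vanishes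
  on all others makes the integral of its square zero. Testing with the facet pressure \<open>1\<close> shows, with
  the divergence theorem on each cell, that the divergence of \<open>u\<close> has zero mean, so that it lies in \<open>Q\<^sub>h\<close>;
  testing with \<open>q \<in> Q\<^sub>h\<close> then identifies \<open>- div u\<close> as the \<open>L\<^sup>2\<close>-projection.

  For polynomials the divergence theorem on a simplex reduces to the scaling identity
  \<open>(n + d) \<integral>\<^sub>K g = dist(v, F) \<integral>\<^sub>F g\<close> for \<open>g\<close> homogeneous of degree \<open>d\<close> about the vertex \<open>v\<close> opposite to the facet \<open>F\<close>.
\<close>

section \<open>Integrals of homogeneous functions over cones\<close>

text \<open>The polynomial degrees match: normal traces of \<open>V_h\<close> have degree
  \<open>order D\<close>, like the facet pressures, so a jump is an admissible test function for
  itself; divergences have degree \<open>order D - 1\<close>, like \<open>Q_h\<close>. The obstacle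
  is the zero mean imposed in \<open>Q_h\<close>. Volume test functions cannot see the mean of the
  divergence, so it has to be computed, and the divergence theorem serves only this purpose. The
  same constraint accounts for the two formulas for the divergence: projecting
  \<open>chi_d * f_d\<close> onto functions of zero mean subtracts its average over
  \<open>Omega D\<close>, so on Stokes cells the projection is minus that average, and a factor
  \<open>chi_d\<close> in front calls for zero mean of \<open>f_d\<close> over the Darcy region. A
  facet integral is by definition an integral over a prism of height 1. The scaling identity is
  therefore a change of variables from the prism to the cone, and Euler's identity turns its
  left-hand side into the integral of the divergence of the field g(x) (x - v).\<close>

lemma det_scale_plus_rank_one:
  fixes \<nu> w :: "real^'n"
  assumes "norm \<nu> = 1" and "s \<noteq> 0"
  shows "det (matrix (\<lambda>z. s *\<^sub>R z + (\<nu> \<bullet> z) *\<^sub>R w)) = s ^ (CARD('n) - 1) * (s + \<nu> \<bullet> w)"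
proof -
  obtain k :: 'n where True by simp
  \<comment> \<open>Conjugation by an orthogonal map that takes \<open>\<nu>\<close> to a basis
    vector keeps the determinant and confines the rank one term to column \<open>k\<close>.\<close>
  obtain Q :: "real^'n \<Rightarrow> real^'n" where Q: "orthogonal_transformation Q" "Q \<nu> = axis k 1"
    by (rule orthogonal_transformation_exists_1[OF assms(1) norm_axis_1[of k]]) 
  have linQ: "linear Q" and iQ: "\<And>x y. Q x \<bullet> Q y = x \<bullet> y"
    using Q(1) by (auto simp: orthogonal_transformation_def)
  define L where "L = (\<lambda>z. s *\<^sub>R z + (\<nu> \<bullet> z) *\<^sub>R w)"
  define L' where "L' = (\<lambda>z. s *\<^sub>R z + (axis k 1 \<bullet> z) *\<^sub>R Q w)"
  have linL: "linear L" and linL': "linear L'"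
    unfolding L_def L'_def by (auto intro!: linearI simp: algebra_simps inner_add_right)
  have "Q \<circ> L = L' \<circ> Q"
  proof
    fix z
    have "axis k 1 \<bullet> Q z = \<nu> \<bullet> z" using iQ[of \<nu> z] Q(2) by simp
    then show "(Q \<circ> L) z = (L' \<circ> Q) z"
      using linQ by (simp add: L_def L'_def linear_add linear_scale)
  qed
  then have "matrix Q ** matrix L = matrix L' ** matrix Q"
    by (metis matrix_compose linL linL' linQ)
  then have "det (matrix Q) * det (matrix L) = det (matrix L') * det (matrix Q)"
    by (metis det_mul)
  moreover have "det (matrix Q) \<noteq> 0"
    using orthogonal_transformation_det[OF Q(1)] by auto
  ultimately have "det (matrix L) = det (matrix L')" by simp
  \<comment> \<open>Column \<open>k\<close> of \<open>mat s\<close> is replaced by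
    \<open>mat s\<close> times a vector, so Cramer's rule gives the determinant as the
    \<open>k\<close>-th coordinate of that vector times \<open>det (mat s)\<close>.\<close>
  also have "matrix L' =
    (\<chi> i j. if j = k then ((mat s :: real^'n^'n) *v (axis k 1 + (1 / s) *\<^sub>R Q w)) $ i else (mat s :: real^'n^'n) $ i $ j)"
  proof -
    have ms: "(mat s :: real^'n^'n) *v x = s *\<^sub>R x" for x
      by (simp add: vec_eq_iff matrix_vector_mult_def mat_def if_distrib[where f="\<lambda>t. t * _"] sum.If_cases)
    have ax: "axis k (1::real) \<bullet> axis j 1 = (if j = k then 1 else 0)" for j
      by (simp add: inner_axis_axis)
    have nth: "axis j (1::real) $ i = (if i = j then 1 else 0)" for i j :: 'n
      by (simp add: axis_def)
    show ?thesis
      unfolding ms using assms(2)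
      by (auto simp: vec_eq_iff matrix_def L'_def mat_def ax nth distrib_left)
  qed
  also have "det \<dots> = (axis k 1 + (1 / s) *\<^sub>R Q w) $ k * det (mat s :: real^'n^'n)"
    by (rule cramer_lemma)
  also have "det (mat s :: real^'n^'n) = s ^ CARD('n)"
    by (subst det_diagonal) (auto simp: mat_def)
  also have "(axis k 1 + (1 / s) *\<^sub>R Q w) $ k = 1 + (\<nu> \<bullet> w) / s"
    using iQ[of \<nu> w] Q(2) by (simp add: inner_axis')
  also have "(1 + (\<nu> \<bullet> w) / s) * s ^ CARD('n) = s ^ (CARD('n) - 1) * (s + \<nu> \<bullet> w)"
  proof -
    have "s ^ CARD('n) = s ^ (CARD('n) - 1) * s"
      by (metis One_nat_def Suc_pred power_Suc2 zero_less_card_finite)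
    then show ?thesis using assms(2) by (simp add: field_simps)
  qed
  finally show ?thesis by (simp add: L_def)
qed

definition apex_cone :: "real^'n \<Rightarrow> (real^'n) set \<Rightarrow> (real^'n) set" where
  "apex_cone v F = (\<lambda>(x, t). v + t *\<^sub>R (x - v)) ` (F \<times> {0..1})"

text \<open>This is \<open>prism\<close> with the normal as a parameter: \<open>unit_normal\<close>
  is a choice and need not commute with an isometry, whereas here the normal can be carried
  along.\<close>

definition thicken :: "real^'n \<Rightarrow> (real^'n) set \<Rightarrow> (real^'n) set" where
  "thicken \<nu> F = (\<lambda>(x, t). x + t *\<^sub>R \<nu>) ` (F \<times> {0..1})"

lemma compact_apex_cone: "compact F \<Longrightarrow> compact (apex_cone v F)"
  unfolding apex_cone_def
  by (intro compact_continuous_image compact_Times) (auto simp: case_prod_unfold intro!: continuous_intros)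

lemma compact_thicken: "compact F \<Longrightarrow> compact (thicken \<nu> F)"
  unfolding thicken_def
  by (intro compact_continuous_image compact_Times) (auto simp: case_prod_unfold intro!: continuous_intros)

text \<open>The exponent \<open>1/N\<close> makes the Jacobian of \<open>\<Phi>\<close> times \<open>g \<circ> \<Phi>\<close> constant along the rays, so
  that no iterated integral is needed.\<close>

lemma cone_integral_wellorder:
  fixes F :: "(real^'m::{finite,wellorder}) set" and \<nu> v :: "real^'m::_" and g :: "real^'m::_ \<Rightarrow> real"
  assumes F: "compact F" and \<nu>: "norm \<nu> = 1" and plane: "\<And>x. x \<in> F \<Longrightarrow> \<nu> \<bullet> x = b"
    and v: "\<nu> \<bullet> v \<noteq> b" and g: "continuous_on UNIV g"
    and hom: "\<And>x t. x \<in> F \<Longrightarrow> 0 < t \<Longrightarrow> t \<le> 1 \<Longrightarrow> g (v + t *\<^sub>R (x - v)) = t ^ d * g x"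
  shows "real (CARD('m) + d) * integral (apex_cone v F) g =
    \<bar>b - \<nu> \<bullet> v\<bar> * integral (thicken \<nu> F) (\<lambda>y. g (y - (\<nu> \<bullet> y - b) *\<^sub>R \<nu>))"
proof -
  define N where "N = CARD('m) + d"
  have N: "N > 0" by (simp add: N_def)
  define h where "h = b - \<nu> \<bullet> v"
  define ft where "ft = (\<lambda>y. y - (\<nu> \<bullet> y - b) *\<^sub>R \<nu>)"
  define r where "r = (\<lambda>y::real^'m::_. (\<nu> \<bullet> y - b) powr (1 / real N))"
  define r' where "r' = (\<lambda>y::real^'m::_. (1 / real N) * (\<nu> \<bullet> y - b) powr (1 / real N - 1))"
  define \<Phi> where "\<Phi> = (\<lambda>y. v + r y *\<^sub>R (ft y - v))"
  \<comment> \<open>The derivatives of \<open>r\<close> and of \<open>ft\<close> both contribute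
    multiples of \<open>\<nu> \<bullet> z\<close>; collecting them leaves a multiple of the identity
    plus a rank one map, the shape handled by \<open>det_scale_plus_rank_one\<close>.\<close>
  define \<Phi>' where "\<Phi>' = (\<lambda>y z. r y *\<^sub>R z + (\<nu> \<bullet> z) *\<^sub>R (r' y *\<^sub>R (ft y - v) - r y *\<^sub>R \<nu>))"
  \<comment> \<open>On the base of the prism \<open>\<Phi>\<close> is constantly \<open>v\<close>;
    off the base it is injective and differentiable. The base is a null set.\<close>
  define S where "S = thicken \<nu> F - {y. \<nu> \<bullet> y = b}"
  have nn: "\<nu> \<bullet> \<nu> = 1" using \<nu> by (simp add: dot_square_norm)
  have S_iff: "y \<in> S \<longleftrightarrow> (\<exists>x\<in>F. \<exists>t. 0 < t \<and> t \<le> 1 \<and> y = x + t *\<^sub>R \<nu>)" for y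
  proof
    assume "y \<in> S"
    then obtain x t where xt: "x \<in> F" "0 \<le> t" "t \<le> 1" "y = x + t *\<^sub>R \<nu>" "\<nu> \<bullet> y \<noteq> b"
      unfolding S_def thicken_def by auto
    then have "t \<noteq> 0" using plane by auto
    with xt show "\<exists>x\<in>F. \<exists>t. 0 < t \<and> t \<le> 1 \<and> y = x + t *\<^sub>R \<nu>" by (intro bexI[of _ x] exI[of _ t]) auto
  next
    assume "\<exists>x\<in>F. \<exists>t. 0 < t \<and> t \<le> 1 \<and> y = x + t *\<^sub>R \<nu>"
    then obtain x t where xt: "x \<in> F" "0 < t" "t \<le> 1" "y = x + t *\<^sub>R \<nu>" by auto
    then have "\<nu> \<bullet> y = b + t" by (simp add: inner_add_right nn plane)
    then show "y \<in> S" using xt unfolding S_def thicken_def by (auto intro!: image_eqI[of _ _ "(x, t)"])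
  qed
  have ft_eq: "ft (x + t *\<^sub>R \<nu>) = x" if "x \<in> F" for x t
    using that by (simp add: ft_def inner_add_right nn plane)
  have pos: "0 < \<nu> \<bullet> y - b" if "y \<in> S" for y
    using that by (auto simp: S_iff inner_add_right nn plane)
  have ftF: "ft y \<in> F" if "y \<in> S" for y
    using that ft_eq by (auto simp: S_iff)
  have Sm: "S \<in> sets lebesgue"
    unfolding S_def using compact_thicken[OF F] closed_hyperplane[of \<nu> b]
    by (intro sets.Diff lmeasurable_compact[THEN fmeasurableD] sets_completionI_sets) auto
  have der: "(\<Phi> has_derivative \<Phi>' y) (at y within S)" if "y \<in> S" for y
  proof -
    have 1: "(r has_derivative (\<lambda>z. r' y * (\<nu> \<bullet> z))) (at y within S)"
    proof -
      have "((\<lambda>s. s powr (1 / real N)) has_derivative (*) (r' y)) (at (\<nu> \<bullet> y - b))"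
        using has_real_derivative_powr[OF pos[OF that], of "1 / real N"]
        unfolding has_field_derivative_def r'_def by simp
      moreover have "((\<lambda>y. \<nu> \<bullet> y - b) has_derivative (\<lambda>z. \<nu> \<bullet> z)) (at y within S)"
        by (auto intro!: derivative_eq_intros)
      ultimately show ?thesis
        unfolding r_def by (rule has_derivative_compose[rotated])
    qed
    have 2: "(ft has_derivative (\<lambda>z. z - (\<nu> \<bullet> z) *\<^sub>R \<nu>)) (at y within S)"
      unfolding ft_def by (auto intro!: derivative_eq_intros)
    have "(\<Phi> has_derivative (\<lambda>z. r y *\<^sub>R (z - (\<nu> \<bullet> z) *\<^sub>R \<nu>) + (r' y * (\<nu> \<bullet> z)) *\<^sub>R (ft y - v))) (at y within S)"
      unfolding \<Phi>_def by (auto intro!: derivative_eq_intros 1 2)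
    then show ?thesis
      by (rule has_derivative_eq_rhs) (auto simp: \<Phi>'_def algebra_simps)
  qed
  have inj: "inj_on \<Phi> S"
  proof (rule inj_onI)
    fix y z assume y: "y \<in> S" and z: "z \<in> S" and eq: "\<Phi> y = \<Phi> z"
    \<comment> \<open>The height of \<open>\<Phi> y\<close> over the parallel hyperplane through
      \<open>v\<close> determines \<open>r y\<close>, its \<open>N\<close>-th power is the height of
      \<open>y\<close>, and then \<open>ft y\<close> can be recovered too.\<close>
    have *: "\<nu> \<bullet> (\<Phi> y - v) = r y * h" if "y \<in> S" for y
      using plane[OF ftF[OF that]] by (simp add: \<Phi>_def inner_diff_right h_def)
    have "r y * h = r z * h" using *[OF y] *[OF z] eq by metis
    then have rr: "r y = r z" using v by (simp add: h_def)
    then have s: "\<nu> \<bullet> y - b = \<nu> \<bullet> z - b"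
    proof -
      have "r y powr real N = \<nu> \<bullet> y - b" if "y \<in> S" for y
        using pos[OF that] N by (simp add: r_def powr_powr)
      then show ?thesis using rr y z by metis
    qed
    have "r y \<noteq> 0" using pos[OF y] by (simp add: r_def)
    then have "ft y = ft z" using eq rr by (simp add: \<Phi>_def)
    then show "y = z" using s by (simp add: ft_def)
  qed
  have img: "\<Phi> ` S = apex_cone v F - {v}"
  proof (intro equalityI subsetI)
    fix a assume "a \<in> \<Phi> ` S"
    then obtain x t where xt: "x \<in> F" "0 < t" "t \<le> 1" "a = \<Phi> (x + t *\<^sub>R \<nu>)" by (auto simp: S_iff)
    then have a: "a = v + (t powr (1 / real N)) *\<^sub>R (x - v)"
      by (simp add: \<Phi>_def ft_eq r_def inner_add_right nn plane)
    have "t powr (1 / real N) \<le> 1" using xt by (simp add: powr_le1)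
    moreover have "x \<noteq> v" using xt plane v by auto
    ultimately show "a \<in> apex_cone v F - {v}"
      using xt a unfolding apex_cone_def by (auto intro!: image_eqI[of _ _ "(x, t powr (1 / real N))"])
  next
    fix a assume "a \<in> apex_cone v F - {v}"
    then obtain x t where xt': "x \<in> F" "0 \<le> t" "t \<le> 1" "a = v + t *\<^sub>R (x - v)" "a \<noteq> v"
      unfolding apex_cone_def by auto
    then have "t \<noteq> 0" by auto
    with xt' have xt: "x \<in> F" "0 < t" "t \<le> 1" "a = v + t *\<^sub>R (x - v)" by auto
    \<comment> \<open>The point with parameter \<open>t\<close> on a ray comes from height
      \<open>t ^ N\<close> in the prism, since \<open>r\<close> takes the \<open>N\<close>-th root.
      Only the apex is missed.\<close>
    have "x + (t ^ N) *\<^sub>R \<nu> \<in> S"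
      unfolding S_iff using xt by (intro bexI[of _ x] exI[of _ "t ^ N"]) (auto simp: power_le_one)
    moreover have "\<Phi> (x + (t ^ N) *\<^sub>R \<nu>) = a"
    proof -
      have "(t ^ N) powr (1 / real N) = t"
        using xt N by (simp add: powr_realpow[symmetric] powr_powr)
      then show ?thesis using xt by (simp add: \<Phi>_def ft_eq r_def inner_add_right nn plane)
    qed
    ultimately show "a \<in> \<Phi> ` S" by (metis image_eqI)
  qed
  have gK: "g absolutely_integrable_on apex_cone v F"
    using borel_integrable_compact[OF compact_apex_cone[OF F, of v] continuous_on_subset[OF g]]
    unfolding set_integrable_def
    by (intro integrable_completion[THEN iffD2]) (auto simp: borel_measurable_integrable)
  have gK': "g absolutely_integrable_on (\<Phi> ` S)"
    unfolding img
  proof (rule set_integrable_subset[OF gK])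
    have "apex_cone v F \<in> sets lebesgue"
      by (simp add: fmeasurableD lmeasurable_compact compact_apex_cone F)
    then show "apex_cone v F - {v} \<in> sets lebesgue"
      by (rule sets.Diff) (simp add: fmeasurableD lmeasurable_compact)
  qed auto
  have jac: "\<bar>det (matrix (\<Phi>' y))\<bar> * g (\<Phi> y) = (\<bar>h\<bar> / real N) * g (ft y)" if "y \<in> S" for y
  proof -
    let ?s = "\<nu> \<bullet> y - b"
    have rpos: "r y > 0" using pos[OF that] by (simp add: r_def)
    have "det (matrix (\<Phi>' y)) = r y ^ (CARD('m) - 1) * (r y + \<nu> \<bullet> (r' y *\<^sub>R (ft y - v) - r y *\<^sub>R \<nu>))"
      unfolding \<Phi>'_def using rpos \<nu> by (intro det_scale_plus_rank_one) auto
    also have "\<nu> \<bullet> (r' y *\<^sub>R (ft y - v) - r y *\<^sub>R \<nu>) = r' y * h - r y"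
      using plane[OF ftF[OF that]] by (simp add: inner_diff_right nn h_def)
    finally have d: "\<bar>det (matrix (\<Phi>' y))\<bar> = r y ^ (CARD('m) - 1) * (r' y * \<bar>h\<bar>)"
      using rpos by (simp add: abs_mult r'_def)
    have "r y \<le> 1"
      using that by (auto simp: S_iff r_def inner_add_right nn plane powr_le1)
    then have "g (\<Phi> y) = r y ^ d * g (ft y)"
      unfolding \<Phi>_def using hom[OF ftF[OF that] rpos] by simp
    then have "\<bar>det (matrix (\<Phi>' y))\<bar> * g (\<Phi> y) = (r y ^ (N - 1) * r' y) * \<bar>h\<bar> * g (ft y)"
      unfolding d N_def by (simp add: power_add[symmetric] Suc_leI)
    \<comment> \<open>Since \<open>r y ^ N\<close> is the height of \<open>y\<close>,
      differentiating it in the direction \<open>\<nu>\<close> gives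
      \<open>N * r y ^ (N - 1) * r' y = 1\<close>.\<close>
    moreover have "r y ^ (N - 1) * r' y = 1 / real N"
    proof -
      have "r y ^ (N - 1) = ?s powr ((1 / real N) * real (N - 1))"
        using rpos by (simp add: r_def powr_realpow[symmetric] powr_powr)
      then have "r y ^ (N - 1) * r' y = (1 / real N) * ?s powr ((1 / real N) * real (N - 1) + (1 / real N - 1))"
        by (simp add: r'_def powr_add)
      also have "(1 / real N) * real (N - 1) + (1 / real N - 1) = 0"
        using N by (simp add: of_nat_diff field_simps)
      finally show ?thesis using pos[OF that] by simp
    qed
    ultimately show ?thesis by simp
  qed
  have "integral (\<Phi> ` S) g = integral S (\<lambda>y. \<bar>det (matrix (\<Phi>' y))\<bar> * g (\<Phi> y))"
  proof -
    have "integral (\<Phi> ` S) (\<lambda>x. vec (g x) :: real^1) =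
          integral S (\<lambda>y. \<bar>det (matrix (\<Phi>' y))\<bar> *\<^sub>R (vec (g (\<Phi> y)) :: real^1))"
      using gK' by (intro integral_change_of_variables Sm der inj) (auto simp: absolutely_integrable_on_1_iff)
    then show ?thesis by (simp add: integral_on_1_eq)
  qed
  also have "\<dots> = integral S (\<lambda>y. (\<bar>h\<bar> / real N) * g (ft y))"
    by (rule integral_cong) (rule jac)
  also have "\<dots> = (\<bar>h\<bar> / real N) * integral S (\<lambda>y. g (ft y))" by simp
  also have "integral S (\<lambda>y. g (ft y)) = integral (thicken \<nu> F) (\<lambda>y. g (ft y))"
    using \<nu> unfolding S_def
    by (intro integral_subset_negligible negligible_subset[OF negligible_hyperplane[of \<nu> b]]) auto
  also have "integral (\<Phi> ` S) g = integral (apex_cone v F) g"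
    unfolding img by (intro integral_subset_negligible negligible_subset[OF negligible_sing[of v]]) auto
  finally have "integral (apex_cone v F) g = \<bar>h\<bar> / real N * integral (thicken \<nu> F) (\<lambda>y. g (ft y))" .
  then have "real N * integral (apex_cone v F) g = \<bar>h\<bar> * integral (thicken \<nu> F) (\<lambda>y. g (ft y))"
    using N by simp
  then show ?thesis by (simp only: h_def ft_def N_def)
qed

section \<open>Volume integrals and relabelling of coordinates\<close>

lemma apex_cone_UN: "apex_cone v F = (\<Union>x\<in>F. (\<lambda>t. v + t *\<^sub>R (x - v)) ` {0..1})"
  by (auto simp: apex_cone_def)

lemma thicken_UN: "thicken \<nu> F = (\<Union>x\<in>F. (\<lambda>t. x + t *\<^sub>R \<nu>) ` {0..1})"
  by (auto simp: thicken_def)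

lemma vol_int_lborel:
  assumes "compact S" and "continuous_on UNIV g"
  shows "vol_int S g = integral\<^sup>L lborel (\<lambda>x. indicator S x *\<^sub>R g x)"
proof -
  have S: "S \<in> sets lebesgue" using assms(1) by (simp add: fmeasurableD lmeasurable_compact)
  have "integrable lborel (\<lambda>x. indicator S x *\<^sub>R g x)"
    using borel_integrable_compact[OF assms(1)] assms(2) continuous_on_subset by blast
  then have "integral\<^sup>L lebesgue (\<lambda>x. indicator S x *\<^sub>R g x) = integral\<^sup>L lborel (\<lambda>x. indicator S x *\<^sub>R g x)"
    by (intro integral_completion) (rule borel_measurable_integrable)
  then show ?thesis using S by (simp add: vol_int_def integral_restrict_space)
qed

lemma integrable_lebesgue_on_compact:
  fixes g :: "'a::euclidean_space \<Rightarrow> real"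
  assumes "compact S" and "continuous_on UNIV g"
  shows "integrable (lebesgue_on S) g"
proof -
  have S: "S \<in> sets lebesgue" using assms(1) by (simp add: fmeasurableD lmeasurable_compact)
  have "integrable lborel (\<lambda>x. indicator S x *\<^sub>R g x)"
    using borel_integrable_compact[OF assms(1)] assms(2) continuous_on_subset by blast
  then have "integrable lebesgue (\<lambda>x. indicator S x *\<^sub>R g x)"
    by (subst integrable_completion) (auto intro: borel_measurable_integrable)
  then show ?thesis using S by (simp add: integrable_restrict_space)
qed

lemma vol_int_eq_integral:
  assumes "compact S" and "continuous_on UNIV g"
  shows "vol_int S g = integral S g"
  unfolding vol_int_def using assms
  by (intro lebesgue_integral_eq_integral integrable_lebesgue_on_compact) (simp_all add: fmeasurableD lmeasurable_compact)

lemma prod_Basis_vec: "(\<Prod>b\<in>Basis. (x::real^'n) \<bullet> b) = (\<Prod>i\<in>UNIV. x $ i)"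
proof -
  have "bij_betw (\<lambda>i. axis i (1::real)) (UNIV :: 'n set) Basis"
    by (auto simp: bij_betw_def inj_on_def axis_eq_axis Basis_vec_def)
  from prod.reindex_bij_betw[OF this, of "\<lambda>b. x \<bullet> b"] show ?thesis
    by (simp add: inner_axis)
qed

text \<open>Relabelling coordinates turns boxes into boxes with the same side lengths, and the
  measure of boxes determines \<open>lborel\<close>.\<close>

lemma lborel_reindex:
  fixes \<pi> :: "'m::finite \<Rightarrow> 'n::finite"
  assumes "bij \<pi>"
  shows "lborel = distr lborel borel (\<lambda>x::real^'n. \<chi> i. x $ \<pi> i)"
proof (rule lborel_eqI)
  let ?T = "\<lambda>x::real^'n. (\<chi> i. x $ \<pi> i) :: real^'m"
  let ?U = "\<lambda>x::real^'m. (\<chi> i. x $ inv \<pi> i) :: real^'n"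
  have meas: "?T \<in> borel_measurable borel"
    by (intro borel_measurable_continuous_onI continuous_intros)
  fix l u :: "real^'m" assume "\<And>b. b \<in> Basis \<Longrightarrow> l \<bullet> b \<le> u \<bullet> b"
  then have lu: "l $ i \<le> u $ i" for i
    by (metis axis_in_Basis_iff cart_eq_inner_axis Basis_real_def insertI1)
  have "?T -` box l u = box (?U l) (?U u)"
  proof -
    have "(\<forall>i. l $ i < x $ \<pi> i \<and> x $ \<pi> i < u $ i) \<longleftrightarrow> (\<forall>j. l $ inv \<pi> j < x $ j \<and> x $ j < u $ inv \<pi> j)" for x :: "real^'n"
      using assms by (metis bij_inv_eq_iff)
    then show ?thesis by (auto simp: mem_box_cart)
  qed
  then have "emeasure (distr lborel borel ?T) (box l u) = emeasure lborel (box (?U l) (?U u))"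
    using meas by (simp add: emeasure_distr)
  also have "\<dots> = ennreal (\<Prod>b\<in>Basis. (?U u - ?U l) \<bullet> b)"
    using lu by (intro emeasure_lborel_box) (auto simp: Basis_vec_def inner_axis)
  also have "(\<Prod>b\<in>Basis. (?U u - ?U l) \<bullet> b) = (\<Prod>j\<in>UNIV. (\<lambda>i. u $ i - l $ i) (inv \<pi> j))"
    unfolding prod_Basis_vec by simp
  also have "\<dots> = (\<Prod>i\<in>UNIV. u $ i - l $ i)"
    by (rule prod.reindex_bij_betw) (rule bij_imp_bij_inv[OF assms])
  also have "\<dots> = (\<Prod>b\<in>Basis. (u - l) \<bullet> b)"
    unfolding prod_Basis_vec by simp
  finally show "emeasure (distr lborel borel ?T) (box l u) = ennreal (\<Prod>b\<in>Basis. (u - l) \<bullet> b)" .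
qed simp

text \<open>The library's change of variables needs a well-ordered index type, hence the detour over an
  index type \<open>'m\<close> of the same cardinality.\<close>

lemma cone_integral_reindex:
  fixes F :: "(real^'n) set" and g :: "real^'n \<Rightarrow> real" and \<pi> :: "'m::{finite,wellorder} \<Rightarrow> 'n"
  assumes bij: "bij \<pi>"
    and F: "compact F" and \<nu>: "norm \<nu> = 1" and plane: "\<And>x. x \<in> F \<Longrightarrow> \<nu> \<bullet> x = b"
    and v: "\<nu> \<bullet> v \<noteq> b" and g: "continuous_on UNIV g"
    and hom: "\<And>x t. x \<in> F \<Longrightarrow> 0 < t \<Longrightarrow> t \<le> 1 \<Longrightarrow> g (v + t *\<^sub>R (x - v)) = t ^ d * g x"
  shows "real (CARD('n) + d) * vol_int (apex_cone v F) g =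
    \<bar>b - \<nu> \<bullet> v\<bar> * vol_int (thicken \<nu> F) (\<lambda>y. g (y - (\<nu> \<bullet> y - b) *\<^sub>R \<nu>))"
proof -
  define T where "T = (\<lambda>x::real^'n. (\<chi> i. x $ \<pi> i) :: real^'m::_)"
  define U where "U = (\<lambda>x::real^'m::_. (\<chi> i. x $ inv \<pi> i) :: real^'n)"
  have UT: "U (T x) = x" and TU: "T (U y) = y" for x y
    using bij by (simp_all add: T_def U_def vec_eq_iff bij_is_surj bij_is_inj surj_f_inv_f inv_f_f)
  have linT: "linear T" and linU: "linear U"
    by (auto intro!: linearI simp: T_def U_def vec_eq_iff)
  have inT: "T x \<bullet> T y = x \<bullet> y" for x y
    unfolding T_def inner_vec_def using sum.reindex_bij_betw[OF bij, of "\<lambda>j. x $ j \<bullet> y $ j"] by simp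
  have contT: "continuous_on UNIV T" and contU: "continuous_on UNIV U"
    using linT linU by (simp_all add: linear_continuous_on linear_conv_bounded_linear)
  \<comment> \<open>Measure is preserved by \<open>lborel_reindex\<close>. Cones, prisms and heights
    carry over because \<open>T\<close> is linear and keeps inner products.\<close>
  have tr: "vol_int (T ` S) (\<lambda>y. f (U y)) = vol_int S f" if S: "compact S" and f: "continuous_on UNIV f" for S f
  proof -
    have cT: "compact (T ` S)" using S contT by (meson compact_continuous_image continuous_on_subset subset_UNIV)
    have cf: "continuous_on UNIV (\<lambda>y. f (U y))"
      using f contU by (rule continuous_on_compose2) simp
    have meas: "(\<lambda>y. indicator (T ` S) y *\<^sub>R f (U y)) \<in> borel_measurable borel"
      using borel_measurable_integrable[OF borel_integrable_compact[OF cT continuous_on_subset[OF cf subset_UNIV]]]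
      by simp
    have ind: "indicator (T ` S) (T x) = (indicator S x :: real)" for x
    proof -
      have "T x \<in> T ` S \<longleftrightarrow> x \<in> S" using UT by (metis imageE imageI)
      then show ?thesis by (simp add: indicator_def)
    qed
    have "vol_int (T ` S) (\<lambda>y. f (U y)) = integral\<^sup>L (distr lborel borel T) (\<lambda>y. indicator (T ` S) y *\<^sub>R f (U y))"
      using vol_int_lborel[OF cT cf] lborel_reindex[OF bij] by (simp add: T_def)
    also have "\<dots> = integral\<^sup>L lborel (\<lambda>x. indicator (T ` S) (T x) *\<^sub>R f (U (T x)))"
      using meas contT by (intro integral_distr) (auto intro: borel_measurable_continuous_onI)
    also have "\<dots> = vol_int S f"
      by (simp add: vol_int_lborel[OF S f] ind UT)
    finally show ?thesis .
  qed
  have card: "CARD('m) = CARD('n)" using bij by (rule bij_betw_same_card)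
  let ?ft = "\<lambda>y. y - (\<nu> \<bullet> y - b) *\<^sub>R \<nu>"
  have ft: "continuous_on UNIV (\<lambda>y. g (?ft y))"
    using g by (rule continuous_on_compose2) (auto intro!: continuous_intros)
  have TF: "compact (T ` F)" using F contT by (meson compact_continuous_image continuous_on_subset subset_UNIV)
  have cone: "apex_cone (T v) (T ` F) = T ` apex_cone v F"
    by (simp add: apex_cone_UN image_UN image_image linear_add[OF linT] linear_diff[OF linT] linear_scale[OF linT])
  have thick: "thicken (T \<nu>) (T ` F) = T ` thicken \<nu> F"
    by (simp add: thicken_UN image_UN image_image linear_add[OF linT] linear_scale[OF linT])
  have gU: "continuous_on UNIV (\<lambda>y. g (U y))"
    using g contU by (rule continuous_on_compose2) simp
  have inTU: "T \<nu> \<bullet> y = \<nu> \<bullet> U y" for y using inT[of \<nu> "U y"] by (simp add: TU)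
  have Uft: "U (y - (T \<nu> \<bullet> y - b) *\<^sub>R T \<nu>) = ?ft (U y)" for y
    by (simp add: linear_diff[OF linU] linear_scale[OF linU] UT inTU)
  have "real (CARD('m) + d) * integral (apex_cone (T v) (T ` F)) (\<lambda>y. g (U y)) =
    \<bar>b - T \<nu> \<bullet> T v\<bar> * integral (thicken (T \<nu>) (T ` F)) (\<lambda>y. g (U (y - (T \<nu> \<bullet> y - b) *\<^sub>R T \<nu>)))"
  proof (rule cone_integral_wellorder[OF TF])
    show "norm (T \<nu>) = 1" using \<nu> inT[of \<nu> \<nu>] by (simp add: norm_eq_1)
    show "T \<nu> \<bullet> x = b" if "x \<in> T ` F" for x using that plane by (auto simp: inT)
    show "T \<nu> \<bullet> T v \<noteq> b" using v by (simp add: inT)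
    show "continuous_on UNIV (\<lambda>y. g (U y))" by (rule gU)
    show "g (U (T v + t *\<^sub>R (x - T v))) = t ^ d * g (U x)" if "x \<in> T ` F" "0 < t" "t \<le> 1" for x t
      using that hom by (auto simp: linear_add[OF linU] linear_diff[OF linU] linear_scale[OF linU] UT)
  qed
  then have "real (CARD('n) + d) * integral (T ` apex_cone v F) (\<lambda>y. g (U y)) =
    \<bar>b - \<nu> \<bullet> v\<bar> * integral (T ` thicken \<nu> F) (\<lambda>y. g (?ft (U y)))"
    unfolding cone thick Uft inT card .
  moreover have "integral (T ` apex_cone v F) (\<lambda>y. g (U y)) = vol_int (apex_cone v F) g"
    using tr[OF compact_apex_cone[OF F] g] vol_int_eq_integral[OF _ gU]
      compact_continuous_image[OF continuous_on_subset[OF contT] compact_apex_cone[OF F]] by simp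
  moreover have "integral (T ` thicken \<nu> F) (\<lambda>y. g (?ft (U y))) = vol_int (thicken \<nu> F) (\<lambda>y. g (?ft y))"
    using tr[OF compact_thicken[OF F] ft] vol_int_eq_integral[OF _ continuous_on_compose2[OF ft contU]]
      compact_continuous_image[OF continuous_on_subset[OF contT] compact_thicken[OF F]] by simp
  ultimately show ?thesis by simp
qed

text \<open>In dimension two and three the numeral types \<open>2\<close> and \<open>3\<close> serve
  as well-ordered index types.\<close>

lemma cone_integral:
  fixes F :: "(real^'n) set" and g :: "real^'n \<Rightarrow> real"
  assumes "CARD('n) = 2 \<or> CARD('n) = 3"
    and F: "compact F" and \<nu>: "norm \<nu> = 1" and plane: "\<And>x. x \<in> F \<Longrightarrow> \<nu> \<bullet> x = b"
    and v: "\<nu> \<bullet> v \<noteq> b" and g: "continuous_on UNIV g"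
    and hom: "\<And>x t. x \<in> F \<Longrightarrow> 0 < t \<Longrightarrow> t \<le> 1 \<Longrightarrow> g (v + t *\<^sub>R (x - v)) = t ^ d * g x"
  shows "real (CARD('n) + d) * vol_int (apex_cone v F) g =
    \<bar>b - \<nu> \<bullet> v\<bar> * vol_int (thicken \<nu> F) (\<lambda>y. g (y - (\<nu> \<bullet> y - b) *\<^sub>R \<nu>))"
  using assms(1)
proof
  assume "CARD('n) = 2"
  then obtain \<pi> :: "2 \<Rightarrow> 'n" where "bij \<pi>"
    using finite_same_card_bij[of "UNIV :: 2 set" "UNIV :: 'n set"] by auto
  then show ?thesis using assms by (intro cone_integral_reindex)
next
  assume "CARD('n) = 3"
  then obtain \<pi> :: "3 \<Rightarrow> 'n" where "bij \<pi>"
    using finite_same_card_bij[of "UNIV :: 3 set" "UNIV :: 'n set"] by auto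
  then show ?thesis using assms by (intro cone_integral_reindex)
qed

section \<open>Facets and their normals\<close>

lemma full_simplex:
  fixes K :: "(real^'n) set"
  assumes "int CARD('n) simplex K"
  shows "convex K" "compact K" "closed K" "aff_dim K = int CARD('n)" "affine hull K = UNIV"
    "interior K = rel_interior K" "interior K \<noteq> {}" "closure (interior K) = K" "K \<noteq> {}"
proof -
  show c: "convex K" and "compact K" and cl: "closed K" and d: "aff_dim K = int CARD('n)"
    using assms by (simp_all add: convex_simplex compact_simplex closed_simplex aff_dim_simplex)
  show a: "affine hull K = UNIV" using d by (simp add: aff_dim_eq_full[symmetric])
  then show r: "interior K = rel_interior K" by (simp add: rel_interior_interior)
  show ne: "K \<noteq> {}" using d by auto
  show "interior K \<noteq> {}" unfolding r using ne c by (simp add: rel_interior_eq_empty)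
  then show "closure (interior K) = K" using convex_closure_interior[OF c] cl by simp
qed

lemma facet_basic:
  fixes K :: "(real^'n) set"
  assumes K: "int CARD('n) simplex K" and F: "F facet_of K"
  shows "convex F" "compact F" "F \<noteq> {}" "F \<subseteq> K" "F face_of K" "aff_dim F = int CARD('n) - 1"
    "rel_interior F \<noteq> {}" "closure (rel_interior F) = F"
proof -
  show f: "F face_of K" and ne: "F \<noteq> {}" and "aff_dim F = int CARD('n) - 1"
    using F full_simplex(4)[OF K] by (simp_all add: facet_of_def)
  show c: "convex F" and k: "compact F" and "F \<subseteq> K"
    using f full_simplex[OF K] by (auto simp: face_of_imp_convex face_of_imp_compact face_of_imp_subset)
  show "rel_interior F \<noteq> {}" using ne c by (simp add: rel_interior_eq_empty)
  show "closure (rel_interior F) = F"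
    using c k by (simp add: convex_closure_rel_interior compact_imp_closed closure_closed)
qed

text \<open>The normals are given by description and choice operators; this predicate supplies the
  concrete hyperplane with which they are computed.\<close>

definition supporting :: "(real^'n) set \<Rightarrow> (real^'n) set \<Rightarrow> real^'n \<Rightarrow> real \<Rightarrow> bool" where
  "supporting K F \<nu> b \<longleftrightarrow> norm \<nu> = 1 \<and> affine hull F = {x. \<nu> \<bullet> x = b} \<and> K \<subseteq> {x. \<nu> \<bullet> x \<le> b} \<and> F = K \<inter> {x. \<nu> \<bullet> x = b}"

lemma supportingD:
  assumes "supporting K F \<nu> b"
  shows "norm \<nu> = 1" "\<nu> \<noteq> 0" "affine hull F = {x. \<nu> \<bullet> x = b}" "\<And>x. x \<in> K \<Longrightarrow> \<nu> \<bullet> x \<le> b"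
    "F = K \<inter> {x. \<nu> \<bullet> x = b}" "\<And>x. x \<in> F \<Longrightarrow> \<nu> \<bullet> x = b" "\<nu> \<bullet> \<nu> = 1"
  using assms unfolding supporting_def by (auto simp: norm_eq_1)

lemma hyperplane_eqI:
  fixes F :: "(real^'n) set"
  assumes "aff_dim F = int CARD('n) - 1" and "F \<subseteq> {x. a \<bullet> x = b}" and "a \<noteq> 0"
  shows "affine hull F = {x. a \<bullet> x = b}"
proof -
  have "aff_dim F = aff_dim {x. a \<bullet> x = b}" using assms by (simp add: aff_dim_hyperplane)
  then have "affine hull F = affine hull {x. a \<bullet> x = b}"
    using aff_dim_eq_full_gen[OF assms(2)] by simp
  also have "affine hull {x. a \<bullet> x = b} = {x. a \<bullet> x = b}"
    by (rule affine_hull_eq[THEN iffD2]) (rule affine_hyperplane)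
  finally show ?thesis .
qed

text \<open>Faces of a polyhedron are exposed, and by its dimension a facet spans the whole exposing
  hyperplane.\<close>

lemma supporting_exists:
  fixes K :: "(real^'n) set"
  assumes K: "int CARD('n) simplex K" and F: "F facet_of K"
  obtains \<nu> b where "supporting K F \<nu> b"
proof -
  have "F exposed_face_of K"
    using exposed_face_of_polyhedron[OF simplex_imp_polyhedron[OF K]] facet_basic(5)[OF K F] by simp
  then obtain a c where ac: "K \<subseteq> {x. a \<bullet> x \<le> c}" "F = K \<inter> {x. a \<bullet> x = c}"
    by (auto simp: exposed_face_of_def)
  have "a \<noteq> 0"
  proof
    assume "a = 0"
    then have "F = K" using ac facet_basic(3)[OF K F] by auto
    then show False using facet_basic(6)[OF K F] full_simplex(4)[OF K] by simp
  qed
  have "supporting K F (a /\<^sub>R norm a) (c / norm a)"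
  proof -
    have le: "(a /\<^sub>R norm a) \<bullet> x \<le> c / norm a \<longleftrightarrow> a \<bullet> x \<le> c" for x
      using \<open>a \<noteq> 0\<close> by (simp add: divide_inverse_commute[symmetric] divide_right_mono field_simps)
    have eq: "(a /\<^sub>R norm a) \<bullet> x = c / norm a \<longleftrightarrow> a \<bullet> x = c" for x
      using \<open>a \<noteq> 0\<close> by (simp add: field_simps)
    show ?thesis
      unfolding supporting_def le eq
      using \<open>a \<noteq> 0\<close> ac hyperplane_eqI[OF facet_basic(6)[OF K F], of a c] by auto
  qed
  then show ?thesis by (rule that)
qed

text \<open>Let \<open>z\<close> be the part of \<open>\<mu>\<close> orthogonal to
  \<open>\<nu>\<close>. Moving from \<open>x0\<close> by \<open>z\<close> stays in the affine hull,
  on which \<open>\<mu>\<close> is constant, so \<open>\<mu> \<bullet> z = 0\<close>. This forces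
  \<open>c * c = 1\<close> and \<open>z = 0\<close>.\<close>

lemma unit_normal_unique:
  fixes \<nu> \<mu> :: "real^'n"
  assumes \<nu>: "norm \<nu> = 1" "affine hull F = {x. \<nu> \<bullet> x = b}" and \<mu>: "norm \<mu> = 1"
    and ne: "x0 \<in> F" and flat: "\<And>y. y \<in> F \<Longrightarrow> \<mu> \<bullet> y = \<mu> \<bullet> x0"
  shows "\<mu> = \<nu> \<or> \<mu> = - \<nu>"
proof -
  define c where "c = \<nu> \<bullet> \<mu>"
  define z where "z = \<mu> - c *\<^sub>R \<nu>"
  have \<nu>1: "\<nu> \<bullet> \<nu> = 1" and \<mu>1: "\<mu> \<bullet> \<mu> = 1" using \<nu> \<mu> by (simp_all add: norm_eq_1)
  have "affine hull F \<subseteq> {y. \<mu> \<bullet> y = \<mu> \<bullet> x0}"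
    by (rule hull_minimal) (auto simp: flat affine_hyperplane)
  moreover have "x0 + z \<in> affine hull F"
  proof -
    have "\<nu> \<bullet> x0 = b" using \<nu>(2) hull_inc[OF ne] by auto
    then show ?thesis unfolding \<nu>(2) by (simp add: z_def c_def inner_add_right inner_diff_right \<nu>1)
  qed
  ultimately have "\<mu> \<bullet> z = 0" by (auto simp: inner_add_right)
  then have c2: "c * c = 1" by (simp add: z_def c_def inner_diff_right \<mu>1 inner_commute)
  have "z \<bullet> z = 0"
    using c2 by (simp add: z_def c_def inner_diff_right inner_diff_left \<mu>1 \<nu>1 inner_commute)
  then have "\<mu> = c *\<^sub>R \<nu>" by (simp add: z_def)
  moreover have "c = 1 \<or> c = -1" using c2 by (simp add: square_eq_1_iff)
  ultimately show ?thesis by auto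
qed

text \<open>Uniqueness up to sign leaves \<open>\<nu>\<close> and \<open>- \<nu>\<close>. The wrong
  sign would squeeze all of \<open>K\<close> into the hyperplane, making it equal to
  \<open>F\<close> against its dimension.\<close>

lemma outer_normal_eq:
  fixes K :: "(real^'n) set"
  assumes K: "int CARD('n) simplex K" and F: "F facet_of K" and s: "supporting K F \<nu> b"
  shows "outer_normal K F = \<nu>"
  unfolding outer_normal_def
proof (rule the_equality)
  show "norm \<nu> = 1 \<and> (\<forall>x\<in>F. \<forall>y\<in>K. \<nu> \<bullet> (y - x) \<le> 0)"
    using supportingD(1,4,6)[OF s] by (auto simp: inner_diff_right)
next
  fix \<mu> assume \<mu>: "norm \<mu> = 1 \<and> (\<forall>x\<in>F. \<forall>y\<in>K. \<mu> \<bullet> (y - x) \<le> 0)"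
  obtain x0 where x0: "x0 \<in> F" using facet_basic(3)[OF K F] by auto
  have FK: "F \<subseteq> K" by (rule facet_basic(4)[OF K F])
  have "\<mu> \<bullet> y = \<mu> \<bullet> x0" if "y \<in> F" for y
    using \<mu> that x0 FK by (auto simp: inner_diff_right intro!: antisym)
  then have "\<mu> = \<nu> \<or> \<mu> = - \<nu>"
    using unit_normal_unique[OF supportingD(1)[OF s] supportingD(3)[OF s] _ x0] \<mu> by blast
  moreover have "\<mu> \<noteq> - \<nu>"
  proof
    assume m: "\<mu> = - \<nu>"
    have "\<nu> \<bullet> y = b" if "y \<in> K" for y
    proof -
      have "\<mu> \<bullet> (y - x0) \<le> 0" using \<mu> x0 that by auto
      then have "b \<le> \<nu> \<bullet> y" using supportingD(6)[OF s x0] by (simp add: m inner_diff_right)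
      then show ?thesis using supportingD(4)[OF s that] by simp
    qed
    then have "F = K" using supportingD(5)[OF s] by auto
    then show False using facet_basic(6)[OF K F] full_simplex(4)[OF K] by simp
  qed
  ultimately show "\<mu> = \<nu>" by blast
qed

lemma outer_normal_supporting:
  fixes K :: "(real^'n) set"
  assumes K: "int CARD('n) simplex K" and F: "F facet_of K"
  obtains b where "supporting K F (outer_normal K F) b"
  using supporting_exists[OF K F] outer_normal_eq[OF K F] by metis

text \<open>The outer normal of a cell at \<open>F\<close> is a witness for the choice in
  \<open>unit_normal\<close>, so the chosen vector differs from it at most by the sign.\<close>

lemma unit_normal_props:
  fixes K :: "(real^'n) set"
  assumes K: "int CARD('n) simplex K" and F: "F facet_of K"
  shows "unit_normal F = outer_normal K F \<or> unit_normal F = - outer_normal K F"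
    and "norm (unit_normal F) = 1" and "\<exists>b. affine hull F = {x. unit_normal F \<bullet> x = b}"
proof -
  obtain b where s: "supporting K F (outer_normal K F) b" by (rule outer_normal_supporting[OF K F])
  obtain x0 where x0: "x0 \<in> F" using facet_basic(3)[OF K F] by auto
  have "norm (outer_normal K F) = 1 \<and> (\<forall>x\<in>F. \<forall>y\<in>F. outer_normal K F \<bullet> (y - x) = 0)"
    using supportingD(1,4,6)[OF s] by (auto simp: inner_diff_right)
  then have u: "norm (unit_normal F) = 1 \<and> (\<forall>x\<in>F. \<forall>y\<in>F. unit_normal F \<bullet> (y - x) = 0)"
    unfolding unit_normal_def by (rule someI)
  then show "norm (unit_normal F) = 1" by simp
  have "unit_normal F \<bullet> y = unit_normal F \<bullet> x0" if "y \<in> F" for y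
  proof -
    have "unit_normal F \<bullet> (y - x0) = 0" using u x0 that by blast
    then show ?thesis by (simp add: inner_diff_right)
  qed
  then show *: "unit_normal F = outer_normal K F \<or> unit_normal F = - outer_normal K F"
    using unit_normal_unique[OF supportingD(1)[OF s] supportingD(3)[OF s] _ x0] u by blast
  from * show "\<exists>b. affine hull F = {x. unit_normal F \<bullet> x = b}"
  proof
    assume "unit_normal F = - outer_normal K F"
    then have "affine hull F = {x. unit_normal F \<bullet> x = - b}" using supportingD(3)[OF s] by simp
    then show ?thesis by blast
  qed (use supportingD(3)[OF s] in auto)
qed

text \<open>Near a relative interior point of the facet, every point below the hyperplane lies on a segment
  from the facet to a fixed interior point of \<open>K\<close>.\<close>

lemma facet_half_ball:
  fixes K :: "(real^'n) set"
  assumes K: "int CARD('n) simplex K" and F: "F facet_of K" and s: "supporting K F \<nu> b"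
    and x: "x \<in> rel_interior F"
  obtains e where "e > 0" "ball x e \<inter> {y. \<nu> \<bullet> y \<le> b} \<subseteq> K"
proof -
  obtain z where z: "z \<in> interior K" using full_simplex(7)[OF K] by auto
  have zK: "z \<in> K" using z interior_subset by blast
  have cK: "convex K" by (rule full_simplex[OF K])
  have zb: "\<nu> \<bullet> z < b"
  proof -
    have "z \<notin> F"
    proof
      assume "z \<in> F"
      then have "K \<subseteq> F"
        using subset_of_face_of[OF facet_basic(5)[OF K F], of K] z full_simplex(6)[OF K] by auto
      then show False using facet_basic(4,6)[OF K F] full_simplex(4)[OF K] by auto
    qed
    then show ?thesis using supportingD(4,5)[OF s] zK by (force simp: less_le)
  qed
  obtain r where r: "r > 0" "ball x r \<inter> affine hull F \<subseteq> F"
    using x by (auto simp: mem_rel_interior_ball)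
  have xb: "\<nu> \<bullet> x = b" using x rel_interior_subset supportingD(6)[OF s] by blast
  \<comment> \<open>\<open>w y\<close> is the projection of \<open>y\<close> from the centre
    \<open>z\<close> onto the hyperplane, and \<open>t y\<close> is the weight of \<open>z\<close>
    when \<open>y\<close> is written as an affine combination of \<open>w y\<close> and
    \<open>z\<close>. Both depend continuously on \<open>y\<close>, with \<open>w x = x\<close> and
    \<open>t x = 0\<close>.\<close>
  define t where "t = (\<lambda>y. (b - \<nu> \<bullet> y) / (b - \<nu> \<bullet> z))"
  define w where "w = (\<lambda>y. (1 / (1 - t y)) *\<^sub>R (y - t y *\<^sub>R z))"
  have tx: "t x = 0" by (simp add: t_def xb)
  have ct: "continuous (at x) t" unfolding t_def using zb by (intro continuous_intros) auto
  have cw: "continuous (at x) w" unfolding w_def using ct tx by (intro continuous_intros) auto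
  have wx: "w x = x" by (simp add: w_def tx)
  have "eventually (\<lambda>y. t y < 1) (nhds x)"
    using ct unfolding continuous_at by (metis tx order_tendstoD(2) zero_less_one tendsto_at_iff_tendsto_nhds)
  moreover have "eventually (\<lambda>y. dist (w y) x < r) (nhds x)"
    using cw r(1) unfolding continuous_at by (metis wx tendstoD tendsto_at_iff_tendsto_nhds)
  ultimately have "eventually (\<lambda>y. t y < 1 \<and> dist (w y) x < r) (nhds x)" by (rule eventually_conj)
  then obtain e where e: "e > 0" "\<And>y. dist y x < e \<Longrightarrow> t y < 1 \<and> dist (w y) x < r"
    by (auto simp: eventually_nhds_metric)
  have "y \<in> K" if "y \<in> ball x e" "\<nu> \<bullet> y \<le> b" for y
  proof -
    have ty: "t y < 1" "dist (w y) x < r" using e that by (auto simp: dist_commute)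
    have t0: "0 \<le> t y" using that zb by (simp add: t_def)
    have "\<nu> \<bullet> w y = b"
    proof -
      have "t y * (b - \<nu> \<bullet> z) = b - \<nu> \<bullet> y" using zb by (simp add: t_def)
      then have "\<nu> \<bullet> y - t y * (\<nu> \<bullet> z) = (1 - t y) * b" by (simp add: algebra_simps)
      then show ?thesis using ty(1) by (simp add: w_def inner_diff_right)
    qed
    then have "w y \<in> F" using r(2) ty(2) supportingD(3)[OF s] by (auto simp: dist_commute)
    then have "w y \<in> K" using facet_basic(4)[OF K F] by auto
    then have "(1 - t y) *\<^sub>R w y + t y *\<^sub>R z \<in> K"
      using cK zK t0 ty(1) by (intro convexD) auto
    moreover have "(1 - t y) *\<^sub>R w y + t y *\<^sub>R z = y" using ty(1) by (simp add: w_def)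
    ultimately show ?thesis by simp
  qed
  then show ?thesis using e(1) that by blast
qed

section \<open>Facets of the mesh\<close>

lemma mesh_cells: "K \<in> mesh D j \<Longrightarrow> K \<in> cells D"
  by (cases j) (auto simp: cells_def)

lemma cells_mesh: "K \<in> cells D \<Longrightarrow> \<exists>j. K \<in> mesh D j"
  by (auto simp: cells_def)

lemma all_facets_iff: "F \<in> all_facets D \<longleftrightarrow> (\<exists>K\<in>cells D. F facet_of K)"
  by (auto simp: all_facets_def facets_def)

lemma interface_frontier: "F \<in> interface_facets D \<Longrightarrow> F \<subseteq> frontier (region D j)"
  by (cases j) (auto simp: interface_facets_def interface_def)

context
  fixes D :: "'n::finite setting"
  assumes D: "stokes_darcy_setting D"
begin

lemma cells_simplex: "K \<in> cells D \<Longrightarrow> int CARD('n) simplex K"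
  using D by (simp add: stokes_darcy_setting_def)

lemma mesh_disjoint: "K \<in> mesh D i \<Longrightarrow> K \<in> mesh D j \<Longrightarrow> i = j"
  using D by (cases i; cases j) (auto simp: stokes_darcy_setting_def)

lemma finite_cells: "finite (cells D)"
  using D by (simp add: stokes_darcy_setting_def triangulation_def)

lemma finite_mesh: "finite (mesh D j)"
  using finite_cells mesh_cells by (meson finite_subset subsetI)

lemma region_eq: "region D j = interior (\<Union> (mesh D j))"
  using D by (simp add: stokes_darcy_setting_def)

lemma Omega_eq: "Omega D = interior (\<Union> (cells D))"
  using D by (simp add: stokes_darcy_setting_def)

lemma cells_face: "K \<in> cells D \<Longrightarrow> K' \<in> cells D \<Longrightarrow> K \<inter> K' face_of K"
  using D by (simp add: stokes_darcy_setting_def triangulation_def)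

text \<open>A face of \<open>K\<close> that meets the interior of \<open>K\<close> is all of
  \<open>K\<close>. Then \<open>K\<close> would be a face of \<open>K'\<close> of full dimension,
  hence equal to \<open>K'\<close>.\<close>

lemma interior_cell_disjoint:
  assumes K: "K \<in> cells D" and K': "K' \<in> cells D" and "K \<noteq> K'"
  shows "interior K \<inter> K' = {}"
proof (rule ccontr)
  assume ne: "interior K \<inter> K' \<noteq> {}"
  note sK = full_simplex[OF cells_simplex[OF K]] and sK' = full_simplex[OF cells_simplex[OF K']]
  have "K \<subseteq> K \<inter> K'"
    using subset_of_face_of[OF cells_face[OF K K'], of K] ne sK(6) interior_subset[of K] by auto
  then have "K face_of K'"
    using cells_face[OF K' K] by (simp add: Int_absorb2 Int_absorb1 inf.absorb2)
  then show False
    using face_of_aff_dim_lt[OF sK'(1)] sK(4) sK'(4) \<open>K \<noteq> K'\<close> by fastforce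
qed

lemma finite_facets: "K \<in> cells D \<Longrightarrow> finite (facets K)"
  using finite_polytope_facets[OF simplex_imp_polytope[OF cells_simplex]] by (simp add: facets_def)

text \<open>If the two normals agreed, both cells would contain the same half-ball at a relative
  interior point of \<open>F\<close>, and the interior of one would meet the other.\<close>

lemma outer_normal_opposite:
  assumes K: "K \<in> cells D" and K': "K' \<in> cells D" and "K \<noteq> K'" and F: "F facet_of K" and F': "F facet_of K'"
  shows "outer_normal K' F = - outer_normal K F"
proof -
  note sK = cells_simplex[OF K] and sK' = cells_simplex[OF K']
  obtain b where s: "supporting K F (outer_normal K F) b" by (rule outer_normal_supporting[OF sK F])
  obtain b' where s': "supporting K' F (outer_normal K' F) b'" by (rule outer_normal_supporting[OF sK' F'])
  obtain x where x: "x \<in> rel_interior F" using facet_basic(7)[OF sK F] by auto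
  have xF: "x \<in> F" using x rel_interior_subset by auto
  have "outer_normal K' F = outer_normal K F \<or> outer_normal K' F = - outer_normal K F"
    using supportingD(6)[OF s'] supportingD(6)[OF s' xF]
    by (intro unit_normal_unique[OF supportingD(1)[OF s] supportingD(3)[OF s] supportingD(1)[OF s'] xF]) simp
  moreover have "outer_normal K' F \<noteq> outer_normal K F"
  proof
    let ?\<nu> = "outer_normal K F"
    assume eq: "outer_normal K' F = ?\<nu>"
    have b: "b' = b" using supportingD(6)[OF s xF] supportingD(6)[OF s' xF] eq by simp
    obtain e where e: "e > 0" "ball x e \<inter> {y. ?\<nu> \<bullet> y \<le> b} \<subseteq> K"
      by (rule facet_half_ball[OF sK F s x])
    obtain e' where e': "e' > 0" "ball x e' \<inter> {y. ?\<nu> \<bullet> y \<le> b} \<subseteq> K'"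
      using facet_half_ball[OF sK' F' s' x] eq b by metis
    define U where "U = ball x (min e e') \<inter> {y. ?\<nu> \<bullet> y < b}"
    have "open U" unfolding U_def by (intro open_Int open_ball open_halfspace_lt)
    moreover have "U \<subseteq> K" "U \<subseteq> K'" using e(2) e'(2) by (auto simp: U_def)
    ultimately have "U \<subseteq> interior K \<inter> K'" using interior_maximal[of U K] by auto
    moreover have "x - (min e e' / 2) *\<^sub>R ?\<nu> \<in> U"
      using e(1) e'(1) supportingD(1,7)[OF s] supportingD(6)[OF s xF]
      by (auto simp: U_def dist_norm inner_diff_right)
    ultimately show False using interior_cell_disjoint[OF K K' \<open>K \<noteq> K'\<close>] by auto
  qed
  ultimately show ?thesis by blast
qed

text \<open>The half-balls that the two cells contain lie on opposite sides of \<open>F\<close> and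
  together fill a ball.\<close>

lemma rel_interior_facet_subset_interior_Un:
  assumes K: "K \<in> cells D" and K': "K' \<in> cells D" and "K \<noteq> K'" and F: "F facet_of K" and F': "F facet_of K'"
  shows "rel_interior F \<subseteq> interior (K \<union> K')"
proof
  fix x assume x: "x \<in> rel_interior F"
  then have xF: "x \<in> F" using rel_interior_subset by auto
  note sK = cells_simplex[OF K] and sK' = cells_simplex[OF K']
  let ?\<nu> = "outer_normal K F"
  obtain b where s: "supporting K F ?\<nu> b" by (rule outer_normal_supporting[OF sK F])
  obtain b' where s': "supporting K' F (outer_normal K' F) b'" by (rule outer_normal_supporting[OF sK' F'])
  have opp: "outer_normal K' F = - ?\<nu>" by (rule outer_normal_opposite) fact+
  have b: "b' = - b" using supportingD(6)[OF s xF] supportingD(6)[OF s' xF] opp by simp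
  obtain e where e: "e > 0" "ball x e \<inter> {y. ?\<nu> \<bullet> y \<le> b} \<subseteq> K"
    by (rule facet_half_ball[OF sK F s x])
  obtain e' where e': "e' > 0" "ball x e' \<inter> {y. outer_normal K' F \<bullet> y \<le> b'} \<subseteq> K'"
    by (rule facet_half_ball[OF sK' F' s' x])
  have "ball x (min e e') \<subseteq> K \<union> K'"
  proof
    fix y assume y: "y \<in> ball x (min e e')"
    show "y \<in> K \<union> K'"
    proof (cases "?\<nu> \<bullet> y \<le> b")
      case True then show ?thesis using e(2) y by auto
    next
      case False then have "outer_normal K' F \<bullet> y \<le> b'" by (simp add: opp b)
      then show ?thesis using e'(2) y by auto
    qed
  qed
  then show "x \<in> interior (K \<union> K')" using e(1) e'(1) by (meson centre_in_ball interior_maximal min_less_iff_conj open_ball subsetD)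
qed

text \<open>The face \<open>K \<inter> K'\<close> of \<open>K\<close> contains a relative interior
  point of \<open>F\<close>, hence all of \<open>F\<close>; and a face of a face of
  \<open>K'\<close> is a face of \<open>K'\<close>.\<close>

lemma facet_of_neighbour:
  assumes K: "K \<in> cells D" and K': "K' \<in> cells D" and F: "F facet_of K"
    and x: "x \<in> rel_interior F" "x \<in> K'"
  shows "F face_of K'"
proof -
  note sK = cells_simplex[OF K]
  have "F \<subseteq> K \<inter> K'"
    using subset_of_face_of[OF cells_face[OF K K'] facet_basic(4)[OF sK F]] x rel_interior_subset facet_basic(4)[OF sK F] by blast
  then have "F face_of K \<inter> K'"
    using face_of_subset[OF facet_basic(5)[OF sK F]] by auto
  moreover have "K \<inter> K' face_of K'" using cells_face[OF K' K] by (simp add: Int_commute)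
  ultimately show ?thesis by (rule face_of_trans)
qed

text \<open>Otherwise \<open>F\<close> would be a proper face of \<open>F'\<close> of the same
  dimension. This is what lets a facet pressure on the relative interior of one facet vanish on
  every other closed facet.\<close>

lemma rel_interior_facet_disjoint:
  assumes K: "K \<in> cells D" and K': "K' \<in> cells D" and F: "F facet_of K" and F': "F' facet_of K'" and "F \<noteq> F'"
  shows "rel_interior F \<inter> F' = {}"
proof (rule ccontr)
  assume "rel_interior F \<inter> F' \<noteq> {}"
  then obtain x where x: "x \<in> rel_interior F" "x \<in> F'" by auto
  note sK = cells_simplex[OF K] and sK' = cells_simplex[OF K']
  have "F face_of K'"
    using facet_of_neighbour[OF K K' F x(1)] x(2) facet_basic(4)[OF sK' F'] by auto
  moreover have "F \<subseteq> F'"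
    using subset_of_face_of[OF facet_basic(5)[OF sK' F'] face_of_imp_subset[OF \<open>F face_of K'\<close>]] x by auto
  ultimately have "F face_of F'"
    using facet_basic(4)[OF sK' F'] face_of_subset by blast
  then show False
    using face_of_aff_dim_lt[OF facet_basic(1)[OF sK' F'] \<open>F face_of F'\<close> \<open>F \<noteq> F'\<close>]
      facet_basic(6)[OF sK F] facet_basic(6)[OF sK' F'] by simp
qed

lemma interior_cell_subset_region: "K \<in> mesh D j \<Longrightarrow> interior K \<subseteq> region D j"
  unfolding region_eq by (intro interior_mono) auto

lemma cell_subset_closure_region: "K \<in> mesh D j \<Longrightarrow> K \<subseteq> closure (region D j)"
  using closure_mono[OF interior_cell_subset_region] full_simplex(8)[OF cells_simplex[OF mesh_cells]] by metis

lemma interior_cell_other_region: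
  assumes "K \<in> mesh D i" and "i \<noteq> j"
  shows "interior K \<inter> \<Union> (mesh D j) = {}"
proof -
  have "interior K \<inter> K' = {}" if "K' \<in> mesh D j" for K'
    using that assms mesh_disjoint mesh_cells by (metis interior_cell_disjoint)
  then show ?thesis by auto
qed

lemma closure_region_subset: "closure (region D j) \<subseteq> \<Union> (mesh D j)"
proof -
  have "closed (\<Union> (mesh D j))"
    using finite_mesh full_simplex(3)[OF cells_simplex[OF mesh_cells]] by (intro closed_Union) auto
  then show ?thesis unfolding region_eq by (metis closure_minimal interior_subset)
qed

lemma open_region: "open (region D j)" by (simp add: region_eq)

lemma facet_between_regions:
  assumes K: "K \<in> mesh D i" and K': "K' \<in> mesh D j" and "i \<noteq> j" and F: "F facet_of K" "F facet_of K'"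
  shows "F \<subseteq> interface D"
proof -
  \<comment> \<open>The regions are open: if one of them met a cell of the other mesh, it would meet
    the interior of that cell, which is disjoint from its own cells.\<close>
  have *: "F \<inter> region D i = {}" if K: "K \<in> mesh D i" and K': "K' \<in> mesh D j" and "i \<noteq> j" and F: "F facet_of K'" for K K' i j
  proof (rule ccontr)
    assume "F \<inter> region D i \<noteq> {}"
    then obtain x where "x \<in> region D i" "x \<in> K'"
      using facet_basic(4)[OF cells_simplex[OF mesh_cells[OF K']] F] by auto
    then have "region D i \<inter> closure (interior K') \<noteq> {}"
      using full_simplex(8)[OF cells_simplex[OF mesh_cells[OF K']]] by auto
    then have "region D i \<inter> interior K' \<noteq> {}"
      using open_Int_closure_eq_empty[OF open_region] by blast
    moreover have "region D i \<subseteq> \<Union> (mesh D i)" unfolding region_eq by (rule interior_subset)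
    ultimately show False using interior_cell_other_region[OF K', of i] \<open>i \<noteq> j\<close> by auto
  qed
  have "F \<subseteq> closure (region D i)" "F \<subseteq> closure (region D j)"
    using cell_subset_closure_region[OF K] cell_subset_closure_region[OF K']
      facet_basic(4)[OF cells_simplex[OF mesh_cells[OF K]] F(1)] facet_basic(4)[OF cells_simplex[OF mesh_cells[OF K']] F(2)] by auto
  moreover have "F \<inter> region D i = {}" "F \<inter> region D j = {}"
    using *[OF K K' \<open>i \<noteq> j\<close> F(2)] *[OF K' K _ F(1)] \<open>i \<noteq> j\<close> by auto
  ultimately have "F \<subseteq> frontier (region D i) \<inter> frontier (region D j)"
    using open_region by (auto simp: frontier_def interior_open)
  then show ?thesis using \<open>i \<noteq> j\<close> by (cases i; cases j) (auto simp: interface_def)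
qed

text \<open>Two cells of one mesh at \<open>F\<close> would put its relative interior inside the
  open set \<open>region D j\<close>, but an interface facet lies on the frontier.\<close>

lemma interface_facet_unique:
  assumes F: "F \<in> interface_facets D" and K: "K \<in> mesh D j" "F facet_of K" and K': "K' \<in> mesh D j" "F facet_of K'"
  shows "K = K'"
proof (rule ccontr)
  assume "K \<noteq> K'"
  then have "rel_interior F \<subseteq> interior (K \<union> K')"
    using K K' by (intro rel_interior_facet_subset_interior_Un) (auto intro: mesh_cells)
  also have "\<dots> \<subseteq> region D j" unfolding region_eq using K K' by (intro interior_mono) auto
  finally have "rel_interior F \<subseteq> region D j" .
  moreover have "rel_interior F \<subseteq> frontier (region D j)"
    using interface_frontier[OF F] rel_interior_subset by blast
  moreover have "rel_interior F \<noteq> {}" using facet_basic(7)[OF cells_simplex[OF mesh_cells[OF K(1)]] K(2)] .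
  ultimately show False using open_region frontier_disjoint_eq by blast
qed

text \<open>The cell that makes \<open>F\<close> a facet may lie on either side. A relative interior
  point of \<open>F\<close> is in the closure of \<open>region D j\<close>, hence in a cell of
  \<open>mesh D j\<close>, and then \<open>F\<close> is a facet of that cell. With
  \<open>interface_facet_unique\<close> this makes the description in \<open>side_normal\<close>
  meaningful.\<close>

lemma interface_facet_exists:
  assumes F: "F \<in> interface_facets D"
  shows "\<exists>K\<in>mesh D j. F facet_of K"
proof -
  obtain K where K: "K \<in> cells D" "F facet_of K" using F by (auto simp: interface_facets_def all_facets_iff)
  obtain x where x: "x \<in> rel_interior F" using facet_basic(7)[OF cells_simplex[OF K(1)] K(2)] by auto
  then have "x \<in> closure (region D j)"
    using interface_frontier[OF F] rel_interior_subset by (auto simp: frontier_def)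
  then obtain K' where K': "K' \<in> mesh D j" "x \<in> K'" using closure_region_subset by auto
  have "F face_of K'" by (rule facet_of_neighbour[OF K(1) mesh_cells[OF K'(1)] K(2) x K'(2)])
  then have "F facet_of K'"
    using K full_simplex(4)[OF cells_simplex] mesh_cells[OF K'(1)] by (simp add: facet_of_def)
  then show ?thesis using K'(1) by blast
qed

lemma side_normal_eq:
  assumes F: "F \<in> interface_facets D" and K: "K \<in> mesh D j" "F facet_of K"
  shows "side_normal D j F = outer_normal K F"
proof -
  have "(THE K. K \<in> mesh D j \<and> F facet_of K) = K"
  proof (rule the_equality)
    show "K \<in> mesh D j \<and> F facet_of K" using K by simp
    show "L = K" if "L \<in> mesh D j \<and> F facet_of L" for L
      by (rule interface_facet_unique[OF F conjunct1[OF that] conjunct2[OF that] K])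
  qed
  then show ?thesis by (simp add: side_normal_def)
qed

lemma side_normal_opposite:
  assumes F: "F \<in> interface_facets D"
  shows "side_normal D Darcy F = - side_normal D Stokes F"
proof -
  obtain K where K: "K \<in> mesh D Stokes" "F facet_of K" using interface_facet_exists[OF F] by blast
  obtain K' where K': "K' \<in> mesh D Darcy" "F facet_of K'" using interface_facet_exists[OF F] by blast
  have "K \<noteq> K'" using mesh_disjoint[OF K(1)] K'(1) by auto
  then show ?thesis
    using outer_normal_opposite[OF mesh_cells[OF K(1)] mesh_cells[OF K'(1)] _ K(2) K'(2)]
    by (simp add: side_normal_eq[OF F K] side_normal_eq[OF F K'])
qed

lemma side_facets_cell:
  assumes K: "K \<in> mesh D j" and F: "F facet_of K"
  shows "F \<in> side_facets D j"
  using cell_subset_closure_region[OF K] facet_basic(4)[OF cells_simplex[OF mesh_cells[OF K]] F] mesh_cells[OF K] F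
  unfolding side_facets_def by (auto simp: all_facets_iff)

lemma side_facets_interface: "F \<in> interface_facets D \<Longrightarrow> F \<in> side_facets D j"
  using interface_facet_exists[of F j] side_facets_cell by auto

end

section \<open>Integrals over facets\<close>

lemma prism_eq: "prism F = thicken (unit_normal F) F"
proof
  show "prism F \<subseteq> thicken (unit_normal F) F"
    by (auto simp: prism_def thicken_UN intro!: bexI imageI)
  show "thicken (unit_normal F) F \<subseteq> prism F"
    unfolding prism_def thicken_UN by clarsimp blast
qed

text \<open>By Cauchy-Schwarz no point of the hyperplane is closer to \<open>y\<close> than its foot
  along the normal.\<close>

lemma foot_eq:
  fixes F :: "(real^'n) set"
  assumes "norm \<nu> = 1" and "affine hull F = {x. \<nu> \<bullet> x = c}"
  shows "foot F y = y - (\<nu> \<bullet> y - c) *\<^sub>R \<nu>"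
proof -
  have nn: "\<nu> \<bullet> \<nu> = 1" using assms(1) by (simp add: norm_eq_1)
  have "y - (\<nu> \<bullet> y - c) *\<^sub>R \<nu> = closest_point {x. \<nu> \<bullet> x = c} y"
  proof (rule closest_point_unique)
    show "\<forall>z\<in>{x. \<nu> \<bullet> x = c}. dist y (y - (\<nu> \<bullet> y - c) *\<^sub>R \<nu>) \<le> dist y z"
    proof
      fix z assume "z \<in> {x. \<nu> \<bullet> x = c}"
      then have "\<bar>\<nu> \<bullet> y - c\<bar> = \<bar>\<nu> \<bullet> (y - z)\<bar>" by (simp add: inner_diff_right)
      also have "\<dots> \<le> norm \<nu> * norm (y - z)" by (rule Cauchy_Schwarz_ineq2)
      finally show "dist y (y - (\<nu> \<bullet> y - c) *\<^sub>R \<nu>) \<le> dist y z"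
        using assms(1) by (simp add: dist_norm)
    qed
  qed (simp_all add: convex_hyperplane closed_hyperplane inner_diff_right nn)
  then show ?thesis by (simp add: foot_def assms(2))
qed

lemma facet_int_mult_right: "facet_int F (\<lambda>x. f x * c) = facet_int F f * c"
  unfolding facet_int_def by simp

context
  fixes K F :: "(real^'n) set"
  assumes K: "int CARD('n) simplex K" and F: "F facet_of K"
begin

lemma unit_normal_plane:
  obtains c where "affine hull F = {x. unit_normal F \<bullet> x = c}" "\<forall>y. foot F y = y - (unit_normal F \<bullet> y - c) *\<^sub>R unit_normal F"
  using unit_normal_props(2,3)[OF K F] foot_eq by metis

lemma unit_normal_inner_self: "unit_normal F \<bullet> unit_normal F = 1"
  using unit_normal_props(2)[OF K F] by (simp add: norm_eq_1)

lemma foot_in_facet: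
  assumes "y \<in> prism F"
  shows "foot F y \<in> F"
proof -
  obtain c where c: "affine hull F = {x. unit_normal F \<bullet> x = c}" "\<forall>y. foot F y = y - (unit_normal F \<bullet> y - c) *\<^sub>R unit_normal F"
    by (rule unit_normal_plane)
  obtain x t where x: "x \<in> F" "y = x + t *\<^sub>R unit_normal F" using assms by (auto simp: prism_def)
  have "unit_normal F \<bullet> x = c" using hull_inc[OF x(1), of affine] c(1) by auto
  then have "foot F y = x" using x(2) by (simp add: c(2) inner_add_right unit_normal_inner_self)
  then show ?thesis using x(1) by simp
qed

lemma continuous_foot: "continuous_on UNIV (foot F)"
proof -
  obtain c where c: "\<forall>y. foot F y = y - (unit_normal F \<bullet> y - c) *\<^sub>R unit_normal F"
    by (rule unit_normal_plane)
  have "foot F = (\<lambda>y. y - (unit_normal F \<bullet> y - c) *\<^sub>R unit_normal F)" using c by auto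
  then show ?thesis by (auto intro!: continuous_intros)
qed

lemma continuous_on_foot_compose: "continuous_on UNIV g \<Longrightarrow> continuous_on UNIV (\<lambda>y. g (foot F y))"
  by (rule continuous_on_compose2[OF _ continuous_foot]) auto

lemma compact_prism: "compact (prism F)"
  unfolding prism_eq by (rule compact_thicken[OF facet_basic(2)[OF K F]])

lemma facet_int_cong: "(\<And>x. x \<in> F \<Longrightarrow> f x = g x) \<Longrightarrow> facet_int F f = facet_int F g"
  unfolding facet_int_def using foot_in_facet by (intro Bochner_Integration.integral_cong) auto

lemma integrable_foot:
  fixes g :: "real^'n \<Rightarrow> real"
  shows "continuous_on UNIV g \<Longrightarrow> integrable (lebesgue_on (prism F)) (\<lambda>y. g (foot F y))"
  by (intro integrable_lebesgue_on_compact compact_prism continuous_on_foot_compose)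

lemma facet_int_add:
  "continuous_on UNIV f \<Longrightarrow> continuous_on UNIV g \<Longrightarrow>
   facet_int F (\<lambda>x. f x + g x) = facet_int F f + facet_int F g"
  unfolding facet_int_def by (intro Bochner_Integration.integral_add integrable_foot)

lemma facet_int_sum:
  "finite I \<Longrightarrow> (\<And>i. i \<in> I \<Longrightarrow> continuous_on UNIV (f i)) \<Longrightarrow>
   facet_int F (\<lambda>x. \<Sum>i\<in>I. f i x) = (\<Sum>i\<in>I. facet_int F (f i))"
  unfolding facet_int_def by (intro Bochner_Integration.integral_sum integrable_foot)

text \<open>The relative interior is relatively open in a closed affine set, hence Borel, and
  \<open>foot F\<close> is continuous.\<close>

lemma measurable_foot_rel_interior:
  "(\<lambda>y. indicator (rel_interior F) (foot F y) :: real) \<in> borel_measurable (lebesgue_on (prism F))"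
proof -
  have "openin (top_of_set (affine hull F)) (rel_interior F)" by (rule openin_rel_interior)
  then obtain U where "open U" "rel_interior F = affine hull F \<inter> U" by (auto simp: openin_open)
  then have "rel_interior F \<in> sets borel"
    using closed_affine_hull[of F] by (simp add: sets.Int borel_closed borel_open)
  then have "(\<lambda>y. indicator (rel_interior F) (foot F y) :: real) \<in> borel_measurable borel"
    by (intro measurable_compose[OF borel_measurable_continuous_onI[OF continuous_foot]] borel_measurable_indicator)
  then have "(\<lambda>y. indicator (rel_interior F) (foot F y) :: real) \<in> borel_measurable lebesgue"
    by (intro measurable_completion) simp
  then show ?thesis by (rule measurable_restrict_space1)
qed

lemma facet_rel_interior_L2:
  fixes g :: "real^'n \<Rightarrow> real"
  assumes "continuous_on UNIV g"
  shows "integrable (lebesgue_on (prism F)) (\<lambda>y. indicator (rel_interior F) (foot F y) * g (foot F y))"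
proof (rule Bochner_Integration.integrable_bound[OF integrable_foot[OF assms]])
  show "(\<lambda>y. indicator (rel_interior F) (foot F y) * g (foot F y)) \<in> borel_measurable (lebesgue_on (prism F))"
    by (intro borel_measurable_times measurable_foot_rel_interior borel_measurable_integrable[OF integrable_foot[OF assms]])
qed (auto simp: indicator_def)

text \<open>The prism over a relatively open piece of the facet contains an open set.\<close>

lemma facet_int_square_eq_0:
  fixes g :: "real^'n \<Rightarrow> real"
  assumes g: "continuous_on UNIV g"
    and 0: "facet_int F (\<lambda>x. indicator (rel_interior F) x * (g x * g x)) = 0"
    and x: "x \<in> F"
  shows "g x = 0"
proof -
  obtain c where c: "affine hull F = {x. unit_normal F \<bullet> x = c}" "\<forall>y. foot F y = y - (unit_normal F \<bullet> y - c) *\<^sub>R unit_normal F"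
    by (rule unit_normal_plane)
  let ?h = "\<lambda>y. indicator (rel_interior F) (foot F y) * (g (foot F y) * g (foot F y))"
  have m: "prism F \<in> sets lebesgue" by (simp add: fmeasurableD lmeasurable_compact compact_prism)
  have "integrable (lebesgue_on (prism F)) ?h"
    by (rule facet_rel_interior_L2) (intro continuous_intros g)
  then have "AE y in lebesgue_on (prism F). ?h y = 0"
    using 0 unfolding facet_int_def by (subst (asm) integral_nonneg_eq_0_iff_AE) auto
  then have "AE y in lebesgue. y \<in> prism F \<longrightarrow> ?h y = 0"
    using m by (simp add: AE_restrict_space_iff)
  then have neg: "negligible {y. \<not> (y \<in> prism F \<longrightarrow> ?h y = 0)}"
    by (auto simp: eventually_ae_filter negligible_iff_null_sets[symmetric] intro: negligible_subset)
  have "g z = 0" if z: "z \<in> rel_interior F" for z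
  proof (rule ccontr)
    assume gz: "g z \<noteq> 0"
    obtain r where r: "r > 0" "ball z r \<inter> affine hull F \<subseteq> F" using z by (auto simp: mem_rel_interior_ball)
    obtain V where V: "open V" "rel_interior F = affine hull F \<inter> V"
      using openin_rel_interior[of F] by (auto simp: openin_open)
    define U where "U = V \<inter> {x. g x \<noteq> 0}"
    have oU: "open U" unfolding U_def using V(1) g
      by (intro open_Int open_Collect_neq) auto
    \<comment> \<open>The points strictly between the two ends of the prism whose foot lies in
      \<open>U\<close>. The point at half height above \<open>z\<close> shows that this open set is
      not empty.\<close>
    define W where "W = foot F -` U \<inter> {y. c < unit_normal F \<bullet> y} \<inter> {y. unit_normal F \<bullet> y < c + 1}"
    have "open W"
      unfolding W_def using oU continuous_foot
      by (intro open_Int open_halfspace_lt open_halfspace_gt) (auto simp: continuous_on_open_vimage)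
    have zc: "unit_normal F \<bullet> z = c" using V(2) z c(1) by auto
    have "z + (1/2) *\<^sub>R unit_normal F \<in> W"
      using zc z V(2) gz by (auto simp: W_def U_def c(2) inner_add_right unit_normal_inner_self)
    moreover have "W \<subseteq> {y. \<not> (y \<in> prism F \<longrightarrow> ?h y = 0)}"
    proof
      fix y assume y: "y \<in> W"
      have "foot F y \<in> affine hull F"
        unfolding c(1) by (simp add: c(2) inner_diff_right unit_normal_inner_self)
      then have fy: "foot F y \<in> rel_interior F" "g (foot F y) \<noteq> 0" using y V(2) by (auto simp: W_def U_def)
      then have "foot F y \<in> F" using rel_interior_subset by auto
      moreover have "y = foot F y + (unit_normal F \<bullet> y - c) *\<^sub>R unit_normal F" by (simp add: c(2))
      moreover have "0 \<le> unit_normal F \<bullet> y - c" "unit_normal F \<bullet> y - c \<le> 1" using y by (auto simp: W_def)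
      ultimately have "y \<in> prism F" unfolding prism_def by blast
      then show "y \<in> {y. \<not> (y \<in> prism F \<longrightarrow> ?h y = 0)}" using fy by simp
    qed
    ultimately show False using open_not_negligible[OF \<open>open W\<close>] negligible_subset[OF neg] by blast
  qed
  \<comment> \<open>The relative interior is dense in the facet, so continuity extends the zero set
    to all of \<open>F\<close>.\<close>
  then have "rel_interior F \<subseteq> {x. g x = 0}" by auto
  moreover have "closed {x. g x = 0}" using g by (intro closed_Collect_eq) auto
  ultimately have "closure (rel_interior F) \<subseteq> {x. g x = 0}" by (rule closure_minimal)
  then show ?thesis using x facet_basic(8)[OF K F] by auto
qed

end

text \<open>The direction may vary with the point, as \<open>x - v\<close> does in Euler's identity;
  constant directions give partial derivatives. The sum and product rules keep the result
  polynomial.\<close>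

lemma real_polynomial_function_frechet_derivative:
  fixes g :: "real^'n \<Rightarrow> real"
  assumes "real_polynomial_function g" and l: "polynomial_function l"
  shows "real_polynomial_function (\<lambda>x. frechet_derivative g (at x) (l x))"
  using assms(1)
proof induction
  case (linear f)
  have "frechet_derivative f (at x) = f" for x
    by (rule frechet_derivative_at[symmetric]) (rule bounded_linear_imp_has_derivative[OF linear])
  then show ?case using l linear by (auto simp: polynomial_function_def o_def)
next
  case (const c)
  then show ?case by (simp add: real_polynomial_function.intros(2))
next
  case (add f g)
  have "frechet_derivative (\<lambda>x. f x + g x) (at x) = (\<lambda>z. frechet_derivative f (at x) z + frechet_derivative g (at x) z)" for x
    using add differentiable_at_real_polynomial_function
    by (intro frechet_derivative_at[symmetric] has_derivative_add frechet_derivative_works[THEN iffD1]) auto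
  then show ?case using add by (auto intro: real_polynomial_function.intros)
next
  case (mult f g)
  have "frechet_derivative (\<lambda>x. f x * g x) (at x) = (\<lambda>z. f x * frechet_derivative g (at x) z + frechet_derivative f (at x) z * g x)" for x
    using mult differentiable_at_real_polynomial_function
    by (intro frechet_derivative_at[symmetric] has_derivative_mult frechet_derivative_works[THEN iffD1]) auto
  then show ?case using mult by (auto intro: real_polynomial_function.intros)
qed

lemma frechet_derivative_add:
  assumes "real_polynomial_function f" "real_polynomial_function g"
  shows "frechet_derivative (\<lambda>x. f x + g x) (at x) z = frechet_derivative f (at x) z + frechet_derivative g (at x) z"
proof -
  have "frechet_derivative (\<lambda>x. f x + g x) (at x) = (\<lambda>z. frechet_derivative f (at x) z + frechet_derivative g (at x) z)"
    using assms differentiable_at_real_polynomial_function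
    by (intro frechet_derivative_at[symmetric] has_derivative_add frechet_derivative_works[THEN iffD1]) auto
  then show ?thesis by simp
qed

lemma continuous_real_polynomial_function:
  "real_polynomial_function g \<Longrightarrow> continuous_on S g"
  by (simp add: continuous_on_polymonial_function real_polynomial_function_eq)

section \<open>The divergence theorem on a simplex\<close>

text \<open>The scaling law is required for all real \<open>t\<close>, so that it can be
  differentiated at \<open>t = 1\<close>.\<close>

definition homogeneous_at :: "real^'n \<Rightarrow> nat \<Rightarrow> (real^'n \<Rightarrow> real) \<Rightarrow> bool" where
  "homogeneous_at v d g \<longleftrightarrow> real_polynomial_function g \<and> (\<forall>x t. g (v + t *\<^sub>R (x - v)) = t ^ d * g x)"

text \<open>Sums of polynomials that are homogeneous about \<open>v\<close> with possibly different
  degrees. The identities to be proved are additive, so induction over the summands replaces a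
  bookkeeping of degrees.\<close>

inductive homogeneous_sum :: "real^'n \<Rightarrow> (real^'n \<Rightarrow> real) \<Rightarrow> bool" for v where
  single: "homogeneous_at v d g \<Longrightarrow> homogeneous_sum v g"
| add: "homogeneous_sum v f \<Longrightarrow> homogeneous_sum v g \<Longrightarrow> homogeneous_sum v (\<lambda>x. f x + g x)"

lemma homogeneous_sum_polynomial: "homogeneous_sum v g \<Longrightarrow> real_polynomial_function g"
  by (induction rule: homogeneous_sum.induct) (auto simp: homogeneous_at_def intro: real_polynomial_function.intros)

lemma homogeneous_at_mult:
  "homogeneous_at v d f \<Longrightarrow> homogeneous_at v e g \<Longrightarrow> homogeneous_at v (d + e) (\<lambda>x. f x * g x)"
  unfolding homogeneous_at_def by (auto intro: real_polynomial_function.intros simp: power_add)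

lemma homogeneous_sum_mult:
  assumes "homogeneous_sum v f" and g: "homogeneous_sum v g"
  shows "homogeneous_sum v (\<lambda>x. f x * g x)"
  using assms(1)
proof induction
  case (single d f)
  from g show ?case
  proof induction
    case (single e g)
    then show ?case using homogeneous_at_mult[OF \<open>homogeneous_at v d f\<close>] homogeneous_sum.single by blast
  next
    case (add g1 g2)
    show ?case unfolding distrib_left by (rule homogeneous_sum.add[OF add.IH])
  qed
next
  case (add f1 f2)
  show ?case unfolding distrib_right by (rule homogeneous_sum.add[OF add.IH])
qed

lemma homogeneous_sum_const: "homogeneous_sum v (\<lambda>x. c)"
  by (rule homogeneous_sum.single[of v 0]) (auto simp: homogeneous_at_def intro: real_polynomial_function.intros)

text \<open>A linear \<open>f\<close> splits about \<open>v\<close> into \<open>f x - f v\<close> of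
  degree 1 and the constant \<open>f v\<close> of degree 0; sums and products stay in the
  class.\<close>

lemma real_polynomial_function_homogeneous_sum:
  assumes "real_polynomial_function g"
  shows "homogeneous_sum v g"
  using assms
proof induction
  case (linear f)
  then interpret L: bounded_linear f .
  have "homogeneous_at v 1 (\<lambda>x. f x - f v)"
    unfolding homogeneous_at_def
    using linear by (auto simp: L.add L.diff L.scale algebra_simps intro: real_polynomial_function.intros real_polynomial_function_diff)
  then have "homogeneous_sum v (\<lambda>x. (f x - f v) + f v)"
    by (intro homogeneous_sum.add homogeneous_sum_const homogeneous_sum.single)
  then show ?case by simp
qed (auto intro: homogeneous_sum_const homogeneous_sum.add homogeneous_sum_mult)

text \<open>Euler's identity: both sides are the derivative at \<open>t = 1\<close> of
  \<open>g\<close> along the ray from \<open>v\<close> through \<open>x\<close>.\<close>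

lemma homogeneous_at_Euler:
  assumes g: "homogeneous_at v d g"
  shows "frechet_derivative g (at x) (x - v) = real d * g x"
proof -
  have "g differentiable (at x)"
    using g differentiable_at_real_polynomial_function by (auto simp: homogeneous_at_def)
  then have "(g has_derivative frechet_derivative g (at x)) (at (v + 1 *\<^sub>R (x - v)))"
    by (simp add: frechet_derivative_works[symmetric])
  moreover have "((\<lambda>t. v + t *\<^sub>R (x - v)) has_derivative (\<lambda>t. t *\<^sub>R (x - v))) (at (1::real))"
    by (auto intro!: derivative_eq_intros)
  ultimately have "((\<lambda>t. g (v + t *\<^sub>R (x - v))) has_derivative (\<lambda>t. frechet_derivative g (at x) (t *\<^sub>R (x - v)))) (at 1)"
    by (rule has_derivative_compose[rotated])
  then have 1: "((\<lambda>t. t ^ d * g x) has_derivative (\<lambda>t. frechet_derivative g (at x) (t *\<^sub>R (x - v)))) (at (1::real))"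
    using g by (simp add: homogeneous_at_def)
  have 2: "((\<lambda>t. t ^ d * g x) has_derivative (\<lambda>t. t * (real d * g x))) (at (1::real))"
    by (auto intro!: derivative_eq_intros)
  have "(\<lambda>t. frechet_derivative g (at x) (t *\<^sub>R (x - v))) = (\<lambda>t. t * (real d * g x))"
    by (rule has_derivative_unique[OF 1 2])
  from fun_cong[OF this, of 1] show ?thesis by simp
qed

lemma vol_int_add:
  "compact K \<Longrightarrow> continuous_on UNIV f \<Longrightarrow> continuous_on UNIV g \<Longrightarrow>
   vol_int K (\<lambda>x. f x + g x) = vol_int K f + vol_int K g"
  unfolding vol_int_def by (intro Bochner_Integration.integral_add integrable_lebesgue_on_compact)

lemma vol_int_sum:
  "compact K \<Longrightarrow> (\<And>i. i \<in> I \<Longrightarrow> continuous_on UNIV (f i)) \<Longrightarrow>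
   vol_int K (\<lambda>x. \<Sum>i\<in>I. f i x) = (\<Sum>i\<in>I. vol_int K (f i))"
  unfolding vol_int_def by (intro Bochner_Integration.integral_sum integrable_lebesgue_on_compact)

lemma vol_int_mult_right: "vol_int K (\<lambda>x. f x * c) = vol_int K f * c"
  unfolding vol_int_def by simp

lemma polynomial_function_diff_const: "polynomial_function (\<lambda>x::real^'n. x - v)"
  by (intro polynomial_function_diff polynomial_function_id polynomial_function_const)

text \<open>The integrand is the divergence of the field \<open>g x *\<^sub>R (x - v)\<close>, whose
  normal component on \<open>F\<close> is \<open>(b - \<nu> \<bullet> v) * g x\<close> and vanishes
  on all facets through \<open>v\<close>. For \<open>g\<close> homogeneous of degree
  \<open>d\<close> Euler's identity reduces the integrand to \<open>(CARD('n) + d) * g x\<close>,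
  which gives the scaling identity; both sides are additive in \<open>g\<close>.\<close>

lemma cone_flux:
  fixes K F :: "(real^'n) set"
  assumes dim: "CARD('n) = 2 \<or> CARD('n) = 3"
    and K: "int CARD('n) simplex K" and F: "F facet_of K" and s: "supporting K F \<nu> b"
    and v: "v \<in> K" "\<nu> \<bullet> v \<noteq> b" and cone: "K = apex_cone v F" and g: "real_polynomial_function g"
  shows "vol_int K (\<lambda>x. real CARD('n) * g x + frechet_derivative g (at x) (x - v)) = (b - \<nu> \<bullet> v) * facet_int F g"
  using real_polynomial_function_homogeneous_sum[OF g, of v]
proof induction
  case (single d g)
  obtain c where c: "affine hull F = {x. unit_normal F \<bullet> x = c}" "\<forall>y. foot F y = y - (unit_normal F \<bullet> y - c) *\<^sub>R unit_normal F"
    by (rule unit_normal_plane[OF K F])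
  obtain x0 where x0: "x0 \<in> F" using facet_basic(3)[OF K F] by auto
  \<comment> \<open>Facet integrals use \<open>unit_normal F\<close>, whose sign is arbitrary; the
    absolute value in \<open>cone_integral\<close> absorbs it.\<close>
  have pm: "unit_normal F = \<nu> \<or> unit_normal F = - \<nu>"
    using unit_normal_props(1)[OF K F] outer_normal_eq[OF K F s] by simp
  have "unit_normal F \<bullet> x0 = c" using c(1) hull_inc[OF x0, of affine] by auto
  moreover have "\<nu> \<bullet> x0 = b" by (rule supportingD(6)[OF s x0])
  moreover have "\<nu> \<bullet> v \<le> b" by (rule supportingD(4)[OF s v(1)])
  ultimately have h: "\<bar>c - unit_normal F \<bullet> v\<bar> = b - \<nu> \<bullet> v" "unit_normal F \<bullet> v \<noteq> c"
    using pm v(2) by auto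
  have gc: "continuous_on UNIV g" and gh: "\<And>x t. g (v + t *\<^sub>R (x - v)) = t ^ d * g x"
    using single by (auto simp: homogeneous_at_def intro: continuous_real_polynomial_function)
  have "real (CARD('n) + d) * vol_int (apex_cone v F) g =
    \<bar>c - unit_normal F \<bullet> v\<bar> * vol_int (thicken (unit_normal F) F) (\<lambda>y. g (y - (unit_normal F \<bullet> y - c) *\<^sub>R unit_normal F))"
  proof (rule cone_integral[OF dim facet_basic(2)[OF K F] unit_normal_props(2)[OF K F] _ h(2) gc])
    show "unit_normal F \<bullet> x = c" if "x \<in> F" for x using c(1) hull_inc[OF that, of affine] by auto
  qed (rule gh)
  moreover have "vol_int (thicken (unit_normal F) F) (\<lambda>y. g (y - (unit_normal F \<bullet> y - c) *\<^sub>R unit_normal F)) = facet_int F g"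
    unfolding facet_int_def vol_int_def prism_eq using c(2) by simp
  moreover have "vol_int K (\<lambda>x. real CARD('n) * g x + frechet_derivative g (at x) (x - v)) = real (CARD('n) + d) * vol_int K g"
    using vol_int_mult_right[of K g "real (CARD('n) + d)"]
    by (simp add: homogeneous_at_Euler[OF single] algebra_simps)
  ultimately show ?case using cone h(1) by simp
next
  case (add f g)
  have p: "real_polynomial_function f" "real_polynomial_function g"
    using add.hyps by (auto intro: homogeneous_sum_polynomial)
  have c: "continuous_on UNIV (\<lambda>x. real CARD('n) * f x + frechet_derivative f (at x) (x - v))" if "real_polynomial_function f" for f
    using that real_polynomial_function_frechet_derivative[OF that polynomial_function_diff_const]
    by (intro continuous_intros continuous_real_polynomial_function)
  have "vol_int K (\<lambda>x. real CARD('n) * (f x + g x) + frechet_derivative (\<lambda>x. f x + g x) (at x) (x - v)) =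
    vol_int K (\<lambda>x. (real CARD('n) * f x + frechet_derivative f (at x) (x - v)) + (real CARD('n) * g x + frechet_derivative g (at x) (x - v)))"
    by (simp add: frechet_derivative_add[OF p] algebra_simps)
  also have "\<dots> = (b - \<nu> \<bullet> v) * facet_int F f + (b - \<nu> \<bullet> v) * facet_int F g"
    using vol_int_add[OF full_simplex(2)[OF K] c[OF p(1)] c[OF p(2)]] add.IH by simp
  also have "\<dots> = (b - \<nu> \<bullet> v) * facet_int F (\<lambda>x. f x + g x)"
    using facet_int_add[OF K F] p by (simp add: continuous_real_polynomial_function distrib_left)
  finally show ?case .
qed

text \<open>For a simplex this exhibits \<open>K\<close> as the cone from a vertex over the opposite
  facet, as \<open>cone_flux\<close> requires.\<close>

lemma apex_cone_convex_hull:
  fixes v :: "real^'n"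
  assumes "S \<noteq> {}"
  shows "apex_cone v (convex hull S) = convex hull (insert v S)"
proof -
  have "convex hull (insert v S) = {x. \<exists>u\<ge>0. \<exists>w\<ge>0. \<exists>b. u + w = 1 \<and> b \<in> convex hull S \<and> x = u *\<^sub>R v + w *\<^sub>R b}"
    using convex_hull_insert[OF assms, of v] by auto
  also have "\<dots> = apex_cone v (convex hull S)"
  proof (intro equalityI subsetI)
    fix x assume "x \<in> apex_cone v (convex hull S)"
    then obtain b t where bt: "b \<in> convex hull S" "0 \<le> t" "t \<le> 1" "x = v + t *\<^sub>R (b - v)" by (auto simp: apex_cone_def)
    then have "x = (1 - t) *\<^sub>R v + t *\<^sub>R b" by (simp add: algebra_simps)
    then show "x \<in> {x. \<exists>u\<ge>0. \<exists>w\<ge>0. \<exists>b. u + w = 1 \<and> b \<in> convex hull S \<and> x = u *\<^sub>R v + w *\<^sub>R b}"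
      using bt by (intro CollectI exI[of _ "1 - t"] conjI exI[of _ t] exI[of _ b]) auto
  next
    fix x assume "x \<in> {x. \<exists>u\<ge>0. \<exists>w\<ge>0. \<exists>b. u + w = 1 \<and> b \<in> convex hull S \<and> x = u *\<^sub>R v + w *\<^sub>R b}"
    then obtain u w b where h: "0 \<le> u" "0 \<le> w" "u + w = 1" "b \<in> convex hull S" "x = u *\<^sub>R v + w *\<^sub>R b" by auto
    then have u: "u = 1 - w" by simp
    have "x = v + w *\<^sub>R (b - v)" using h(5) unfolding u by (simp add: algebra_simps)
    then show "x \<in> apex_cone v (convex hull S)"
      unfolding apex_cone_def using h by (intro image_eqI[of _ _ "(b, w)"]) auto
  qed
  finally show ?thesis by simp
qed

text \<open>A constant field \<open>e = \<Sum> \<alpha> v *\<^sub>R v\<close> with \<open>\<Sum> \<alpha> v = 0\<close> equals \<open>- \<Sum> \<alpha> v *\<^sub>R (x - v)\<close>, and the field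
  \<open>x - v\<close> is tangential to all facets but the one opposite to the vertex \<open>v\<close>.\<close>

lemma divergence_theorem_direction:
  fixes K :: "(real^'n) set"
  assumes dim: "CARD('n) = 2 \<or> CARD('n) = 3"
    and K: "int CARD('n) simplex K" and g: "real_polynomial_function g"
  shows "vol_int K (\<lambda>x. frechet_derivative g (at x) e) = (\<Sum>F\<in>facets K. facet_int F g * (e \<bullet> outer_normal K F))"
proof -
  obtain C where C: "finite C" "\<not> affine_dependent C" "int (card C) = int CARD('n) + 1" "K = convex hull C"
    using K by (auto simp: simplex)
  define Fv where "Fv = (\<lambda>v. convex hull (C - {v}))"
  have card: "card C \<ge> 2" using C(3) dim by auto
  have ne: "C - {v} \<noteq> {}" for v
  proof
    assume "C - {v} = {}"
    then have "card C \<le> card {v}" by (intro card_mono) auto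
    then show False using card by simp
  qed
  have notin: "v \<notin> affine hull (C - {v})" if "v \<in> C" for v
    using C(2) that by (auto simp: affine_dependent_def)
  have FvF: "Fv v facet_of K" if "v \<in> C" for v
    unfolding C(4) Fv_def using facet_of_convex_hull_affine_independent[OF C(2)] ne that by auto
  have facets: "facets K = Fv ` C"
    unfolding facets_def C(4) Fv_def using facet_of_convex_hull_affine_independent[OF C(2)] ne by auto
  have inFv: "v \<in> Fv w" if "v \<in> C" "v \<noteq> w" for v w using that by (auto simp: Fv_def intro: hull_inc)
  have notinFv: "v \<notin> Fv v" if "v \<in> C" for v
    using notin[OF that] convex_hull_subset_affine_hull by (auto simp: Fv_def)
  have inj: "inj_on Fv C" using inFv notinFv by (metis inj_onI)
  have "\<exists>b. supporting K (Fv v) (outer_normal K (Fv v)) b" if "v \<in> C" for v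
    using outer_normal_supporting[OF K FvF[OF that]] by metis
  then obtain b where b: "\<And>v. v \<in> C \<Longrightarrow> supporting K (Fv v) (outer_normal K (Fv v)) (b v)" by metis
  have CK: "v \<in> K" if "v \<in> C" for v using that by (simp add: C(4) hull_inc)
  have apex: "outer_normal K (Fv v) \<bullet> v \<noteq> b v" if "v \<in> C" for v
    using supportingD(5)[OF b[OF that]] CK[OF that] notinFv[OF that] by blast
  have flux: "vol_int K (\<lambda>x. real CARD('n) * g x + frechet_derivative g (at x) (x - v)) =
      (b v - outer_normal K (Fv v) \<bullet> v) * facet_int (Fv v) g" if "v \<in> C" for v
  proof (rule cone_flux[OF dim K FvF[OF that] b[OF that] CK[OF that] apex[OF that] _ g])
    show "K = apex_cone v (Fv v)"
      unfolding Fv_def C(4) using apex_cone_convex_hull[OF ne] that by (simp add: insert_absorb)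
  qed
  \<comment> \<open>The coefficients are differences of the barycentric coordinates of
    \<open>e\<close> and of the origin.\<close>
  have "\<exists>\<alpha>. sum \<alpha> C = 0 \<and> (\<Sum>v\<in>C. \<alpha> v *\<^sub>R v) = e"
  proof -
    have "affine hull C = UNIV" using full_simplex(5)[OF K] by (simp add: C(4))
    then have "e \<in> affine hull C" "0 \<in> affine hull C" by auto
    then obtain p q where "sum p C = 1" "(\<Sum>v\<in>C. p v *\<^sub>R v) = e" "sum q C = 1" "(\<Sum>v\<in>C. q v *\<^sub>R v) = 0"
      by (auto simp: affine_hull_finite[OF C(1)])
    then show ?thesis by (intro exI[of _ "\<lambda>v. p v - q v"]) (simp add: sum_subtractf scaleR_left_diff_distrib)
  qed
  then obtain \<alpha> where \<alpha>: "sum \<alpha> C = 0" "(\<Sum>v\<in>C. \<alpha> v *\<^sub>R v) = e" by blast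
  \<comment> \<open>All vertices other than \<open>w\<close> lie in the hyperplane of the facet
    opposite to \<open>w\<close>. As the coefficients sum to zero, \<open>b w\<close> may be
    subtracted in each term, and only the term of \<open>w\<close> survives.\<close>
  have normal: "e \<bullet> outer_normal K (Fv w) = - \<alpha> w * (b w - outer_normal K (Fv w) \<bullet> w)" if w: "w \<in> C" for w
  proof -
    let ?N = "outer_normal K (Fv w)"
    have "e \<bullet> ?N = (\<Sum>v\<in>C. \<alpha> v * (?N \<bullet> v))" unfolding \<alpha>(2)[symmetric] inner_sum_left by (simp add: inner_commute[of ?N])
    also have "\<dots> = (\<Sum>v\<in>C. \<alpha> v * (?N \<bullet> v - b w))"
      using \<alpha>(1) by (simp add: right_diff_distrib sum_subtractf sum_distrib_right[symmetric])
    also have "\<dots> = (\<Sum>v\<in>C. if v = w then \<alpha> w * (?N \<bullet> w - b w) else 0)"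
      using supportingD(6)[OF b[OF w]] inFv by (intro sum.cong) auto
    also have "\<dots> = - \<alpha> w * (b w - ?N \<bullet> w)" using C(1) w by (simp add: algebra_simps)
    finally show ?thesis .
  qed
  \<comment> \<open>The terms that do not depend on the summation index,
    \<open>CARD('n) * g x\<close> and the derivative in direction \<open>x\<close>, cancel because
    the coefficients sum to zero.\<close>
  have der: "frechet_derivative g (at x) e = (\<Sum>v\<in>C. (real CARD('n) * g x + frechet_derivative g (at x) (x - v)) * (- \<alpha> v))" for x
  proof -
    have "linear (frechet_derivative g (at x))"
      using differentiable_at_real_polynomial_function[OF g] by (rule linear_frechet_derivative)
    then interpret L: linear "frechet_derivative g (at x)" .
    have "(\<Sum>v\<in>C. (real CARD('n) * g x + frechet_derivative g (at x) (x - v)) * (- \<alpha> v)) =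
      (\<Sum>v\<in>C. \<alpha> v * frechet_derivative g (at x) v) - (real CARD('n) * g x + frechet_derivative g (at x) x) * sum \<alpha> C"
      unfolding L.diff sum_distrib_left sum_subtractf[symmetric] by (intro sum.cong) (auto simp: algebra_simps)
    also have "(\<Sum>v\<in>C. \<alpha> v * frechet_derivative g (at x) v) = frechet_derivative g (at x) e"
      by (simp add: \<alpha>(2)[symmetric] L.sum L.scale)
    finally show ?thesis using \<alpha>(1) by simp
  qed
  have "vol_int K (\<lambda>x. frechet_derivative g (at x) e) =
      (\<Sum>v\<in>C. vol_int K (\<lambda>x. (real CARD('n) * g x + frechet_derivative g (at x) (x - v)) * (- \<alpha> v)))"
    unfolding der
    using g real_polynomial_function_frechet_derivative[OF g polynomial_function_diff_const]
    by (intro vol_int_sum full_simplex(2)[OF K] continuous_intros continuous_real_polynomial_function)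
  also have "\<dots> = (\<Sum>v\<in>C. facet_int (Fv v) g * (e \<bullet> outer_normal K (Fv v)))"
    unfolding vol_int_mult_right by (intro sum.cong) (simp_all add: flux normal)
  also have "\<dots> = (\<Sum>F\<in>facets K. facet_int F g * (e \<bullet> outer_normal K F))"
    unfolding facets by (simp add: sum.reindex[OF inj])
  finally show ?thesis .
qed

lemma divergence_components:
  assumes "w differentiable (at x)"
  shows "divergence w x = (\<Sum>i\<in>UNIV. frechet_derivative (\<lambda>y. w y $ i) (at x) (axis i 1))"
proof -
  have "(w has_derivative frechet_derivative w (at x)) (at x)"
    using assms by (simp add: frechet_derivative_works)
  then have "((\<lambda>y. w y $ i) has_derivative (\<lambda>z. frechet_derivative w (at x) z $ i)) (at x)" for i
    by (auto intro!: derivative_eq_intros bounded_linear.has_derivative[OF bounded_linear_vec_nth])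
  then have "frechet_derivative (\<lambda>y. w y $ i) (at x) = (\<lambda>z. frechet_derivative w (at x) z $ i)" for i
    by (rule frechet_derivative_at[symmetric])
  then show ?thesis by (simp add: divergence_def grad_def trace_def matrix_def)
qed

lemma differentiable_component_polynomials:
  fixes w :: "real^'n \<Rightarrow> real^'n"
  assumes "\<And>i. real_polynomial_function (\<lambda>x. w x $ i)"
  shows "w differentiable (at x)"
proof -
  have "(\<lambda>x. w x \<bullet> b) differentiable (at x)" if "b \<in> Basis" for b
    using that differentiable_at_real_polynomial_function[OF assms] by (auto simp: Basis_vec_def inner_axis)
  then show ?thesis using differentiable_componentwise_within by blast
qed

text \<open>Each component of \<open>w\<close> is treated as a scalar function with its coordinate
  vector as direction, and the results are summed.\<close>

lemma divergence_theorem_simplex: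
  fixes K :: "(real^'n) set" and w :: "real^'n \<Rightarrow> real^'n"
  assumes dim: "CARD('n) = 2 \<or> CARD('n) = 3"
    and K: "int CARD('n) simplex K" and w: "\<And>i. real_polynomial_function (\<lambda>x. w x $ i)"
  shows "vol_int K (divergence w) = (\<Sum>F\<in>facets K. facet_int F (\<lambda>x. w x \<bullet> outer_normal K F))"
proof -
  have "divergence w = (\<lambda>x. \<Sum>i\<in>UNIV. frechet_derivative (\<lambda>y. w y $ i) (at x) (axis i 1))"
    by (simp add: divergence_components[OF differentiable_component_polynomials[OF w]] fun_eq_iff)
  then have "vol_int K (divergence w) = (\<Sum>i\<in>UNIV. vol_int K (\<lambda>x. frechet_derivative (\<lambda>y. w y $ i) (at x) (axis i 1)))"
    using real_polynomial_function_frechet_derivative[OF w polynomial_function_const]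
    by (simp add: vol_int_sum full_simplex(2)[OF K] continuous_real_polynomial_function)
  also have "\<dots> = (\<Sum>i\<in>UNIV. \<Sum>F\<in>facets K. facet_int F (\<lambda>x. w x $ i) * (axis i 1 \<bullet> outer_normal K F))"
    by (simp add: divergence_theorem_direction[OF dim K w])
  also have "\<dots> = (\<Sum>F\<in>facets K. \<Sum>i\<in>UNIV. facet_int F (\<lambda>x. w x $ i) * (outer_normal K F $ i))"
    by (subst sum.swap) (simp add: inner_axis')
  also have "\<dots> = (\<Sum>F\<in>facets K. facet_int F (\<lambda>x. w x \<bullet> outer_normal K F))"
  proof (rule sum.cong)
    fix F assume "F \<in> facets K"
    then have F: "F facet_of K" by (simp add: facets_def)
    show "(\<Sum>i\<in>UNIV. facet_int F (\<lambda>x. w x $ i) * (outer_normal K F $ i)) = facet_int F (\<lambda>x. w x \<bullet> outer_normal K F)"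
      unfolding inner_vec_def inner_real_def
      by (subst facet_int_sum[OF K F])
        (auto simp: facet_int_mult_right intro!: continuous_intros continuous_real_polynomial_function w)
  qed simp
  finally show ?thesis .
qed

section \<open>Piecewise polynomials\<close>

abbreviation multiindices :: "nat \<Rightarrow> ('n::finite \<Rightarrow> nat) set" where
  "multiindices k \<equiv> {a. (\<Sum>i\<in>UNIV. a i) \<le> k}"

lemma finite_multiindices: "finite (multiindices k :: ('n::finite \<Rightarrow> nat) set)"
proof (rule finite_subset)
  show "multiindices k \<subseteq> (UNIV :: 'n set) \<rightarrow>\<^sub>E {..k}"
  proof
    fix a :: "'n \<Rightarrow> nat" assume a: "a \<in> multiindices k"
    have "a i \<le> k" for i
    proof -
      have "a i \<le> (\<Sum>i\<in>UNIV. a i)" by (rule member_le_sum) auto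
      then show ?thesis using a by simp
    qed
    then show "a \<in> UNIV \<rightarrow>\<^sub>E {..k}" by (simp add: PiE_UNIV_domain)
  qed
  show "finite ((UNIV :: 'n set) \<rightarrow>\<^sub>E {..k})" by (intro finite_PiE) auto
qed

lemma P_cong: "(\<And>x. x \<in> S \<Longrightarrow> f x = g x) \<Longrightarrow> f \<in> P k S \<longleftrightarrow> g \<in> P k S"
  unfolding P_def by auto

lemma P_subset: "f \<in> P k UNIV \<Longrightarrow> f \<in> P k S"
  unfolding P_def by auto

text \<open>Membership in \<open>P k S\<close> constrains values on \<open>S\<close> only; the
  extension is continuous and differentiable everywhere, so traces and derivatives can be computed
  from it.\<close>

lemma P_extend:
  assumes "f \<in> P k S"
  obtains g where "g \<in> P k UNIV" "\<And>x. x \<in> S \<Longrightarrow> f x = g x"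
proof -
  obtain c :: "('a \<Rightarrow> nat) \<Rightarrow> real" where "\<forall>x\<in>S. f x = (\<Sum>a \<in> multiindices k. c a * (\<Prod>i\<in>UNIV. (x $ i) ^ a i))"
    using assms by (auto simp: P_def)
  then show ?thesis
    by (intro that[of "\<lambda>x. \<Sum>a \<in> multiindices k. c a * (\<Prod>i\<in>UNIV. (x $ i) ^ a i)"]) (auto simp: P_def)
qed

lemma P_add: "f \<in> P k S \<Longrightarrow> g \<in> P k S \<Longrightarrow> (\<lambda>x. f x + g x) \<in> P k S"
proof -
  assume "f \<in> P k S" "g \<in> P k S"
  then obtain c d :: "('a \<Rightarrow> nat) \<Rightarrow> real" where
    "\<forall>x\<in>S. f x = (\<Sum>a \<in> multiindices k. c a * (\<Prod>i\<in>UNIV. (x $ i) ^ a i))"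
    "\<forall>x\<in>S. g x = (\<Sum>a \<in> multiindices k. d a * (\<Prod>i\<in>UNIV. (x $ i) ^ a i))"
    unfolding P_def by blast
  then show ?thesis
    unfolding P_def by (intro CollectI exI[of _ "\<lambda>a. c a + d a"]) (simp add: distrib_right sum.distrib)
qed

lemma P_mult_right: "f \<in> P k S \<Longrightarrow> (\<lambda>x. f x * r) \<in> P k S"
proof -
  assume "f \<in> P k S"
  then obtain c :: "('a \<Rightarrow> nat) \<Rightarrow> real" where
    "\<forall>x\<in>S. f x = (\<Sum>a \<in> multiindices k. c a * (\<Prod>i\<in>UNIV. (x $ i) ^ a i))"
    unfolding P_def by blast
  then show ?thesis
    unfolding P_def by (intro CollectI exI[of _ "\<lambda>a. r * c a"]) (simp add: sum_distrib_left mult_ac)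
qed

lemma P_0: "(\<lambda>x. 0) \<in> P k S"
  unfolding P_def by (intro CollectI exI[of _ "\<lambda>a. 0"]) simp

lemma P_sum: "(\<And>i. i \<in> I \<Longrightarrow> f i \<in> P k S) \<Longrightarrow> (\<lambda>x. \<Sum>i\<in>I. f i x) \<in> P k S"
  by (induction I rule: infinite_finite_induct) (auto intro: P_0 P_add)

lemma P_monomial:
  assumes "(\<Sum>i\<in>UNIV. a i) \<le> k"
  shows "(\<lambda>x::real^'n. \<Prod>i\<in>UNIV. (x $ i) ^ a i) \<in> P k S"
proof -
  have "(\<Sum>b\<in>multiindices k. (if b = a then 1 else 0) * (\<Prod>i\<in>UNIV. (x $ i) ^ b i)) = (\<Prod>i\<in>UNIV. (x $ i) ^ a i)"
    (is "?L = ?R") for x :: "real^'n"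
  proof -
    have "?L = (\<Sum>b\<in>multiindices k. if b = a then ?R else 0)" by (intro sum.cong) auto
    also have "\<dots> = ?R" using assms by (subst sum.delta[OF finite_multiindices]) simp
    finally show ?thesis .
  qed
  then show ?thesis
    unfolding P_def by (intro CollectI exI[of _ "\<lambda>b. if b = a then 1 else 0"]) simp
qed

lemma P_const: "(\<lambda>x::real^'n. r) \<in> P k S"
  using P_mult_right[OF P_monomial[of "\<lambda>i::'n. 0" k], where r = r and S = S] by simp

lemma P_polynomial:
  assumes "f \<in> P k (UNIV :: (real^'n) set)"
  shows "real_polynomial_function f"
proof -
  obtain c :: "('n \<Rightarrow> nat) \<Rightarrow> real" where
    f: "\<forall>x\<in>UNIV. f x = (\<Sum>a \<in> multiindices k. c a * (\<Prod>i\<in>UNIV. (x $ i) ^ a i))"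
    using assms unfolding P_def by blast
  have "real_polynomial_function (\<lambda>x::real^'n. \<Sum>a \<in> multiindices k. c a * (\<Prod>i\<in>UNIV. (x $ i) ^ a i))"
    by (intro real_polynomial_function_sum finite_multiindices real_polynomial_function.intros
        real_polynomial_function_prod real_polynomial_function_power) (auto intro: bounded_linear_vec_nth)
  then show ?thesis using f by (simp add: fun_eq_iff[symmetric])
qed

lemma prod_powers_update:
  fixes x :: "real^'n"
  shows "(\<Prod>j\<in>UNIV. (x $ j) ^ (a(i := m)) j) = (x $ i) ^ m * (\<Prod>j\<in>UNIV - {i}. (x $ j) ^ a j)"
  by (subst prod.remove[of UNIV i]) (auto intro!: prod.cong)

text \<open>On the line through \<open>x\<close> in direction \<open>axis i 1\<close> a monomial is
  a constant times a power of \<open>x $ i + t\<close>, so differentiation lowers one exponent and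
  with it the total degree.\<close>

lemma P_partial_derivative:
  assumes f: "f \<in> P k (UNIV :: (real^'n) set)"
  shows "(\<lambda>x. frechet_derivative f (at x) (axis i 1)) \<in> P (k - 1) UNIV"
proof -
  obtain c :: "('n \<Rightarrow> nat) \<Rightarrow> real" where
    c: "\<forall>x\<in>UNIV. f x = (\<Sum>a \<in> multiindices k. c a * (\<Prod>j\<in>UNIV. (x $ j) ^ a j))"
    using f unfolding P_def by blast
  have der: "frechet_derivative f (at x) (axis i 1) =
      (\<Sum>a \<in> multiindices k. (\<Prod>j\<in>UNIV. (x $ j) ^ (a(i := a i - 1)) j) * (c a * real (a i)))" for x
  proof -
    let ?l = "\<lambda>t. x + t *\<^sub>R axis i 1"
    have "(f has_derivative frechet_derivative f (at x)) (at (?l 0))"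
      using differentiable_at_real_polynomial_function[OF P_polynomial[OF f]]
      by (simp add: frechet_derivative_works[symmetric])
    moreover have "(?l has_derivative (\<lambda>t. t *\<^sub>R axis i 1)) (at (0::real))"
      by (auto intro!: derivative_eq_intros)
    ultimately have 1: "((\<lambda>t. f (?l t)) has_derivative (\<lambda>t. frechet_derivative f (at x) (t *\<^sub>R axis i 1))) (at 0)"
      by (rule has_derivative_compose[rotated])
    have "f (?l t) = (\<Sum>a \<in> multiindices k. c a * ((x $ i + t) ^ a i * (\<Prod>j\<in>UNIV - {i}. (x $ j) ^ a j)))" for t
    proof -
      have "(\<Prod>j\<in>UNIV. (?l t $ j) ^ a j) = (x $ i + t) ^ a i * (\<Prod>j\<in>UNIV - {i}. (x $ j) ^ a j)" for a
        by (subst prod.remove[of UNIV i]) (auto simp: axis_def intro!: prod.cong)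
      then show ?thesis using c by simp
    qed
    moreover have "((\<lambda>t. \<Sum>a \<in> multiindices k. c a * ((x $ i + t) ^ a i * (\<Prod>j\<in>UNIV - {i}. (x $ j) ^ a j))) has_derivative
       (\<lambda>t. \<Sum>a \<in> multiindices k. c a * (t * real (a i) * (x $ i) ^ (a i - 1) * (\<Prod>j\<in>UNIV - {i}. (x $ j) ^ a j)))) (at (0::real))"
      by (auto intro!: derivative_eq_intros has_derivative_sum simp: mult_ac)
    ultimately have 2: "((\<lambda>t. f (?l t)) has_derivative
       (\<lambda>t. \<Sum>a \<in> multiindices k. c a * (t * real (a i) * (x $ i) ^ (a i - 1) * (\<Prod>j\<in>UNIV - {i}. (x $ j) ^ a j)))) (at (0::real))"
      by simp
    from fun_cong[OF has_derivative_unique[OF 1 2], of 1] show ?thesis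
      unfolding prod_powers_update by (simp add: mult_ac)
  qed
  have "(\<lambda>x. (\<Prod>j\<in>UNIV. (x $ j) ^ (a(i := a i - 1)) j) * (c a * real (a i))) \<in> P (k - 1) UNIV"
    if a: "a \<in> multiindices k" for a
  \<comment> \<open>For \<open>a i = 0\<close> the truncated exponent \<open>a i - 1\<close> is
    \<open>0\<close>, but the factor \<open>real (a i)\<close> removes the term. Otherwise
    \<open>k\<close> is positive and the degree does drop.\<close>
  proof (cases "a i = 0")
    case True
    then show ?thesis by (simp add: P_0)
  next
    case False
    have "(\<Sum>j\<in>UNIV. (a(i := a i - 1)) j) = (a i - 1) + (\<Sum>j\<in>UNIV - {i}. a j)"
      by (subst sum.remove[of UNIV i]) auto
    moreover have "(\<Sum>j\<in>UNIV. a j) = a i + (\<Sum>j\<in>UNIV - {i}. a j)"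
      by (subst sum.remove[of UNIV i]) auto
    ultimately have "(\<Sum>j\<in>UNIV. (a(i := a i - 1)) j) \<le> k - 1" using False a by simp
    then show ?thesis by (intro P_mult_right P_monomial)
  qed
  then show ?thesis unfolding der by (rule P_sum)
qed

lemma Pvec_extend:
  assumes "u \<in> Pvec k S"
  obtains w where "\<And>i. (\<lambda>x. w x $ i) \<in> P k UNIV" "\<And>x. x \<in> S \<Longrightarrow> u x = w x"
proof -
  have "\<exists>g. g \<in> P k UNIV \<and> (\<forall>x\<in>S. u x $ i = g x)" for i
  proof -
    have "(\<lambda>x. u x $ i) \<in> P k S" using assms by (simp add: Pvec_def)
    then show ?thesis by (rule P_extend) auto
  qed
  then obtain g where "\<forall>i. g i \<in> P k UNIV \<and> (\<forall>x\<in>S. u x $ i = g i x)"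
    using choice[of "\<lambda>i g. g \<in> P k UNIV \<and> (\<forall>x\<in>S. u x $ i = g x)"] by auto
  then show ?thesis by (intro that[of "\<lambda>x. \<chi> i. g i x"]) (auto simp: vec_eq_iff)
qed

text \<open>Every point of the closed cell is a limit point of its interior, so the limit is unique
  and equals the value of the continuous representative.\<close>

lemma cell_trace_eq:
  fixes u w :: "real^'n \<Rightarrow> 'b::t2_space"
  assumes K: "int CARD('n) simplex K" and w: "continuous_on UNIV w"
    and eq: "\<And>y. y \<in> interior K \<Longrightarrow> u y = w y" and x: "x \<in> K"
  shows "cell_trace K u x = w x"
proof -
  have "x islimpt interior K"
    using x full_simplex(8)[OF K] islimpt_in_closure[of x "interior K"] interior_limit_point[of x "interior K"]
    by (cases "x \<in> interior K") (auto simp: closure_def)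
  then have "at x within interior K \<noteq> bot" by (simp add: trivial_limit_within)
  moreover have "(w \<longlongrightarrow> w x) (at x within interior K)"
    using w by (meson UNIV_I continuous_on_def subset_UNIV tendsto_within_subset)
  then have "(u \<longlongrightarrow> w x) (at x within interior K)"
    by (rule Lim_transform_eventually) (auto simp: eventually_at_filter eq)
  ultimately show ?thesis unfolding cell_trace_def by (rule tendsto_Lim)
qed

lemma divergence_cong_open:
  assumes "\<And>y. y \<in> S \<Longrightarrow> u y = w y" "open S" "x \<in> S" "w differentiable (at x)"
  shows "divergence u x = divergence w x"
  using frechet_derivative_transform_within_open[OF assms(4,2,3), of u] assms(1)
  by (simp add: divergence_def grad_def)

lemma P_divergence:
  fixes w :: "real^'n \<Rightarrow> real^'n"
  assumes "\<And>i. (\<lambda>x. w x $ i) \<in> P k UNIV"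
  shows "divergence w \<in> P (k - 1) UNIV"
proof -
  have "divergence w = (\<lambda>x. \<Sum>i\<in>UNIV. frechet_derivative (\<lambda>y. w y $ i) (at x) (axis i 1))"
    by (simp add: divergence_components[OF differentiable_component_polynomials[OF P_polynomial[OF assms]]] fun_eq_iff)
  also have "\<dots> \<in> P (k - 1) UNIV" by (intro P_sum P_partial_derivative assms)
  finally show ?thesis .
qed

section \<open>Integrals of piecewise continuous functions\<close>

lemma vol_int_spike:
  assumes S: "S \<in> sets lebesgue" and G: "integrable (lebesgue_on S) G" and N: "negligible N"
    and eq: "\<And>x. x \<in> S - N \<Longrightarrow> f x = G x"
  shows "integrable (lebesgue_on S) f" "vol_int S f = vol_int S G"
proof -
  have iff: "integrable (lebesgue_on S) f \<longleftrightarrow> f absolutely_integrable_on S" for f :: "real^'a \<Rightarrow> real"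
    using S by (simp add: set_integrable_def integrable_restrict_space)
  show f: "integrable (lebesgue_on S) f"
    using G unfolding iff by (rule absolutely_integrable_spike[OF _ N]) (rule eq)
  have "integral S f = integral S G" by (rule integral_spike[OF N]) (use eq in auto)
  then show "vol_int S f = vol_int S G"
    unfolding vol_int_def by (simp add: lebesgue_integral_eq_integral f G S)
qed

lemma vol_int_square_eq_0:
  fixes G :: "real^'n \<Rightarrow> real"
  assumes K: "compact K" and G: "continuous_on UNIV G" and 0: "vol_int K (\<lambda>x. G x * G x) = 0" and x: "x \<in> interior K"
  shows "G x = 0"
proof (rule ccontr)
  assume "G x \<noteq> 0"
  have m: "K \<in> sets lebesgue" using K by (simp add: fmeasurableD lmeasurable_compact)
  have "integrable (lebesgue_on K) (\<lambda>x. G x * G x)"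
    by (intro integrable_lebesgue_on_compact K continuous_intros G)
  then have "AE y in lebesgue_on K. G y * G y = 0"
    using 0 unfolding vol_int_def by (subst (asm) integral_nonneg_eq_0_iff_AE) auto
  then have "AE y in lebesgue. y \<in> K \<longrightarrow> G y * G y = 0"
    using m by (simp add: AE_restrict_space_iff)
  then have neg: "negligible {y. \<not> (y \<in> K \<longrightarrow> G y * G y = 0)}"
    by (auto simp: eventually_ae_filter negligible_iff_null_sets[symmetric] intro: negligible_subset)
  have "open (interior K \<inter> {y. G y \<noteq> 0})"
    using G by (intro open_Int open_Collect_neq) auto
  moreover have "interior K \<inter> {y. G y \<noteq> 0} \<subseteq> {y. \<not> (y \<in> K \<longrightarrow> G y * G y = 0)}"
    using interior_subset by auto
  ultimately show False
    using open_not_negligible negligible_subset[OF neg] x \<open>G x \<noteq> 0\<close> by blast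
qed

text \<open>Off the cell frontiers, a null set, a point lies in at most one cell. There
  \<open>f\<close>, extended by zero, is the sum \<open>h\<close> of the pieces \<open>G K\<close>
  extended by zero.\<close>

lemma broken_integral:
  fixes M :: "(real^'n) set set" and f :: "real^'n \<Rightarrow> real"
  assumes M: "finite M" "\<And>K. K \<in> M \<Longrightarrow> convex K" "\<And>K. K \<in> M \<Longrightarrow> compact K"
    and disj: "\<And>K K'. K \<in> M \<Longrightarrow> K' \<in> M \<Longrightarrow> K \<noteq> K' \<Longrightarrow> interior K \<inter> K' = {}"
    and G: "\<And>K. K \<in> M \<Longrightarrow> continuous_on UNIV (G K)"
    and eq: "\<And>K x. K \<in> M \<Longrightarrow> x \<in> interior K \<Longrightarrow> f x = G K x"
  shows "integrable (lebesgue_on (interior (\<Union>M))) f"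
    and "vol_int (interior (\<Union>M)) f = (\<Sum>K\<in>M. vol_int K (G K))"
proof -
  let ?R = "interior (\<Union>M)"
  define h where "h = (\<lambda>x. \<Sum>K\<in>M. if x \<in> K then G K x else 0)"
  define N where "N = (\<Union>K\<in>M. frontier K)"
  have R: "?R \<in> sets lebesgue" by (simp add: borel_open)
  have N: "negligible N"
    unfolding N_def using M by (intro negligible_Union) (auto intro: negligible_convex_frontier)
  have eqh: "(if x \<in> ?R then f x else 0) = h x" if "x \<notin> N" for x
  proof (cases "\<exists>K\<in>M. x \<in> K")
    case True
    then obtain K where K: "K \<in> M" "x \<in> K" by blast
    have "x \<in> interior K"
      using that K M(3)[OF K(1)] compact_imp_closed closure_closed by (auto simp: N_def frontier_def)
    then have "x \<in> ?R" using interior_mono[of K "\<Union>M"] K by auto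
    have "h x = (\<Sum>L\<in>M. if L = K then G K x else 0)"
      unfolding h_def using disj[OF K(1)] \<open>x \<in> interior K\<close> K(2) by (intro sum.cong) auto
    also have "\<dots> = G K x" using M(1) K(1) by simp
    finally show ?thesis using \<open>x \<in> ?R\<close> eq[OF K(1) \<open>x \<in> interior K\<close>] by simp
  next
    case False
    then have "x \<notin> ?R" using interior_subset[of "\<Union>M"] by blast
    moreover have "h x = 0" unfolding h_def using False by (intro sum.neutral) auto
    ultimately show ?thesis by simp
  qed
  have Gi: "G K absolutely_integrable_on K" if "K \<in> M" for K
    using integrable_lebesgue_on_compact[OF M(3)[OF that] G[OF that]] M(3)[OF that]
    by (simp add: set_integrable_def integrable_restrict_space fmeasurableD lmeasurable_compact)
  then have Gi': "(\<lambda>x. if x \<in> K then G K x else 0) absolutely_integrable_on UNIV" if "K \<in> M" for K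
    using that absolutely_integrable_restrict_UNIV by blast
  have hi: "h absolutely_integrable_on UNIV"
    unfolding h_def using M(1) Gi' by (intro absolutely_integrable_sum)
  have "(\<lambda>x. if x \<in> ?R then f x else 0) absolutely_integrable_on UNIV"
    using hi by (rule absolutely_integrable_spike[OF _ N]) (use eqh in auto)
  then have "f absolutely_integrable_on ?R" using absolutely_integrable_restrict_UNIV by blast
  then show f: "integrable (lebesgue_on ?R) f"
    using R by (simp add: set_integrable_def integrable_restrict_space)
  have "vol_int ?R f = integral ?R f" unfolding vol_int_def by (rule lebesgue_integral_eq_integral[OF f R])
  also have "\<dots> = integral UNIV (\<lambda>x. if x \<in> ?R then f x else 0)" by (rule Henstock_Kurzweil_Integration.integral_restrict_UNIV[symmetric])
  also have "\<dots> = integral UNIV h" by (rule integral_spike[OF N]) (use eqh in auto)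
  also have "\<dots> = (\<Sum>K\<in>M. integral UNIV (\<lambda>x. if x \<in> K then G K x else 0))"
    unfolding h_def using Gi' M(1) by (intro Henstock_Kurzweil_Integration.integral_sum) (auto simp: absolutely_integrable_on_def)
  also have "\<dots> = (\<Sum>K\<in>M. vol_int K (G K))"
    using M(3) G by (intro sum.cong) (simp_all add: vol_int_eq_integral Henstock_Kurzweil_Integration.integral_restrict_UNIV)
  finally show "vol_int ?R f = (\<Sum>K\<in>M. vol_int K (G K))" .
qed

lemma P_inner: "(\<And>i. (\<lambda>x. w x $ i) \<in> P k S) \<Longrightarrow> (\<lambda>x. w x \<bullet> a) \<in> P k S"
  unfolding inner_vec_def inner_real_def by (intro P_sum P_mult_right)

lemma P_continuous: "g \<in> P k UNIV \<Longrightarrow> continuous_on S (g :: real^'n \<Rightarrow> real)"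
  by (intro continuous_real_polynomial_function P_polynomial)

section \<open>Conservation of mass\<close>

lemma L2_zero: "(\<lambda>x. 0) \<in> L2 S"
  by (simp add: L2_def)

lemma L2_facet_cong:
  fixes f g :: "real^'n \<Rightarrow> 'b::euclidean_space"
  assumes K: "int CARD('n) simplex K" and F: "F facet_of K" and eq: "\<And>x. x \<in> F \<Longrightarrow> f x = g x"
  shows "f \<in> L2_facet F \<longleftrightarrow> g \<in> L2_facet F"
proof -
  have fg: "f (foot F y) = g (foot F y)" if "y \<in> space (lebesgue_on (prism F))" for y
    using that eq foot_in_facet[OF K F] by simp
  have "(\<lambda>y. f (foot F y)) \<in> borel_measurable (lebesgue_on (prism F)) \<longleftrightarrow> (\<lambda>y. g (foot F y)) \<in> borel_measurable (lebesgue_on (prism F))"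
    by (rule measurable_cong) (rule fg)
  moreover have "integrable (lebesgue_on (prism F)) (\<lambda>y. (norm (f (foot F y)))\<^sup>2) \<longleftrightarrow> integrable (lebesgue_on (prism F)) (\<lambda>y. (norm (g (foot F y)))\<^sup>2)"
    by (rule Bochner_Integration.integrable_cong) (use fg in auto)
  ultimately show ?thesis unfolding L2_facet_def L2_def by simp
qed

lemma L2_facet_rel_interior:
  fixes g :: "real^'n \<Rightarrow> real"
  assumes K: "int CARD('n) simplex K" and F: "F facet_of K" and g: "continuous_on UNIV g"
  shows "(\<lambda>x. indicator (rel_interior F) x * g x) \<in> L2_facet F"
proof -
  have "(norm (indicator (rel_interior F) (foot F y) * g (foot F y)))\<^sup>2 = indicator (rel_interior F) (foot F y) * (g (foot F y) * g (foot F y))" for y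
    by (simp add: indicator_def power2_eq_square)
  moreover have "integrable (lebesgue_on (prism F)) (\<lambda>y. indicator (rel_interior F) (foot F y) * (g (foot F y) * g (foot F y)))"
    by (rule facet_rel_interior_L2[OF K F]) (intro continuous_intros g)
  ultimately show ?thesis
    unfolding L2_facet_def L2_def
    using borel_measurable_integrable[OF facet_rel_interior_L2[OF K F g]] by simp
qed

lemma L2_facet_const:
  fixes F :: "(real^'n) set" and c :: real
  assumes K: "int CARD('n) simplex K" and F: "F facet_of K"
  shows "(\<lambda>x. c) \<in> L2_facet F"
  unfolding L2_facet_def L2_def
  using integrable_lebesgue_on_compact[OF compact_prism[OF K F], of "\<lambda>x. (norm c)\<^sup>2"] by simp

lemma sym_grad_zero: "sym_grad (\<lambda>x. 0) = (\<lambda>x. 0)"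
  by (simp add: sym_grad_def grad_def matrix_def transpose_def fun_eq_iff vec_eq_iff)

lemma divergence_zero: "divergence (\<lambda>x. 0) = (\<lambda>x. 0)"
  by (simp add: divergence_def grad_def matrix_def trace_def fun_eq_iff)

lemma facet_int_rel_interior_diff:
  assumes K: "int CARD('n) simplex K" and F: "F facet_of (K :: (real^'n) set)"
    and "continuous_on UNIV f" "continuous_on UNIV g"
  shows "facet_int F (\<lambda>x. indicator (rel_interior F) x * (f x - g x)) =
    facet_int F (\<lambda>x. indicator (rel_interior F) x * f x) - facet_int F (\<lambda>x. indicator (rel_interior F) x * g x)"
  unfolding facet_int_def right_diff_distrib
  by (intro Bochner_Integration.integral_diff facet_rel_interior_L2[OF K F] assms)

lemma facet_int_rel_interior_sum:
  assumes K: "int CARD('n) simplex K" and F: "F facet_of (K :: (real^'n) set)"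
    and "\<And>i. i \<in> I \<Longrightarrow> continuous_on UNIV (f i)"
  shows "facet_int F (\<lambda>x. indicator (rel_interior F) x * (\<Sum>i\<in>I. f i x)) =
    (\<Sum>i\<in>I. facet_int F (\<lambda>x. indicator (rel_interior F) x * f i x))"
  unfolding facet_int_def sum_distrib_left
  by (intro Bochner_Integration.integral_sum facet_rel_interior_L2[OF K F] assms)

lemma facet_int_0: "facet_int F (\<lambda>x. 0) = 0"
  by (simp add: facet_int_def)

section \<open>Admissible test functions and integrals over the mesh\<close>

context
  fixes D :: "'n::finite setting"
  assumes D: "stokes_darcy_setting D"
begin

lemma facet_int_mesh_0:
  assumes K: "K \<in> mesh D j" and F: "F \<in> facets K" and h: "\<And>x. x \<in> F \<Longrightarrow> x \<in> K \<Longrightarrow> h x = 0"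
  shows "facet_int F h = 0"
proof -
  have sK: "int CARD('n) simplex K" and fF: "F facet_of K"
    using cells_simplex[OF D mesh_cells[OF K]] F by (simp_all add: facets_def)
  have "facet_int F h = facet_int F (\<lambda>x. 0)"
    using facet_basic(4)[OF sK fF] h by (intro facet_int_cong[OF sK fF]) auto
  then show ?thesis by (simp add: facet_int_0)
qed

lemma facet_int_interface_0:
  assumes F: "F \<in> interface_facets D" and h: "\<And>x. x \<in> F \<Longrightarrow> h x = 0"
  shows "facet_int F h = 0"
  using interface_facet_exists[OF D F, of Stokes] facet_int_mesh_0[of _ Stokes F h] h by (auto simp: facets_def)

lemma cell_trace_zero: "K \<in> mesh D j \<Longrightarrow> x \<in> K \<Longrightarrow> cell_trace K (\<lambda>x. 0 :: 'b::real_normed_vector) x = 0"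
  by (rule cell_trace_eq[OF cells_simplex[OF D mesh_cells]]) auto

lemma a_s_zero: "a_s D (u, ub) ((\<lambda>x. 0), (\<lambda>x. 0)) = 0"
proof -
  have "(\<Sum>K\<in>mesh D Stokes. \<Sum>F\<in>facets K. facet_int F (h K F)) = 0"
    if "\<And>K F x. K \<in> mesh D Stokes \<Longrightarrow> x \<in> K \<Longrightarrow> h K F x = 0" for h
    using that by (intro sum.neutral ballI) (auto intro: facet_int_mesh_0)
  then show ?thesis
    unfolding a_s_def case_prod_conv sym_grad_zero
    by (simp add: cell_trace_zero vol_int_def)
qed

lemma b_h_zero: "b_h D j (p, pb) (\<lambda>x. 0) = 0"
proof -
  have "(\<Sum>K\<in>mesh D j. \<Sum>F\<in>facets K. facet_int F (\<lambda>x. pb x * (cell_trace K (\<lambda>x. 0) x \<bullet> outer_normal K F))) = 0"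
    by (intro sum.neutral ballI facet_int_mesh_0) (auto simp: cell_trace_zero)
  then show ?thesis by (simp add: b_h_def divergence_zero vol_int_def)
qed

lemma B_h_zero_velocity:
  "B_h D ((u, ub), (p, pb)) (((\<lambda>x. 0), (\<lambda>x. 0)), (q, qb)) = (\<Sum>j\<in>sides. b_h D j (q, qb j) u + b_I D j (qb j) ub)"
  by (simp add: B_h_def a_h_def a_s_zero b_h_zero a_d_def a_I_def b_I_def tangential_def facet_int_0 vol_int_def)

lemma side_facets_obtain:
  assumes "F \<in> side_facets D j"
  obtains K where "int CARD('n) simplex K" "F facet_of K" "K \<in> cells D"
  using assms cells_simplex[OF D] by (auto simp: side_facets_def all_facets_iff)

lemma zero_velocity: "((\<lambda>x. 0), (\<lambda>x. 0)) \<in> VV_h D"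
proof -
  have "(\<lambda>x. 0 :: real^'n) \<in> L2_facet F" for F :: "(real^'n) set" by (simp add: L2_facet_def L2_zero)
  then show ?thesis by (simp add: VV_h_def V_h_def Vbar_h_def L2_zero Pvec_def P_0)
qed

lemma zero_Qbar: "(\<lambda>x. 0) \<in> Qbar_h D j"
  by (simp add: Qbar_h_def L2_facet_def L2_zero P_0)

lemma zero_Q: "(\<lambda>x. 0) \<in> Q_h D"
  by (simp add: Q_h_def L2_zero P_0 vol_int_def)

lemma one_Qbar: "(\<lambda>x. 1) \<in> Qbar_h D j"
  unfolding Qbar_h_def
proof (intro CollectI ballI conjI)
  fix F assume "F \<in> side_facets D j"
  then show "(\<lambda>x. 1 :: real) \<in> L2_facet F"
    by (rule side_facets_obtain) (rule L2_facet_const)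
qed (rule P_const)

text \<open>\<open>Qbar_h\<close> asks for polynomials on relative interiors and imposes no
  continuity between facets, so the function may stop at the rim of \<open>F\<close>. On every other
  closed facet it is zero.\<close>

lemma rel_interior_Qbar:
  assumes F: "F \<in> all_facets D" and g: "g \<in> P (order D) UNIV"
  shows "(\<lambda>x. indicator (rel_interior F) x * g x) \<in> Qbar_h D j"
  unfolding Qbar_h_def
proof (intro CollectI ballI conjI)
  obtain K where K: "K \<in> cells D" "F facet_of K" using F by (auto simp: all_facets_iff)
  fix F' assume "F' \<in> side_facets D j"
  then obtain K' where sK': "int CARD('n) simplex K'" "F' facet_of K'" "K' \<in> cells D" by (rule side_facets_obtain)
  show "(\<lambda>x. indicator (rel_interior F) x * g x) \<in> L2_facet F'"
  proof (cases "F' = F")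
    case True
    then show ?thesis
      using L2_facet_rel_interior[OF sK'(1,2), of g] continuous_real_polynomial_function[OF P_polynomial[OF g]] by simp
  next
    case False
    then have "rel_interior F \<inter> F' = {}" using rel_interior_facet_disjoint[OF D K(1) sK'(3) K(2) sK'(2)] by auto
    then have "(\<lambda>x. indicator (rel_interior F) x * g x) \<in> L2_facet F' \<longleftrightarrow> (\<lambda>x. 0 :: real) \<in> L2_facet F'"
      by (intro L2_facet_cong[OF sK'(1,2)]) (auto simp: indicator_def)
    then show ?thesis using L2_facet_const[OF sK'(1,2)] by simp
  qed
  show "(\<lambda>x. indicator (rel_interior F) x * g x) \<in> P (order D) (rel_interior F')"
  proof (cases "F' = F")
    case True
    have "(\<lambda>x. indicator (rel_interior F) x * g x) \<in> P (order D) (rel_interior F) \<longleftrightarrow> g \<in> P (order D) (rel_interior F)"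
      by (rule P_cong) simp
    then show ?thesis using True P_subset[OF g] by simp
  next
    case False
    then have "rel_interior F \<inter> F' = {}" using rel_interior_facet_disjoint[OF D K(1) sK'(3) K(2) sK'(2)] by auto
    then have "(\<lambda>x. indicator (rel_interior F) x * g x) \<in> P (order D) (rel_interior F') \<longleftrightarrow> (\<lambda>x. 0) \<in> P (order D) (rel_interior F')"
      using rel_interior_subset[of F'] by (intro P_cong) (auto simp: indicator_def)
    then show ?thesis by (simp add: P_0)
  qed
qed

lemma sum_cells: "(\<Sum>K\<in>cells D. h K) = (\<Sum>j\<in>sides. \<Sum>K\<in>mesh D j. h K)"
proof -
  have "mesh D Stokes \<inter> mesh D Darcy = {}" using D by (simp add: stokes_darcy_setting_def)
  then show ?thesis
    unfolding cells_def using sum.union_disjoint[OF finite_mesh[OF D] finite_mesh[OF D]] by simp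
qed

lemma Omega_broken:
  assumes G: "\<And>K. K \<in> cells D \<Longrightarrow> continuous_on UNIV (G K)"
    and eq: "\<And>K x. K \<in> cells D \<Longrightarrow> x \<in> interior K \<Longrightarrow> f x = G K x"
  shows "integrable (lebesgue_on (Omega D)) f" and "vol_int (Omega D) f = (\<Sum>K\<in>cells D. vol_int K (G K))"
proof -
  have K: "convex K" "compact K" if "K \<in> cells D" for K
    using full_simplex(1,2)[OF cells_simplex[OF D that]] by auto
  show "integrable (lebesgue_on (Omega D)) f" "vol_int (Omega D) f = (\<Sum>K\<in>cells D. vol_int K (G K))"
    unfolding Omega_eq[OF D]
    by (rule broken_integral[of "cells D" G f, OF finite_cells[OF D] K(1) K(2) interior_cell_disjoint[OF D] G eq]; assumption)+
qed

lemma Q_h_broken: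
  assumes G: "\<And>K. K \<in> cells D \<Longrightarrow> G K \<in> P (order D - 1) UNIV"
    and eq: "\<And>K x. K \<in> cells D \<Longrightarrow> x \<in> interior K \<Longrightarrow> f x = G K x"
    and mean: "(\<Sum>K\<in>cells D. vol_int K (G K)) = 0"
  shows "f \<in> Q_h D"
proof -
  have "f \<in> borel_measurable (lebesgue_on (Omega D))"
    by (rule borel_measurable_integrable) (rule Omega_broken(1)[OF P_continuous[OF G] eq])
  moreover have "integrable (lebesgue_on (Omega D)) (\<lambda>x. (norm (f x))\<^sup>2)"
    by (rule Omega_broken(1)[of "\<lambda>K x. G K x * G K x"])
      (auto intro!: continuous_on_mult P_continuous[OF G] simp: eq power2_eq_square)
  moreover have "f \<in> P (order D - 1) (interior K)" if "K \<in> cells D" for K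
    using P_cong[of "interior K" f "G K"] eq[OF that] P_subset[OF G[OF that]] by simp
  moreover have "vol_int (Omega D) f = 0"
    using Omega_broken(2)[OF P_continuous[OF G] eq] mean by simp
  ultimately show ?thesis by (simp add: Q_h_def L2_def)
qed

lemma Q_h_representation:
  assumes "q \<in> Q_h D"
  obtains H where "\<And>K. K \<in> cells D \<Longrightarrow> H K \<in> P (order D - 1) UNIV"
    "\<And>K x. K \<in> cells D \<Longrightarrow> x \<in> interior K \<Longrightarrow> q x = H K x"
    "(\<Sum>K\<in>cells D. vol_int K (H K)) = 0"
proof -
  have "\<exists>h. K \<in> cells D \<longrightarrow> h \<in> P (order D - 1) UNIV \<and> (\<forall>x\<in>interior K. q x = h x)" for K
  proof (cases "K \<in> cells D")
    case True
    then have "q \<in> P (order D - 1) (interior K)" using assms by (simp add: Q_h_def)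
    then show ?thesis by (rule P_extend) auto
  qed simp
  then obtain H where H: "\<forall>K. K \<in> cells D \<longrightarrow> H K \<in> P (order D - 1) UNIV \<and> (\<forall>x\<in>interior K. q x = H K x)"
    using choice[of "\<lambda>K h. K \<in> cells D \<longrightarrow> h \<in> P (order D - 1) UNIV \<and> (\<forall>x\<in>interior K. q x = h x)"] by auto
  then have "vol_int (Omega D) q = (\<Sum>K\<in>cells D. vol_int K (H K))"
    by (intro Omega_broken(2)) (auto intro: P_continuous)
  then show ?thesis using H assms by (intro that[of H]) (auto simp: Q_h_def)
qed

text \<open>Turns the Darcy load into a pairing over \<open>Omega D\<close>, the domain on which
  \<open>Pi_Q\<close> is defined.\<close>

lemma vol_int_Darcy: "vol_int (Omega D) (\<lambda>x. chi_d D x * h x) = vol_int (region D Darcy) h"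
proof -
  have sub: "region D Darcy \<subseteq> Omega D"
    unfolding region_eq[OF D] Omega_eq[OF D] by (intro interior_mono) (auto simp: cells_def)
  have "region D Darcy \<in> sets lebesgue" "Omega D \<in> sets lebesgue"
    by (simp_all add: region_eq[OF D] Omega_eq[OF D] borel_open)
  then have "vol_int (Omega D) (\<lambda>x. chi_d D x * h x) = integral\<^sup>L lebesgue (\<lambda>x. indicator (Omega D) x *\<^sub>R (indicator (region D Darcy) x * h x))"
    "vol_int (region D Darcy) h = integral\<^sup>L lebesgue (\<lambda>x. indicator (region D Darcy) x *\<^sub>R h x)"
    by (simp_all add: vol_int_def integral_restrict_space chi_d_def)
  moreover have "indicator (Omega D) x *\<^sub>R (indicator (region D Darcy) x * h x) = indicator (region D Darcy) x *\<^sub>R h x" for x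
    using sub by (auto simp: indicator_def)
  ultimately show ?thesis by (simp only:)
qed

lemma broken_square_eq_0:
  assumes C: "C \<subseteq> cells D" and G: "\<And>K. K \<in> C \<Longrightarrow> continuous_on UNIV (G K)"
    and 0: "(\<Sum>K\<in>C. vol_int K (\<lambda>x. G K x * G K x)) = 0" and K: "K \<in> C" and x: "x \<in> interior K"
  shows "G K x = 0"
proof -
  have "finite C" using C finite_cells[OF D] finite_subset by blast
  moreover have "0 \<le> vol_int K (\<lambda>x. G K x * G K x)" for K unfolding vol_int_def by (rule Bochner_Integration.integral_nonneg) simp
  ultimately have "vol_int K (\<lambda>x. G K x * G K x) = 0" using 0 K by (simp add: sum_nonneg_eq_0_iff)
  then show ?thesis
    using C K x G full_simplex(2)[OF cells_simplex[OF D]] by (intro vol_int_square_eq_0[of K "G K" x]) auto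
qed

section \<open>Testing the mass equation of a fixed discrete solution\<close>

context
  fixes u ub :: "real^'n \<Rightarrow> real^'n" and f_d :: "real^'n \<Rightarrow> real"
    and W :: "(real^'n) set \<Rightarrow> real^'n \<Rightarrow> real^'n"
  assumes W: "\<And>K i. K \<in> cells D \<Longrightarrow> (\<lambda>x. W K x $ i) \<in> P (order D) UNIV"
    and uW: "\<And>K x. K \<in> cells D \<Longrightarrow> x \<in> interior K \<Longrightarrow> u x = W K x"
    and ub: "ub \<in> Vbar_h D"
    and weak: "\<And>q qb. q \<in> Q_h D \<Longrightarrow> (\<And>j. qb j \<in> Qbar_h D j) \<Longrightarrow>
      (\<Sum>j\<in>sides. b_h D j (q, qb j) u + b_I D j (qb j) ub) = vol_int (region D Darcy) (\<lambda>x. f_d x * q x)"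
begin

lemma W_differentiable: "K \<in> cells D \<Longrightarrow> W K differentiable (at x)"
  using W by (intro differentiable_component_polynomials P_polynomial)

lemma trace_eq:
  assumes K: "K \<in> cells D" and x: "x \<in> K"
  shows "cell_trace K u x = W K x"
proof (rule cell_trace_eq[OF cells_simplex[OF D K] _ uW[OF K] x])
  show "continuous_on UNIV (W K)"
    using W_differentiable[OF K] by (simp add: continuous_on_eq_continuous_at differentiable_imp_continuous_within)
qed

lemma flux_P: "K \<in> cells D \<Longrightarrow> (\<lambda>x. W K x \<bullet> a) \<in> P (order D) UNIV"
  by (intro P_inner W)

lemma b_h_facets:
  "b_h D j ((\<lambda>x. 0), qb) u = (\<Sum>K\<in>mesh D j. \<Sum>F\<in>facets K. facet_int F (\<lambda>x. qb x * (W K x \<bullet> outer_normal K F)))"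
proof -
  have "facet_int F (\<lambda>x. qb x * (cell_trace K u x \<bullet> outer_normal K F)) = facet_int F (\<lambda>x. qb x * (W K x \<bullet> outer_normal K F))"
    if K: "K \<in> mesh D j" and F: "F \<in> facets K" for K F
  proof -
    have fF: "F facet_of K" using F by (simp add: facets_def)
    note sK = cells_simplex[OF D mesh_cells[OF K]]
    show ?thesis
      using facet_basic(4)[OF sK fF] trace_eq[OF mesh_cells[OF K]]
      by (intro facet_int_cong[OF sK fF]) auto
  qed
  then show ?thesis by (simp add: b_h_def vol_int_def)
qed

text \<open>The mass equation localised: the volume pressure is zero, and the facet pressure lives
  on side \<open>j\<close> and on the relative interior of \<open>F\<close>. What remains are the
  traces from the cells of \<open>mesh D j\<close> at \<open>F\<close> and, on the interface, the
  trace \<open>ub\<close> from \<open>b_I\<close>.\<close>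

lemma facet_test:
  assumes F: "F \<in> all_facets D" and g: "g \<in> P (order D) UNIV"
  shows "(\<Sum>K\<in>{K \<in> mesh D j. F facet_of K}. facet_int F (\<lambda>x. indicator (rel_interior F) x * (g x * (W K x \<bullet> outer_normal K F)))) =
    (if F \<in> interface_facets D then facet_int F (\<lambda>x. indicator (rel_interior F) x * (g x * (ub x \<bullet> side_normal D j F))) else 0)"
proof -
  obtain K0 where K0: "K0 \<in> cells D" "F facet_of K0" using F by (auto simp: all_facets_iff)
  let ?q = "\<lambda>x. indicator (rel_interior F) x * g x"
  define qb where "qb = (\<lambda>i. if i = j then ?q else (\<lambda>x. 0))"
  have q0: "?q x = 0" if "F' \<noteq> F" "x \<in> F'" "K \<in> cells D" "F' facet_of K" for F' x K
    using rel_interior_facet_disjoint[OF D K0(1) that(3) K0(2) that(4)] that(1,2) by (auto simp: indicator_def)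
  have bh: "b_h D i ((\<lambda>x. 0), qb i) u = (if i = j then \<Sum>K\<in>{K \<in> mesh D j. F facet_of K}. facet_int F (\<lambda>x. ?q x * (W K x \<bullet> outer_normal K F)) else 0)" for i
  proof (cases "i = j")
    case True
    have "(\<Sum>F'\<in>facets K. facet_int F' (\<lambda>x. ?q x * (W K x \<bullet> outer_normal K F'))) =
        (if F facet_of K then facet_int F (\<lambda>x. ?q x * (W K x \<bullet> outer_normal K F)) else 0)" if K: "K \<in> mesh D j" for K
    proof -
      have "(\<Sum>F'\<in>facets K. facet_int F' (\<lambda>x. ?q x * (W K x \<bullet> outer_normal K F'))) =
        (\<Sum>F'\<in>facets K. if F' = F then facet_int F (\<lambda>x. ?q x * (W K x \<bullet> outer_normal K F)) else 0)"
      proof (rule sum.cong)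
        fix F' assume F': "F' \<in> facets K"
        have "facet_int F' (\<lambda>x. ?q x * (W K x \<bullet> outer_normal K F')) = 0" if "F' \<noteq> F"
          using q0[OF that _ mesh_cells[OF K]] F' by (intro facet_int_mesh_0[OF K F']) (simp add: facets_def)
        then show "facet_int F' (\<lambda>x. ?q x * (W K x \<bullet> outer_normal K F')) = (if F' = F then facet_int F (\<lambda>x. ?q x * (W K x \<bullet> outer_normal K F)) else 0)"
          by simp
      qed simp
      then show ?thesis using finite_facets[OF D mesh_cells[OF K]] by (simp add: facets_def)
    qed
    then have "b_h D j ((\<lambda>x. 0), ?q) u = (\<Sum>K\<in>mesh D j. if F facet_of K then facet_int F (\<lambda>x. ?q x * (W K x \<bullet> outer_normal K F)) else 0)"
      unfolding b_h_facets by (intro sum.cong) auto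
    then show ?thesis using True finite_mesh[OF D] by (simp add: qb_def sum.inter_filter)
  next
    case False
    then show ?thesis by (simp add: qb_def b_h_facets facet_int_0)
  qed
  have bI: "b_I D i (qb i) ub = (if i = j then - (if F \<in> interface_facets D then facet_int F (\<lambda>x. ?q x * (ub x \<bullet> side_normal D j F)) else 0) else 0)" for i
  proof (cases "i = j")
    case True
    have fin: "finite (interface_facets D)"
      using finite_cells[OF D] finite_facets[OF D] by (simp add: interface_facets_def all_facets_def)
    have "(\<Sum>F'\<in>interface_facets D. facet_int F' (\<lambda>x. ?q x * (ub x \<bullet> side_normal D j F'))) =
      (\<Sum>F'\<in>interface_facets D. if F' = F then facet_int F (\<lambda>x. ?q x * (ub x \<bullet> side_normal D j F)) else 0)"
    proof (rule sum.cong)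
      fix F' assume F': "F' \<in> interface_facets D"
      obtain K where K: "K \<in> cells D" "F' facet_of K" using F' by (auto simp: interface_facets_def all_facets_iff)
      have "facet_int F' (\<lambda>x. ?q x * (ub x \<bullet> side_normal D j F')) = 0" if "F' \<noteq> F"
        using q0[OF that _ K] by (intro facet_int_interface_0[OF F']) simp
      then show "facet_int F' (\<lambda>x. ?q x * (ub x \<bullet> side_normal D j F')) = (if F' = F then facet_int F (\<lambda>x. ?q x * (ub x \<bullet> side_normal D j F)) else 0)"
        by simp
    qed simp
    then show ?thesis using True fin by (simp add: b_I_def qb_def)
  next
    case False
    then show ?thesis by (simp add: qb_def b_I_def facet_int_0)
  qed
  \<comment> \<open>With zero volume pressure the load drops out, whatever \<open>f_d\<close>
    is.\<close>
  have "(\<Sum>i\<in>sides. b_h D i ((\<lambda>x. 0), qb i) u + b_I D i (qb i) ub) = vol_int (region D Darcy) (\<lambda>x. f_d x * 0)"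
    by (rule weak[OF zero_Q]) (simp add: qb_def zero_Qbar rel_interior_Qbar[OF F g])
  then show ?thesis unfolding bh bI by (cases j) (simp_all add: vol_int_def mult.assoc)
qed

text \<open>Facets on the outer boundary are covered: there the jump has a single summand, and the
  normal trace itself vanishes.\<close>

lemma normal_jump_zero:
  assumes F: "F \<in> all_facets D" "F \<notin> interface_facets D" and x: "x \<in> F"
  shows "normal_jump D u F x = 0"
proof -
  obtain K0 where K0: "K0 \<in> cells D" "F facet_of K0" using F by (auto simp: all_facets_iff)
  note sK0 = cells_simplex[OF D K0(1)]
  obtain j where j: "K0 \<in> mesh D j" using cells_mesh[OF K0(1)] by blast
  \<comment> \<open>All cells at a facet off the interface belong to one mesh, by
    \<open>facet_between_regions\<close>; so the test on one side sees the whole jump.\<close>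
  have S: "{K \<in> cells D. F facet_of K} = {K \<in> mesh D j. F facet_of K}" (is "?A = ?B")
  proof
    show "?A \<subseteq> ?B"
    proof clarify
      fix K assume K: "K \<in> cells D" "F facet_of K"
      obtain i where i: "K \<in> mesh D i" using cells_mesh[OF K(1)] by blast
      have "i = j" using facet_between_regions[OF D i j _ K(2) K0(2)] F by (auto simp: interface_facets_def)
      then show "K \<in> mesh D j" using i by simp
    qed
  qed (auto intro: mesh_cells)
  define g where "g = (\<lambda>x. \<Sum>K\<in>{K \<in> mesh D j. F facet_of K}. W K x \<bullet> outer_normal K F)"
  have g: "g \<in> P (order D) UNIV" unfolding g_def by (intro P_sum flux_P) (auto intro: mesh_cells)
  have "(\<Sum>K\<in>{K \<in> mesh D j. F facet_of K}. facet_int F (\<lambda>x. indicator (rel_interior F) x * (g x * (W K x \<bullet> outer_normal K F)))) = 0"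
    using facet_test[OF F(1) g, of j] F(2) by simp
  then have "facet_int F (\<lambda>x. indicator (rel_interior F) x * (\<Sum>K\<in>{K \<in> mesh D j. F facet_of K}. g x * (W K x \<bullet> outer_normal K F))) = 0"
    by (subst facet_int_rel_interior_sum[OF sK0 K0(2)])
      (auto intro!: continuous_on_mult P_continuous[OF g] P_continuous[OF flux_P] mesh_cells)
  then have "facet_int F (\<lambda>x. indicator (rel_interior F) x * (g x * g x)) = 0"
    by (simp add: g_def sum_distrib_left)
  then have "g x = 0" by (rule facet_int_square_eq_0[OF sK0 K0(2) P_continuous[OF g] _ x])
  moreover have "normal_jump D u F x = g x"
    unfolding normal_jump_def S g_def
  proof (rule sum.cong)
    fix K assume "K \<in> {K \<in> mesh D j. F facet_of K}"
    then have K: "K \<in> cells D" "F facet_of K" by (auto intro: mesh_cells)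
    then have "x \<in> K" using x facet_basic(4)[OF cells_simplex[OF D K(1)] K(2)] by auto
    then show "cell_trace K u x \<bullet> outer_normal K F = W K x \<bullet> outer_normal K F" by (simp add: trace_eq[OF K(1)])
  qed simp
  ultimately show ?thesis by simp
qed

text \<open>Each mesh has exactly one cell at an interface facet, and the two sides carry
  independent facet pressures, so the trace from either side is compared with \<open>ub\<close>
  separately.\<close>

lemma interface_flux:
  assumes F: "F \<in> interface_facets D" and K: "K \<in> cells D" "F facet_of K" and x: "x \<in> F"
  shows "cell_trace K u x \<bullet> outer_normal K F = ub x \<bullet> outer_normal K F"
proof -
  note sK = cells_simplex[OF D K(1)]
  obtain j where j: "K \<in> mesh D j" using cells_mesh[OF K(1)] by blast
  have S: "{L \<in> mesh D j. F facet_of L} = {K}"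
  proof (intro equalityI subsetI)
    fix L assume "L \<in> {L \<in> mesh D j. F facet_of L}"
    then have "L \<in> mesh D j" "F facet_of L" by simp_all
    then have "L = K" by (rule interface_facet_unique[OF D F _ _ j K(2)])
    then show "L \<in> {K}" by simp
  qed (use j K(2) in simp)
  have Fa: "F \<in> all_facets D" using F by (simp add: interface_facets_def)
  \<comment> \<open>\<open>ub\<close> is controlled on the Stokes skeleton only; an interface facet
    belongs to it even if \<open>K\<close> is a Darcy cell.\<close>
  have "ub \<in> Pvec (order D) F"
    using ub side_facets_interface[OF D F, of Stokes] by (simp add: Vbar_h_def)
  then obtain U where U: "\<And>i. (\<lambda>x. U x $ i) \<in> P (order D) UNIV" "\<And>x. x \<in> F \<Longrightarrow> ub x = U x"
    by (rule Pvec_extend) blast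
  let ?N = "outer_normal K F"
  have UP: "(\<lambda>x. U x \<bullet> ?N) \<in> P (order D) UNIV" by (intro P_inner U(1))
  define g where "g = (\<lambda>x. W K x \<bullet> ?N + (U x \<bullet> ?N) * (-1))"
  have g: "g \<in> P (order D) UNIV" unfolding g_def by (intro P_add P_mult_right UP flux_P K(1))
  note cont = P_continuous[OF g, of UNIV] P_continuous[OF UP, of UNIV] P_continuous[OF flux_P[OF K(1)], of UNIV ?N]
  have "facet_int F (\<lambda>x. indicator (rel_interior F) x * (g x * (W K x \<bullet> ?N))) =
      facet_int F (\<lambda>x. indicator (rel_interior F) x * (g x * (ub x \<bullet> ?N)))"
    using facet_test[OF Fa g, of j] F S by (simp add: side_normal_eq[OF D F j K(2)])
  also have "\<dots> = facet_int F (\<lambda>x. indicator (rel_interior F) x * (g x * (U x \<bullet> ?N)))"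
    using U(2) by (intro facet_int_cong[OF sK K(2)]) simp
  finally have "facet_int F (\<lambda>x. indicator (rel_interior F) x * (g x * (W K x \<bullet> ?N) - g x * (U x \<bullet> ?N))) = 0"
    using cont by (subst facet_int_rel_interior_diff[OF sK K(2)]) (auto intro: continuous_on_mult)
  moreover have "g x * (W K x \<bullet> ?N) - g x * (U x \<bullet> ?N) = g x * g x" for x
    by (simp add: g_def algebra_simps)
  ultimately have "facet_int F (\<lambda>x. indicator (rel_interior F) x * (g x * g x)) = 0" by simp
  then have "g x = 0" by (rule facet_int_square_eq_0[OF sK K(2) cont(1) _ x])
  moreover have "x \<in> K" using x facet_basic(4)[OF sK K(2)] by auto
  ultimately show ?thesis using U(2)[OF x] by (simp add: g_def trace_eq[OF K(1)])
qed


text \<open>For facet pressure \<open>1\<close> the cell boundary terms sum to the total divergence,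
  and the interface terms of the two sides cancel because their normals are opposite.\<close>

lemma total_divergence: "(\<Sum>K\<in>cells D. vol_int K (divergence (W K))) = 0"
proof -
  have dim: "CARD('n) = 2 \<or> CARD('n) = 3" using D by (simp add: stokes_darcy_setting_def)
  have bh: "b_h D j ((\<lambda>x. 0), (\<lambda>x. 1)) u = (\<Sum>K\<in>mesh D j. vol_int K (divergence (W K)))" for j
    unfolding b_h_facets
  proof (rule sum.cong)
    fix K assume K: "K \<in> mesh D j"
    show "(\<Sum>F\<in>facets K. facet_int F (\<lambda>x. 1 * (W K x \<bullet> outer_normal K F))) = vol_int K (divergence (W K))"
      using divergence_theorem_simplex[OF dim cells_simplex[OF D mesh_cells[OF K]] P_polynomial[OF W[OF mesh_cells[OF K]]]] by simp
  qed simp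
  have bI: "b_I D Darcy (\<lambda>x. 1) ub = - b_I D Stokes (\<lambda>x. 1) ub"
    unfolding b_I_def by (simp add: side_normal_opposite[OF D] facet_int_def sum_negf)
  have "(\<Sum>j\<in>sides. b_h D j ((\<lambda>x. 0), (\<lambda>x. 1)) u + b_I D j (\<lambda>x. 1) ub) = vol_int (region D Darcy) (\<lambda>x. f_d x * 0)"
    using weak[OF zero_Q, of "\<lambda>j x. 1"] one_Qbar by simp
  then show ?thesis unfolding sum_cells using bI by (simp add: bh vol_int_def)
qed

lemma divergence_eq: "K \<in> cells D \<Longrightarrow> x \<in> interior K \<Longrightarrow> divergence u x = divergence (W K) x"
  by (rule divergence_cong_open[OF uW _ _ W_differentiable]) auto

lemma divergence_P: "K \<in> cells D \<Longrightarrow> divergence (W K) \<in> P (order D - 1) UNIV"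
  by (intro P_divergence W)

lemma minus_divergence_P: "K \<in> cells D \<Longrightarrow> (\<lambda>x. - divergence (W K) x) \<in> P (order D - 1) UNIV"
  using P_mult_right[OF divergence_P, of K "-1"] by simp

lemma minus_divergence_Q: "(\<lambda>x. - divergence u x) \<in> Q_h D"
proof (rule Q_h_broken[OF minus_divergence_P])
  show "(\<Sum>K\<in>cells D. vol_int K (\<lambda>x. - divergence (W K) x)) = 0"
    using total_divergence by (simp add: vol_int_def sum_negf)
qed (simp_all add: divergence_eq)

lemma weak_divergence:
  assumes q: "q \<in> Q_h D" and H: "\<And>K. K \<in> cells D \<Longrightarrow> H K \<in> P (order D - 1) UNIV"
    and qH: "\<And>K x. K \<in> cells D \<Longrightarrow> x \<in> interior K \<Longrightarrow> q x = H K x"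
  shows "(\<Sum>K\<in>cells D. vol_int K (\<lambda>x. - divergence (W K) x * H K x)) = vol_int (region D Darcy) (\<lambda>x. f_d x * q x)"
proof -
  have b: "b_h D j (q, (\<lambda>x. 0)) u + b_I D j (\<lambda>x. 0) ub = (\<Sum>K\<in>mesh D j. vol_int K (\<lambda>x. - divergence (W K) x * H K x))" for j
  proof -
    have "vol_int K (\<lambda>x. q x * divergence u x) = vol_int K (\<lambda>x. H K x * divergence (W K) x)" if "K \<in> mesh D j" for K
    proof -
      have K: "K \<in> cells D" by (rule mesh_cells[OF that])
      note sK = full_simplex[OF cells_simplex[OF D K]]
      show ?thesis
      \<comment> \<open>\<open>q\<close> and \<open>u\<close> are tied to their representatives in
        the interior of the cell only; its frontier is a null set.\<close>
      proof (rule vol_int_spike(2)[of K _ "frontier K"])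
        show "K \<in> sets lebesgue" using sK(2) by (simp add: fmeasurableD lmeasurable_compact)
        show "integrable (lebesgue_on K) (\<lambda>x. H K x * divergence (W K) x)"
          by (intro integrable_lebesgue_on_compact sK(2) continuous_on_mult P_continuous[OF H[OF K]] P_continuous[OF divergence_P[OF K]])
        show "negligible (frontier K)" by (rule negligible_convex_frontier[OF sK(1)])
        show "q x * divergence u x = H K x * divergence (W K) x" if "x \<in> K - frontier K" for x
          using that closure_subset[of K] qH[OF K] divergence_eq[OF K] by (auto simp: frontier_def)
      qed
    qed
    then have "(\<Sum>K\<in>mesh D j. vol_int K (\<lambda>x. q x * divergence u x)) = (\<Sum>K\<in>mesh D j. vol_int K (\<lambda>x. H K x * divergence (W K) x))"
      by (rule sum.cong[OF refl])
    then show ?thesis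
      by (simp add: b_h_def b_I_def facet_int_0) (simp add: vol_int_def sum_negf mult.commute)
  qed
  have "(\<Sum>j\<in>sides. b_h D j (q, (\<lambda>x. 0)) u + b_I D j (\<lambda>x. 0) ub) = vol_int (region D Darcy) (\<lambda>x. f_d x * q x)"
    using weak[OF q, of "\<lambda>j x. 0"] zero_Qbar by simp
  then show ?thesis unfolding sum_cells b .
qed

lemma projection_property:
  assumes q: "q \<in> Q_h D"
  shows "vol_int (Omega D) (\<lambda>x. - divergence u x * q x) = vol_int (Omega D) (\<lambda>x. (chi_d D x * f_d x) * q x)"
proof -
  obtain H where H: "\<And>K. K \<in> cells D \<Longrightarrow> H K \<in> P (order D - 1) UNIV"
    "\<And>K x. K \<in> cells D \<Longrightarrow> x \<in> interior K \<Longrightarrow> q x = H K x"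
    by (rule Q_h_representation[OF q]) blast
  have "vol_int (Omega D) (\<lambda>x. - divergence u x * q x) = (\<Sum>K\<in>cells D. vol_int K (\<lambda>x. - divergence (W K) x * H K x))"
  proof (rule Omega_broken(2))
    show "continuous_on UNIV (\<lambda>x. - divergence (W K) x * H K x)" if "K \<in> cells D" for K
      using that by (intro continuous_on_mult P_continuous[OF H(1)] P_continuous[OF minus_divergence_P])
  qed (simp add: divergence_eq H(2))
  also have "\<dots> = vol_int (region D Darcy) (\<lambda>x. f_d x * q x)" by (rule weak_divergence[OF q H])
  also have "\<dots> = vol_int (Omega D) (\<lambda>x. (chi_d D x * f_d x) * q x)"
    using vol_int_Darcy[of "\<lambda>x. f_d x * q x"] by (simp add: mult.assoc)
  finally show ?thesis .
qed

lemma Pi_Q_eq: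
  assumes K: "K \<in> cells D" and x: "x \<in> interior K"
  shows "- divergence u x = Pi_Q D (\<lambda>y. chi_d D y * f_d y) x"
proof -
  define g where "g = Pi_Q D (\<lambda>y. chi_d D y * f_d y)"
  \<comment> \<open>\<open>- divergence u\<close> itself witnesses that a projection exists, so the
    choice in \<open>Pi_Q\<close> has its defining property.\<close>
  have "g \<in> Q_h D \<and> (\<forall>q\<in>Q_h D. vol_int (Omega D) (\<lambda>x. g x * q x) = vol_int (Omega D) (\<lambda>x. (chi_d D x * f_d x) * q x))"
    unfolding g_def Pi_Q_def
    by (rule someI[of _ "\<lambda>x. - divergence u x"]) (use minus_divergence_Q projection_property in blast)
  then have g: "g \<in> Q_h D" "\<And>q. q \<in> Q_h D \<Longrightarrow> vol_int (Omega D) (\<lambda>x. g x * q x) = vol_int (Omega D) (\<lambda>x. - divergence u x * q x)"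
    using projection_property by auto
  obtain H where H: "\<And>K. K \<in> cells D \<Longrightarrow> H K \<in> P (order D - 1) UNIV"
    "\<And>K x. K \<in> cells D \<Longrightarrow> x \<in> interior K \<Longrightarrow> g x = H K x" "(\<Sum>K\<in>cells D. vol_int K (H K)) = 0"
    by (rule Q_h_representation[OF g(1)]) blast
  \<comment> \<open>The difference of \<open>g\<close> and \<open>- divergence u\<close>. It lies in
    \<open>Q_h\<close>, and testing with it makes the sum of its squared cell norms vanish.\<close>
  define E where "E = (\<lambda>K x. H K x + divergence (W K) x)"
  have E: "E K \<in> P (order D - 1) UNIV" if "K \<in> cells D" for K
    unfolding E_def using that by (intro P_add H divergence_P)
  note cH = P_continuous[OF H(1), where S = UNIV] and cE = P_continuous[OF E, where S = UNIV]
    and cW = P_continuous[OF divergence_P, where S = UNIV]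
  have cell: "compact K" if "K \<in> cells D" for K by (rule full_simplex(2)[OF cells_simplex[OF D that]])
  let ?e = "\<lambda>x. g x + divergence u x"
  have e: "?e x = E K x" if "K \<in> cells D" "x \<in> interior K" for K x
    using that by (simp add: E_def H(2) divergence_eq)
  have "?e \<in> Q_h D"
  proof (rule Q_h_broken[OF E e])
    show "(\<Sum>K\<in>cells D. vol_int K (E K)) = 0"
      unfolding E_def using H(3) total_divergence by (simp add: vol_int_add cell cH cW sum.distrib)
  qed
  then have "vol_int (Omega D) (\<lambda>x. g x * ?e x) = vol_int (Omega D) (\<lambda>x. - divergence u x * ?e x)" by (rule g(2))
  also have "vol_int (Omega D) (\<lambda>x. g x * ?e x) = (\<Sum>K\<in>cells D. vol_int K (\<lambda>x. H K x * E K x))"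
  proof (rule Omega_broken(2))
    show "continuous_on UNIV (\<lambda>x. H K x * E K x)" if "K \<in> cells D" for K
      using that by (intro continuous_on_mult cH cE)
  qed (simp add: e[symmetric] H(2))
  also have "vol_int (Omega D) (\<lambda>x. - divergence u x * ?e x) = (\<Sum>K\<in>cells D. vol_int K (\<lambda>x. - divergence (W K) x * E K x))"
  proof (rule Omega_broken(2))
    show "continuous_on UNIV (\<lambda>x. - divergence (W K) x * E K x)" if "K \<in> cells D" for K
      using that by (intro continuous_on_mult continuous_on_minus cW cE)
  qed (simp add: e[symmetric] divergence_eq)
  finally have "(\<Sum>K\<in>cells D. vol_int K (\<lambda>x. H K x * E K x)) = (\<Sum>K\<in>cells D. vol_int K (\<lambda>x. - divergence (W K) x * E K x))" .
  moreover have "(\<Sum>K\<in>cells D. vol_int K (\<lambda>x. H K x * E K x)) =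
      (\<Sum>K\<in>cells D. vol_int K (\<lambda>x. E K x * E K x)) + (\<Sum>K\<in>cells D. vol_int K (\<lambda>x. - divergence (W K) x * E K x))"
    unfolding sum.distrib[symmetric]
  proof (rule sum.cong)
    fix K assume K: "K \<in> cells D"
    have "vol_int K (\<lambda>x. H K x * E K x) = vol_int K (\<lambda>x. E K x * E K x + (- divergence (W K) x * E K x))"
      by (simp add: E_def algebra_simps)
    also have "\<dots> = vol_int K (\<lambda>x. E K x * E K x) + vol_int K (\<lambda>x. - divergence (W K) x * E K x)"
      using K by (intro vol_int_add cell continuous_on_mult continuous_on_minus cE cW)
    finally show "vol_int K (\<lambda>x. H K x * E K x) = vol_int K (\<lambda>x. E K x * E K x) + vol_int K (\<lambda>x. - divergence (W K) x * E K x)" .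
  qed simp
  ultimately have "(\<Sum>K\<in>cells D. vol_int K (\<lambda>x. E K x * E K x)) = 0" by simp
  from broken_square_eq_0[of "cells D" E, OF order.refl _ this K x] cE have "E K x = 0" by blast
  then show ?thesis using e[OF K x] by (simp add: g_def)
qed

text \<open>If \<open>f_d\<close> has zero mean, then the discrete equation also holds for test functions with nonzero mean;
  testing with the divergence restricted to the Stokes region shows that it vanishes there.\<close>

lemma Stokes_divergence_zero:
  assumes mean: "vol_int (region D Darcy) f_d = 0" and K: "K \<in> mesh D Stokes" and x: "x \<in> interior K"
  shows "divergence u x = 0"
proof -
  let ?w = "\<lambda>K x. - divergence (W K) x"
  define V where "V = (\<Sum>K\<in>cells D. vol_int K (\<lambda>x. 1))"
  note cW = P_continuous[OF minus_divergence_P, where S = UNIV]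
  have cell: "compact K" if "K \<in> cells D" for K by (rule full_simplex(2)[OF cells_simplex[OF D that]])
  \<comment> \<open>Zero volume would make the constant \<open>1\<close> vanish at
    \<open>x\<close>.\<close>
  have "V \<noteq> 0"
    using broken_square_eq_0[of "cells D" "\<lambda>K x. 1" K x] mesh_cells[OF K] x by (auto simp: V_def)
  \<comment> \<open>The mean over \<open>Omega D\<close> of the function that is
    \<open>- divergence u\<close> on the Stokes cells and zero on the Darcy cells; subtracting it
    brings \<open>q\<close> into \<open>Q_h\<close>.\<close>
  define m where "m = (\<Sum>K\<in>mesh D Stokes. vol_int K (?w K)) / V"
  define H where "H = (\<lambda>K. if K \<in> mesh D Stokes then (\<lambda>x. ?w K x + - m) else (\<lambda>x. - m))"
  define q where "q = (\<lambda>x. (if x \<in> region D Darcy then 0 else - divergence u x) + - m)"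
  have H: "H K \<in> P (order D - 1) UNIV" if "K \<in> cells D" for K
  proof -
    have "(\<lambda>x. ?w K x + - m) \<in> P (order D - 1) UNIV" by (intro P_add P_const minus_divergence_P that)
    moreover have "(\<lambda>x :: real^'n. - m) \<in> P (order D - 1) UNIV" by (rule P_const)
    ultimately show ?thesis by (simp add: H_def)
  qed
  have qH: "q x = H K x" if K: "K \<in> cells D" and x: "x \<in> interior K" for K x
  proof (cases "K \<in> mesh D Stokes")
    case True
    then have "x \<notin> region D Darcy"
      using interior_cell_other_region[OF D True, of Darcy] x interior_subset[of "\<Union> (mesh D Darcy)"] by (auto simp: region_eq[OF D])
    then show ?thesis using True divergence_eq[OF K x] by (simp add: q_def H_def)
  next
    case False
    then have "K \<in> mesh D Darcy" using K by (simp add: cells_def)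
    then show ?thesis using False interior_cell_subset_region[OF D, of K Darcy] x by (auto simp: q_def H_def)
  qed
  have notS: "K \<notin> mesh D Stokes" if "K \<in> mesh D Darcy" for K using mesh_disjoint[OF D, of K Stokes Darcy] that by auto
  have const: "vol_int K (\<lambda>x. c) = c * vol_int K (\<lambda>x. 1)" for K :: "(real^'n) set" and c :: real
    using vol_int_mult_right[of K "\<lambda>x. 1" c] by (simp add: mult.commute)
  have q: "q \<in> Q_h D"
  proof (rule Q_h_broken[OF H qH])
    have "(\<Sum>K\<in>mesh D Stokes. vol_int K (H K)) = (\<Sum>K\<in>mesh D Stokes. vol_int K (?w K) + - m * vol_int K (\<lambda>x. 1))"
    proof (rule sum.cong)
      fix K assume K: "K \<in> mesh D Stokes"
      have "vol_int K (\<lambda>x. ?w K x + - m) = vol_int K (?w K) + vol_int K (\<lambda>x. - m)"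
        by (intro vol_int_add cell cW continuous_on_const mesh_cells[OF K])
      then show "vol_int K (H K) = vol_int K (?w K) + - m * vol_int K (\<lambda>x. 1)"
        using K const[of K "- m"] by (simp only: H_def if_True)
    qed simp
    moreover have "(\<Sum>K\<in>mesh D Darcy. vol_int K (H K)) = (\<Sum>K\<in>mesh D Darcy. - m * vol_int K (\<lambda>x. 1))"
      by (intro sum.cong) (simp_all only: H_def notS if_False const[of _ "- m"])
    ultimately have "(\<Sum>K\<in>cells D. vol_int K (H K)) = (\<Sum>K\<in>mesh D Stokes. vol_int K (?w K)) + - m * V"
      unfolding V_def sum_cells by (simp add: sum_subtractf sum_negf sum_distrib_left[symmetric] distrib_left)
    then show "(\<Sum>K\<in>cells D. vol_int K (H K)) = 0" using \<open>V \<noteq> 0\<close> by (simp add: m_def)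
  qed
  have "(\<Sum>K\<in>cells D. vol_int K (\<lambda>x. ?w K x * H K x)) = vol_int (region D Darcy) (\<lambda>x. f_d x * q x)"
    by (rule weak_divergence[OF q H qH])
  \<comment> \<open>On the Darcy region \<open>q\<close> is the constant \<open>- m\<close>, so the
    load is a multiple of the integral of \<open>f_d\<close>.\<close>
  also have "\<dots> = vol_int (region D Darcy) (\<lambda>x. f_d x * (- m))"
    unfolding vol_int_def by (rule Bochner_Integration.integral_cong) (auto simp: q_def)
  also have "\<dots> = 0" using mean by (simp only: vol_int_mult_right)
  finally have 0: "(\<Sum>K\<in>cells D. vol_int K (\<lambda>x. ?w K x * H K x)) = 0" .
  have "(\<Sum>K\<in>mesh D Stokes. vol_int K (\<lambda>x. ?w K x * H K x)) = (\<Sum>K\<in>mesh D Stokes. vol_int K (\<lambda>x. ?w K x * ?w K x) + vol_int K (?w K) * (- m))"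
  proof (rule sum.cong)
    fix K assume K: "K \<in> mesh D Stokes"
    have "vol_int K (\<lambda>x. ?w K x * H K x) = vol_int K (\<lambda>x. ?w K x * ?w K x + ?w K x * (- m))"
      using K by (simp only: H_def if_True distrib_left)
    also have "\<dots> = vol_int K (\<lambda>x. ?w K x * ?w K x) + vol_int K (\<lambda>x. ?w K x * (- m))"
      by (intro vol_int_add cell continuous_on_mult cW continuous_on_const mesh_cells[OF K])
    finally show "vol_int K (\<lambda>x. ?w K x * H K x) = vol_int K (\<lambda>x. ?w K x * ?w K x) + vol_int K (?w K) * (- m)"
      by (simp only: vol_int_mult_right)
  qed simp
  moreover have "(\<Sum>K\<in>mesh D Darcy. vol_int K (\<lambda>x. ?w K x * H K x)) = (\<Sum>K\<in>mesh D Darcy. vol_int K (?w K) * (- m))"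
    by (intro sum.cong) (simp_all only: H_def notS if_False vol_int_mult_right)
  ultimately have "(\<Sum>K\<in>cells D. vol_int K (\<lambda>x. ?w K x * H K x)) =
      (\<Sum>K\<in>mesh D Stokes. vol_int K (\<lambda>x. ?w K x * ?w K x)) + (\<Sum>K\<in>cells D. vol_int K (?w K)) * (- m)"
    unfolding sum_cells by (simp add: sum_subtractf sum_negf sum_distrib_right[symmetric] distrib_right)
  \<comment> \<open>The correction \<open>m\<close> appears as a factor of the total divergence and
    drops out, leaving the squares over the Stokes cells.\<close>
  moreover have "(\<Sum>K\<in>cells D. vol_int K (?w K)) = 0"
    using total_divergence by (simp add: vol_int_def sum_negf)
  ultimately have "(\<Sum>K\<in>mesh D Stokes. vol_int K (\<lambda>x. ?w K x * ?w K x)) = 0" using 0 by simp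
  from broken_square_eq_0[of "mesh D Stokes" ?w, OF _ _ this K x] cW mesh_cells have "?w K x = 0" by blast
  then show ?thesis using divergence_eq[OF mesh_cells[OF K] x] by simp
qed

end

end

theorem mainTheorem1:
  fixes D :: "'n::finite setting"
    and f_s :: "real^'n \<Rightarrow> real^'n" and f_d :: "real^'n \<Rightarrow> real"
    and u ub :: "real^'n \<Rightarrow> real^'n"
    and p :: "real^'n \<Rightarrow> real" and pb :: "side \<Rightarrow> real^'n \<Rightarrow> real"
  assumes "stokes_darcy_setting D"
    and "f_s \<in> L2 (region D Stokes)"
    and "f_d \<in> L2 (region D Darcy)"
    and "((u, ub), (p, pb)) \<in> X_h D"
    and "\<And>v vb q qb. ((v, vb), (q, qb)) \<in> X_h D \<Longrightarrow>
           B_h D ((u, ub), (p, pb)) ((v, vb), (q, qb)) =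
             vol_int (region D Stokes) (\<lambda>x. f_s x \<bullet> v x)
           + vol_int (region D Darcy) (\<lambda>x. f_d x * q x)"
  shows "(\<forall>K\<in>cells D. \<forall>x\<in>interior K.
            - divergence u x = Pi_Q D (\<lambda>y. chi_d D y * f_d y) x)
       \<and> (vol_int (region D Darcy) f_d = 0 \<longrightarrow>
            (\<forall>K\<in>cells D. \<forall>x\<in>interior K.
              - divergence u x = chi_d D x * Pi_Q D (\<lambda>y. chi_d D y * f_d y) x))
       \<and> (\<forall>F\<in>all_facets D - interface_facets D. \<forall>x\<in>F. normal_jump D u F x = 0)
       \<and> (\<forall>F\<in>interface_facets D. \<forall>K\<in>cells D. F facet_of K \<longrightarrow>
            (\<forall>x\<in>F. cell_trace K u x \<bullet> outer_normal K F = ub x \<bullet> outer_normal K F))"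
proof -
  note D = assms(1)
  have X: "u \<in> V_h D" "ub \<in> Vbar_h D" using assms(4) by (auto simp: X_h_def VV_h_def)
  \<comment> \<open>On each cell \<open>u\<close> is replaced by a field that is polynomial on the
    whole space, so that its values and derivatives make sense up to the boundary.\<close>
  have "\<exists>w. K \<in> cells D \<longrightarrow> (\<forall>i. (\<lambda>x. w x $ i) \<in> P (order D) UNIV) \<and> (\<forall>x\<in>interior K. u x = w x)" for K
  proof (cases "K \<in> cells D")
    case True
    then have "u \<in> Pvec (order D) (interior K)" using X(1) by (simp add: V_h_def)
    then show ?thesis by (rule Pvec_extend) auto
  qed simp
  then obtain W where "\<forall>K. K \<in> cells D \<longrightarrow> (\<forall>i. (\<lambda>x. W K x $ i) \<in> P (order D) UNIV) \<and> (\<forall>x\<in>interior K. u x = W K x)"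
    using choice[of "\<lambda>K w. K \<in> cells D \<longrightarrow> (\<forall>i. (\<lambda>x. w x $ i) \<in> P (order D) UNIV) \<and> (\<forall>x\<in>interior K. u x = w x)"] by auto
  then have W: "\<And>K i. K \<in> cells D \<Longrightarrow> (\<lambda>x. W K x $ i) \<in> P (order D) UNIV"
    and uW: "\<And>K x. K \<in> cells D \<Longrightarrow> x \<in> interior K \<Longrightarrow> u x = W K x"
    by auto
  have weak: "(\<Sum>j\<in>sides. b_h D j (q, qb j) u + b_I D j (qb j) ub) = vol_int (region D Darcy) (\<lambda>x. f_d x * q x)"
    if "q \<in> Q_h D" "\<And>j. qb j \<in> Qbar_h D j" for q qb
  proof -
    have "(((\<lambda>x. 0), (\<lambda>x. 0)), (q, qb)) \<in> X_h D"
      using zero_velocity[OF D] that by (simp add: X_h_def QQ_h_def)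
    from assms(5)[OF this] show ?thesis
      unfolding B_h_zero_velocity[OF D] by (simp add: vol_int_def)
  qed
  note setting = D W uW X(2) weak
  have div: "- divergence u x = Pi_Q D (\<lambda>y. chi_d D y * f_d y) x" if "K \<in> cells D" "x \<in> interior K" for K x
    by (rule Pi_Q_eq[OF setting that])
  \<comment> \<open>On Stokes cells \<open>divergence u\<close> vanishes, hence by
    \<open>div\<close> the projection does too, and both sides are zero.\<close>
  have chi: "- divergence u x = chi_d D x * Pi_Q D (\<lambda>y. chi_d D y * f_d y) x"
    if "vol_int (region D Darcy) f_d = 0" and K: "K \<in> cells D" and x: "x \<in> interior K" for K x
  proof (cases "K \<in> mesh D Darcy")
    case True
    then have "chi_d D x = 1" using interior_cell_subset_region[OF D True] x by (auto simp: chi_d_def)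
    then show ?thesis using div[OF K x] by simp
  next
    case False
    then have KS: "K \<in> mesh D Stokes" using K by (simp add: cells_def)
    have "divergence u x = 0" by (rule Stokes_divergence_zero[OF setting that(1) KS x])
    then show ?thesis using div[OF K x] by simp
  qed
  have jump: "normal_jump D u F x = 0" if "F \<in> all_facets D - interface_facets D" "x \<in> F" for F x
    using that by (intro normal_jump_zero[OF setting]) auto
  have flux: "cell_trace K u x \<bullet> outer_normal K F = ub x \<bullet> outer_normal K F"
    if "F \<in> interface_facets D" "K \<in> cells D" "F facet_of K" "x \<in> F" for F K x
    by (rule interface_flux[OF setting that])
  show ?thesis using div chi jump flux by blast
qed

end
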